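(* Let $T>0$, $\psi_0\in H_0^1(\Omega)$, $\psi_1=0$, $\psi_2^{\mathfrak K_1}\in L^2(\Omega)$ and $f\in L^1(0,T;L^2(\Omega))$, all independent of $\tau$. Consider the assumptions: (A0) $\mathfrak K_1\in\mathcal M(0,T)$. (A1) There exists $\tilde{\mathfrak K}_1\in L^q(0,T)$ for some $q>1$ with $\tilde{\mathfrak K}_1*\mathfrak K_1=1$. (A2) There exists $\mathfrak r\in L^1(0,T)$ with $\mathfrak K_2=\mathfrak r*\mathfrak K_1$. (A3) $\int_0^t(\mathfrak r*y)(s)\,y(s)\,ds\ge 0$ for all $t\in(0,T]$, $y\in L^2(0,t)$. (A4) $\int_0^t(\mathfrak K_1*y)(s)\,y(s)\,ds\ge 0$ for all $t\in(0,T]$, $y\in L^2(0,t)$. (A5) There is a constant $C_{\mathfrak K_2}$ such that $\int_0^t(\mathfrak K_2*y_t)(s)\,y(s)\,ds\ge -C_{\mathfrak K_2}|y(0)|^2$ for all $t\in(0,T]$ and all $y\in C[0,t]$ with $\mathfrak K_2*y_t\in L^1(0,t)$. (A5alt) $\mathfrak K_2\in W^{1,1}(0,T)$, $\mathfrak K_2(0)\ge 0$, and $\int_0^t(\mathfrak K_{2}'*y)(s)\,y(s)\,ds\ge 0$ for all $t\in(0,T]$, $y\in L^2(0,t)$. Suppose that one of the following two cases holds: (a) $\mathfrak a>\mathfrak b>0$, (A0)–(A4) hold, at least one of (A5), (A5alt) holds, and $\bar\tau>0$ is arbitrary; or (c) $\mathfrak a,\mathfrak b>0$, $\mathfrak r=1$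 (that is, $\mathfrak K_2=1*\mathfrak K_1$), (A0), (A1) and (A4) hold, and $\bar\tau>0$ is small enough that there is $\underline\delta>0$ with $\frac{\mathfrak a-\mathfrak b}{\mathfrak a}c^2\tau^a+\delta\tau_\theta^b>\underline\delta$ for all $\tau\in(0,\bar\tau]$. For $\tau\in(0,\bar\tau]$ let $\psi^{(\tau)}\in\mathcal X^\infty$ be the solution of the $\tau$-problem $(P_\tau)$, and let $\psi^{(0)}\in L^\infty(0,T;H_0^1(\Omega))\cap W^{1,\infty}(0,T;L^2(\Omega))$ be the solution of the limiting problem $(P_0)$, both problems being defined in the context. Then $$\|\psi^{(\tau)}-\psi^{(0)}\|_{L^\infty(0,T;L^2(\Omega))}=O(\sqrt{\tau^a})\qquad\text{as }\tau\searrow0.$$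
   Context: $\Omega\subset\mathbb R^d$ ($d\ge1$) is a bounded Lipschitz domain, and $c,\delta,\tau_\theta,a>0$, $b\in\mathbb R$ are constants. $(\cdot,\cdot)_{L^2}$ is the inner product of $L^2(\Omega)$. $\mathcal M(0,T)$ is the space of finite (real) measures on the time interval, with total variation norm; point masses at $0$ are allowed, so that $\delta_0\in\mathcal M(0,T)$. $*$ is the Laplace convolution: $(\mathfrak K*g)(t)=\int_0^t\mathfrak K(s)g(t-s)\,ds$ for integrable $\mathfrak K$, and $(\mathfrak K*g)(t)=\int_0^t\mathfrak K(ds)\,g(t-s)$ for $\mathfrak K\in\mathcal M(0,T)$ (mass at $0$ included). In $\tilde{\mathfrak K}_1*\mathfrak K_1=1$ the right-hand side is the constant function $1$. For $u$ with values in a Banach space $Z$, $\mathfrak K*u_t$ is understood in the weak sense: $\mathfrak K*u_t=g$ means that there is a constant $u(0)\in Z$ with $\mathfrak K*(u-u(0))=1*g$ a.e. on $(0,T)$, where $(1*g)(t)=\int_0^tg(s)\,ds$ (for continuous $u$, $u(0)$ is the value at $0$). Likewise $\mathfrak K*\psi_{tt}$ means $\mathfrak K*(\psi_t)_t$. $X_{\mathfrak K}^p(0,T;Z)=\{u\in L^p(0,T;Z): \mathfrak K*u_t\in L^p(0,T;Z)\}$ and $\mathcal X^\infty=\{\psi\in X^\infty_{\tau^a\mathfrak K_1}(0,T;H_0^1(\Omega)): \psi_t\in X^\infty_{\tau^a\mathfrak K_1}(0,T;L^2(\Omega))\}$. Problem $(P_\tau)$: $\psi(0)=\psi_0$, $\psi_t(0)=0$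 and $$-\tau^a\int_0^T(\mathfrak K_1*\psi_{tt},v_t)_{L^2}ds-\int_0^T(\mathfrak a\psi_t,v_t)_{L^2}ds+c^2\int_0^T(\mathfrak b\nabla\psi,\nabla v)_{L^2}ds+\tau^ac^2\int_0^T(\mathfrak K_1*\nabla\psi_t,\nabla v)_{L^2}ds-\tau_\theta^b\delta\int_0^T(\mathfrak K_2*\nabla\psi_t,\nabla v_t)_{L^2}ds=-\tau^a(\psi_2^{\mathfrak K_1},v(0))_{L^2}+\int_0^T(f,v)_{L^2}ds$$ for all $v\in H^1(0,T;H_0^1(\Omega))$ with $v(T)=0$. In both cases (a) and (c), $(P_\tau)$ has a unique solution in $\mathcal X^\infty$ for every $\tau\in(0,\bar\tau]$. Problem $(P_0)$: $\psi^{(0)}(0)=\psi_0$ and $$-\int_0^T(\mathfrak a\psi^{(0)}_t,v_t)_{L^2}ds+c^2\int_0^T(\mathfrak b\nabla\psi^{(0)},\nabla v)_{L^2}ds+\tau_\theta^b\delta\int_0^T(\mathfrak K_2*\nabla\psi^{(0)},\nabla v_{tt})_{L^2}ds=-\tau_\theta^b\delta\int_0^T(\mathfrak K_2\nabla\psi_0,\nabla v_t)_{L^2}ds+\int_0^T(f,v)_{L^2}ds$$ for all $v\in H^2(0,T;H_0^1(\Omega))$ with $v(T)=v_t(T)=0$. (Formally: $\mathfrak a\psi_{tt}-c^2\mathfrak b\Delta\psi-\delta\tau_\theta^b\mathfrak K_2*\Delta\psi_{tt}=f$.) $(P_0)$ is uniquely solvable in the stated space, and $\psi^{(\tau)}$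 converges weakly-$*$ to its solution. *)

theory Defs
  imports "HOL-Probability.Essential_Supremum" "HOL-Library.Landau_Symbols"
begin

section \<open>The Hilbert space of square integrable functions\<close>

definition square_integrable :: "('a::euclidean_space \<Rightarrow> 'b::euclidean_space) \<Rightarrow> bool"
  where "square_integrable f \<longleftrightarrow>
    f \<in> borel_measurable lborel \<and> integrable lborel (\<lambda>x. (norm (f x))\<^sup>2)"

lemma square_integrable_measurable [measurable_dest]:
  "square_integrable f \<Longrightarrow> f \<in> borel_measurable lborel"
  by (simp add: square_integrable_def)

lemma square_integrable_0: "square_integrable (\<lambda>_. 0)"
  by (simp add: square_integrable_def)

lemma square_integrable_scaleR:
  "square_integrable f \<Longrightarrow> square_integrable (\<lambda>x. c *\<^sub>R f x)"
  by (auto simp: square_integrable_def power_mult_distrib)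

lemma square_integrable_uminus:
  "square_integrable f \<Longrightarrow> square_integrable (\<lambda>x. - f x)"
  by (auto simp: square_integrable_def)

lemma norm_add_sq_le: "(norm (x + y))\<^sup>2 \<le> 2 * (norm x)\<^sup>2 + 2 * (norm (y::'a::real_normed_vector))\<^sup>2"
proof -
  have "(norm (x + y))\<^sup>2 \<le> (norm x + norm y)\<^sup>2"
    by (intro power_mono norm_triangle_ineq) auto
  also have "\<dots> \<le> 2 * (norm x)\<^sup>2 + 2 * (norm y)\<^sup>2"
    using zero_le_power2[of "norm x - norm y"] by (simp add: power2_eq_square algebra_simps)
  finally show ?thesis .
qed

lemma square_integrable_add:
  assumes "square_integrable f" "square_integrable g"
  shows "square_integrable (\<lambda>x. f x + g x)"
proof -
  have [measurable]: "f \<in> borel_measurable lborel" "g \<in> borel_measurable lborel"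
    using assms by (auto simp: square_integrable_def)
  have "integrable lborel (\<lambda>x. (norm (f x + g x))\<^sup>2)"
  proof (rule Bochner_Integration.integrable_bound)
    show "integrable lborel (\<lambda>x. 2 * (norm (f x))\<^sup>2 + 2 * (norm (g x))\<^sup>2)"
      using assms by (auto simp: square_integrable_def)
    show "AE x in lborel. norm ((norm (f x + g x))\<^sup>2) \<le> norm (2 * (norm (f x))\<^sup>2 + 2 * (norm (g x))\<^sup>2)"
      using norm_add_sq_le by (auto simp: intro!: always_eventually)
  qed measurable
  then show ?thesis by (simp add: square_integrable_def)
qed

lemma square_integrable_diff:
  "square_integrable f \<Longrightarrow> square_integrable g \<Longrightarrow> square_integrable (\<lambda>x. f x - g x)"
  using square_integrable_add[of f "\<lambda>x. - g x"] square_integrable_uminus[of g] by simp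

lemma square_integrable_inner:
  assumes "square_integrable f" "square_integrable g"
  shows "integrable lborel (\<lambda>x. f x \<bullet> g x)"
proof -
  have [measurable]: "f \<in> borel_measurable lborel" "g \<in> borel_measurable lborel"
    using assms by (auto simp: square_integrable_def)
  have "\<bar>x \<bullet> y\<bar> \<le> (norm x)\<^sup>2 + (norm y)\<^sup>2" for x y :: 'b
  proof -
    have "\<bar>x \<bullet> y\<bar> \<le> norm x * norm y" by (rule Cauchy_Schwarz_ineq2)
    also have "\<dots> \<le> (norm x)\<^sup>2 + (norm y)\<^sup>2"
      using zero_le_power2[of "norm x - norm y"] mult_nonneg_nonneg[OF norm_ge_zero[of x] norm_ge_zero[of y]]
      unfolding power2_diff by linarith
    finally show ?thesis .
  qed
  then have bound: "norm (f x \<bullet> g x) \<le> norm ((norm (f x))\<^sup>2 + (norm (g x))\<^sup>2)" for x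
    by simp
  show ?thesis
  proof (rule Bochner_Integration.integrable_bound)
    show "integrable lborel (\<lambda>x. (norm (f x))\<^sup>2 + (norm (g x))\<^sup>2)"
      using assms by (auto simp: square_integrable_def)
    show "AE x in lborel. norm (f x \<bullet> g x) \<le> norm ((norm (f x))\<^sup>2 + (norm (g x))\<^sup>2)"
      using bound by (intro always_eventually allI)
  qed measurable
qed

text \<open>
  Elements of \<open>('a, 'b) L2\<close> are classes of almost everywhere equal, square integrable functions on
  the whole space. For a domain \<open>\<Omega>\<close>, the space $L^2(\<Omega>)$ is the closed subspace \<open>L2_on \<Omega>\<close> of classes
  that vanish almost everywhere outside \<open>\<Omega>\<close> (extension by zero), with the same inner product.
  Values in a Euclidean space are allowed so that gradients live in \<open>('a, 'a) L2\<close>. The instances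
  \<open>banach\<close> and \<open>second_countable_topology\<close> make Bochner integration available.
\<close>

quotient_type (overloaded) ('a, 'b) L2 = "'a::euclidean_space \<Rightarrow> 'b::euclidean_space" /
  partial: "\<lambda>f g. square_integrable f \<and> square_integrable g \<and> (AE x in lborel. f x = g x)"
proof (rule part_equivpI)
  show "\<exists>f::'a\<Rightarrow>'b. square_integrable f \<and> square_integrable f \<and> (AE x in lborel. f x = f x)"
    by (intro exI[of _ "\<lambda>_. 0"]) (simp add: square_integrable_0)
  show "symp (\<lambda>f g::'a\<Rightarrow>'b. square_integrable f \<and> square_integrable g \<and> (AE x in lborel. f x = g x))"
    by (auto simp: symp_def)
  show "transp (\<lambda>f g::'a\<Rightarrow>'b. square_integrable f \<and> square_integrable g \<and> (AE x in lborel. f x = g x))"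
  proof (rule transpI)
    fix f g h :: "'a \<Rightarrow> 'b"
    assume 1: "square_integrable f \<and> square_integrable g \<and> (AE x in lborel. f x = g x)"
      and 2: "square_integrable g \<and> square_integrable h \<and> (AE x in lborel. g x = h x)"
    have "AE x in lborel. f x = h x"
      using conjunct2[OF conjunct2[OF 1]] conjunct2[OF conjunct2[OF 2]] by eventually_elim simp
    with 1 2 show "square_integrable f \<and> square_integrable h \<and> (AE x in lborel. f x = h x)"
      by blast
  qed
qed

instantiation L2 :: (euclidean_space, euclidean_space) real_inner
begin

lift_definition zero_L2 :: "('a, 'b) L2" is "\<lambda>_. 0"
  by (simp add: square_integrable_0)

lift_definition plus_L2 :: "('a, 'b) L2 \<Rightarrow> ('a, 'b) L2 \<Rightarrow> ('a, 'b) L2" is "\<lambda>f g x. f x + g x"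
  by (auto intro: square_integrable_add)

lift_definition uminus_L2 :: "('a, 'b) L2 \<Rightarrow> ('a, 'b) L2" is "\<lambda>f x. - f x"
  by (auto intro: square_integrable_uminus)

lift_definition minus_L2 :: "('a, 'b) L2 \<Rightarrow> ('a, 'b) L2 \<Rightarrow> ('a, 'b) L2" is "\<lambda>f g x. f x - g x"
  by (auto intro: square_integrable_diff)

lift_definition scaleR_L2 :: "real \<Rightarrow> ('a, 'b) L2 \<Rightarrow> ('a, 'b) L2" is "\<lambda>c f x. c *\<^sub>R f x"
  by (auto intro: square_integrable_scaleR)

lift_definition inner_L2 :: "('a, 'b) L2 \<Rightarrow> ('a, 'b) L2 \<Rightarrow> real" is
  "\<lambda>f g. LINT x|lborel. f x \<bullet> g x"
proof -
  fix f f' g g' :: "'a \<Rightarrow> 'b"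
  assume 1: "square_integrable f \<and> square_integrable f' \<and> (AE x in lborel. f x = f' x)"
    and 2: "square_integrable g \<and> square_integrable g' \<and> (AE x in lborel. g x = g' x)"
  have "AE x in lborel. f x \<bullet> g x = f' x \<bullet> g' x"
    using conjunct2[OF conjunct2[OF 1]] conjunct2[OF conjunct2[OF 2]] by eventually_elim simp
  then show "(LINT x|lborel. f x \<bullet> g x) = (LINT x|lborel. f' x \<bullet> g' x)"
    using 1 2 by (intro integral_cong_AE) (auto simp: square_integrable_def)
qed

definition norm_L2 :: "('a, 'b) L2 \<Rightarrow> real" where "norm_L2 u = sqrt (u \<bullet> u)"
definition sgn_L2 :: "('a, 'b) L2 \<Rightarrow> ('a, 'b) L2" where "sgn_L2 u = inverse (norm u) *\<^sub>R u"
definition dist_L2 :: "('a, 'b) L2 \<Rightarrow> ('a, 'b) L2 \<Rightarrow> real" where "dist_L2 u v = norm (u - v)"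
definition uniformity_L2 :: "(('a, 'b) L2 \<times> ('a, 'b) L2) filter"
  where "uniformity_L2 = (INF e\<in>{0<..}. principal {(u, v). dist u v < e})"
definition open_L2 :: "('a, 'b) L2 set \<Rightarrow> bool"
  where "open_L2 U = (\<forall>x\<in>U. eventually (\<lambda>(x', y). x' = x \<longrightarrow> y \<in> U) uniformity)"

instance
proof
  fix u v w :: "('a, 'b) L2" and r s :: real
  show "u + v + w = u + (v + w)" by transfer (auto simp: add.assoc intro!: square_integrable_add)
  show "u + v = v + u" by transfer (auto simp: add.commute intro!: square_integrable_add)
  show "0 + u = u" by transfer auto
  show "- u + u = 0" by transfer (auto intro: square_integrable_0)
  show "u - v = u + - v"
    by transfer (auto intro!: square_integrable_add square_integrable_diff square_integrable_uminus)
  show "r *\<^sub>R (u + v) = r *\<^sub>R u + r *\<^sub>R v"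
    by transfer (auto simp: algebra_simps intro!: square_integrable_add square_integrable_scaleR)
  show "(r + s) *\<^sub>R u = r *\<^sub>R u + s *\<^sub>R u"
    by transfer (auto simp: algebra_simps intro!: square_integrable_add square_integrable_scaleR)
  show "r *\<^sub>R s *\<^sub>R u = (r * s) *\<^sub>R u"
    by transfer (auto intro!: square_integrable_scaleR)
  show "1 *\<^sub>R u = u" by transfer auto
  show "dist u v = norm (u - v)" by (rule dist_L2_def)
  show "sgn u = inverse (norm u) *\<^sub>R u" by (rule sgn_L2_def)
  show "(uniformity :: (('a, 'b) L2 \<times> ('a, 'b) L2) filter) = (INF e\<in>{0<..}. principal {(u, v). dist u v < e})"
    by (rule uniformity_L2_def)
  show "open U = (\<forall>x\<in>U. \<forall>\<^sub>F (x', y) in uniformity. x' = x \<longrightarrow> y \<in> U)" for U :: "('a, 'b) L2 set"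
    by (rule open_L2_def)
  show "u \<bullet> v = v \<bullet> u" by transfer (simp add: inner_commute)
  show "(u + v) \<bullet> w = u \<bullet> w + v \<bullet> w"
    by transfer (simp add: inner_add_left square_integrable_inner)
  show "r *\<^sub>R u \<bullet> v = r * (u \<bullet> v)" by transfer simp
  show "0 \<le> u \<bullet> u" by transfer simp
  show "u \<bullet> u = 0 \<longleftrightarrow> u = 0"
    by transfer (auto simp: square_integrable_0 square_integrable_inner integral_nonneg_eq_0_iff_AE)
  show "norm u = sqrt (u \<bullet> u)" by (rule norm_L2_def)
qed

end

lemma square_integrable_rep_L2: "square_integrable (rep_L2 u)"
  using Quotient_rep_reflp[OF Quotient_L2, of u] by simp

lemma abs_rep_L2: "abs_L2 (rep_L2 u) = u"
  by (rule Quotient_abs_rep[OF Quotient_L2])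

lemma abs_L2_eq_iff:
  "square_integrable f \<Longrightarrow> square_integrable g \<Longrightarrow> abs_L2 f = abs_L2 g \<longleftrightarrow> (AE x in lborel. f x = g x)"
  using Quotient_rel[OF Quotient_L2, of f g] by auto

lemma rep_abs_L2: "square_integrable f \<Longrightarrow> AE x in lborel. rep_L2 (abs_L2 f) x = f x"
  using Quotient_rep_abs[OF Quotient_L2, of f] by auto

lemma inner_abs_L2:
  "square_integrable f \<Longrightarrow> square_integrable g \<Longrightarrow> abs_L2 f \<bullet> abs_L2 g = (LINT x|lborel. f x \<bullet> g x)"
  by (rule inner_L2.abs_eq) auto

lemma diff_abs_L2:
  "square_integrable f \<Longrightarrow> square_integrable g \<Longrightarrow> abs_L2 f - abs_L2 g = abs_L2 (\<lambda>x. f x - g x)"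
  by (rule minus_L2.abs_eq) auto

lemma add_abs_L2:
  "square_integrable f \<Longrightarrow> square_integrable g \<Longrightarrow> abs_L2 f + abs_L2 g = abs_L2 (\<lambda>x. f x + g x)"
  by (rule plus_L2.abs_eq) auto

lemma scaleR_abs_L2:
  "square_integrable f \<Longrightarrow> c *\<^sub>R abs_L2 f = abs_L2 (\<lambda>x. c *\<^sub>R f x)"
  by (rule scaleR_L2.abs_eq) auto

lemma norm_abs_L2_nn_integral:
  assumes "square_integrable f"
  shows "ennreal ((norm (abs_L2 f))\<^sup>2) = (\<integral>\<^sup>+x. ennreal ((norm (f x))\<^sup>2) \<partial>lborel)"
proof -
  have "(norm (abs_L2 f))\<^sup>2 = (LINT x|lborel. (norm (f x))\<^sup>2)"
    using assms by (simp add: norm_L2_def inner_abs_L2 dot_square_norm[symmetric])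
  then show ?thesis
    using assms by (subst nn_integral_eq_integral) (auto simp: square_integrable_def)
qed

lemma norm_diff_L2_nn_integral:
  assumes "square_integrable f" "square_integrable g"
  shows "ennreal ((norm (abs_L2 f - abs_L2 g))\<^sup>2) = (\<integral>\<^sup>+x. ennreal ((norm (f x - g x))\<^sup>2) \<partial>lborel)"
  using assms by (simp add: diff_abs_L2 norm_abs_L2_nn_integral square_integrable_diff)

lemma tendsto_abs_L2I:
  assumes "\<And>n. square_integrable (f n)" "square_integrable g"
    and lim: "(\<lambda>n. \<integral>\<^sup>+x. ennreal ((norm (f n x - g x))\<^sup>2) \<partial>lborel) \<longlonglongrightarrow> 0"
  shows "(\<lambda>n. abs_L2 (f n)) \<longlonglongrightarrow> abs_L2 g"
proof -
  have "(\<lambda>n. ennreal ((norm (abs_L2 (f n) - abs_L2 g))\<^sup>2)) \<longlonglongrightarrow> ennreal 0"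
    using lim assms by (simp add: norm_diff_L2_nn_integral)
  then have "(\<lambda>n. (norm (abs_L2 (f n) - abs_L2 g))\<^sup>2) \<longlonglongrightarrow> 0"
    by (subst (asm) tendsto_ennreal_iff) auto
  then have "(\<lambda>n. norm (abs_L2 (f n) - abs_L2 g)) \<longlonglongrightarrow> 0"
    using tendsto_real_sqrt[of "\<lambda>n. (norm (abs_L2 (f n) - abs_L2 g))\<^sup>2" 0] by simp
  then show ?thesis
    using LIM_zero_iff tendsto_norm_zero_iff by blast
qed

instance L2 :: (euclidean_space, euclidean_space) banach
proof
  fix X :: "nat \<Rightarrow> ('a, 'b) L2"
  assume X: "Cauchy X"
  define e :: "nat \<Rightarrow> real" where "e k = (1/2) ^ k" for k
  have e_pos: "e k > 0" for k by (simp add: e_def)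
  have "\<exists>r::nat \<Rightarrow> nat. \<forall>k. (\<forall>m\<ge>r k. \<forall>n\<ge>r k. dist (X m) (X n) < e k) \<and> r k < r (Suc k)"
  proof (rule dependent_nat_choice)
    show "\<exists>N. \<forall>m\<ge>N. \<forall>n\<ge>N. dist (X m) (X n) < e 0"
      using X e_pos[of 0] unfolding Cauchy_def by blast
    fix N k
    obtain M where M: "\<forall>m\<ge>M. \<forall>n\<ge>M. dist (X m) (X n) < e (Suc k)"
      using X e_pos[of "Suc k"] unfolding Cauchy_def by blast
    show "\<exists>M. (\<forall>m\<ge>M. \<forall>n\<ge>M. dist (X m) (X n) < e (Suc k)) \<and> N < M"
      by (rule exI[of _ "max M (Suc N)"]) (use M in auto)
  qed
  then obtain r where r: "\<And>k m n. m \<ge> r k \<Longrightarrow> n \<ge> r k \<Longrightarrow> dist (X m) (X n) < e k"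
    and r_Suc: "\<And>k. r k < r (Suc k)" by metis
  have r_mono: "strict_mono r" using r_Suc by (simp add: strict_mono_Suc_iff)
  define F where "F k = rep_L2 (X (r k))" for k
  have sqF: "square_integrable (F k)" for k
    by (simp add: F_def square_integrable_rep_L2)
  have [measurable]: "F k \<in> borel_measurable lborel" for k
    using sqF by (simp add: square_integrable_def)
  have XF: "X (r k) = abs_L2 (F k)" for k by (simp add: F_def abs_rep_L2)
  have close: "(\<integral>\<^sup>+x. ennreal ((norm (F m x - F n x))\<^sup>2) \<partial>lborel) \<le> ennreal ((e k)\<^sup>2)"
    if "k \<le> m" "k \<le> n" for k m n
  proof -
    have "r k \<le> r m" "r k \<le> r n" using that r_mono by (simp_all add: strict_mono_less_eq)
    then have "norm (abs_L2 (F m) - abs_L2 (F n)) \<le> e k"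
      using r[of k "r m" "r n"] by (simp add: XF dist_norm)
    then show ?thesis
      by (subst norm_diff_L2_nn_integral[OF sqF sqF, symmetric]) (simp add: ennreal_leI power_mono)
  qed
  define w where "w x = (\<Sum>k. ennreal (2 ^ k) * ennreal ((norm (F (Suc k) x - F k x))\<^sup>2))" for x
  have "(\<integral>\<^sup>+x. w x \<partial>lborel)
      = (\<Sum>k. \<integral>\<^sup>+x. ennreal (2 ^ k) * ennreal ((norm (F (Suc k) x - F k x))\<^sup>2) \<partial>lborel)"
    unfolding w_def by (subst nn_integral_suminf) auto
  also have "\<dots> = (\<Sum>k. ennreal (2 ^ k) * (\<integral>\<^sup>+x. ennreal ((norm (F (Suc k) x - F k x))\<^sup>2) \<partial>lborel))"
    by (intro suminf_cong nn_integral_cmult) auto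
  also have "\<dots> \<le> (\<Sum>k. ennreal ((1/2) ^ k))"
  proof (intro suminf_le allI)
    fix k
    have "ennreal (2 ^ k) * (\<integral>\<^sup>+x. ennreal ((norm (F (Suc k) x - F k x))\<^sup>2) \<partial>lborel)
        \<le> ennreal (2 ^ k) * ennreal ((e k)\<^sup>2)"
      by (intro mult_left_mono close) auto
    also have "\<dots> = ennreal ((1/2) ^ k)"
      by (simp add: ennreal_mult'[symmetric] e_def power2_eq_square flip: power_mult_distrib mult.assoc)
    finally show "ennreal (2 ^ k) * (\<integral>\<^sup>+x. ennreal ((norm (F (Suc k) x - F k x))\<^sup>2) \<partial>lborel)
        \<le> ennreal ((1/2) ^ k)" .
  qed auto
  also have "\<dots> = ennreal (\<Sum>k. (1/2) ^ k)"
    by (rule suminf_ennreal2) (auto simp: summable_geometric)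
  also have "\<dots> < \<infinity>" by simp
  finally have "AE x in lborel. w x \<noteq> \<infinity>"
    by (intro nn_integral_PInf_AE) (auto simp: w_def)
  then have conv: "AE x in lborel. convergent (\<lambda>k. F k x)"
  proof eventually_elim
    fix x assume wx: "w x \<noteq> \<infinity>"
    define C where "C = enn2real (w x)"
    have C: "norm (F (Suc k) x - F k x) \<le> sqrt C * sqrt (1/2) ^ k" for k
    proof -
      have "ennreal (2 ^ k) * ennreal ((norm (F (Suc k) x - F k x))\<^sup>2) \<le> w x"
        unfolding w_def
        using sum_le_suminf[of "\<lambda>k. ennreal (2 ^ k) * ennreal ((norm (F (Suc k) x - F k x))\<^sup>2)" "{k}"]
        by auto
      also have "w x = ennreal C" using wx by (simp add: C_def less_top)
      finally have "2 ^ k * (norm (F (Suc k) x - F k x))\<^sup>2 \<le> C"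
        by (simp add: ennreal_mult'[symmetric] C_def)
      then have "(norm (F (Suc k) x - F k x))\<^sup>2 \<le> C * (1/2) ^ k"
        by (simp add: field_simps)
      then have "norm (F (Suc k) x - F k x) \<le> sqrt (C * (1/2) ^ k)"
        by (rule real_le_rsqrt)
      then show ?thesis by (simp add: real_sqrt_mult real_sqrt_power)
    qed
    have "summable (\<lambda>k. sqrt C * sqrt (1/2) ^ k)"
      by (intro summable_mult summable_geometric) (simp add: real_sqrt_divide)
    then have "summable (\<lambda>k. F (Suc k) x - F k x)"
      by (rule summable_comparison_test'[of _ 0]) (use C in auto)
    then have "convergent (\<lambda>n. \<Sum>k<n. F (Suc k) x - F k x)"
      by (simp add: summable_iff_convergent)
    moreover have "(\<Sum>k<n. F (Suc k) x - F k x) = F n x - F 0 x" for n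
      by (induction n) auto
    ultimately show "convergent (\<lambda>k. F k x)"
      by (simp add: convergent_diff_const_right_iff)
  qed
  define G where "G x = lim (\<lambda>k. F k x)" for x
  have [measurable]: "G \<in> borel_measurable lborel"
    unfolding G_def by measurable
  have lim: "AE x in lborel. (\<lambda>k. F k x) \<longlonglongrightarrow> G x"
    using conv by eventually_elim (auto simp: G_def convergent_LIMSEQ_iff)
  have bound: "(\<integral>\<^sup>+x. ennreal ((norm (F k x - G x))\<^sup>2) \<partial>lborel) \<le> ennreal ((e k)\<^sup>2)" for k
  proof -
    have "(\<integral>\<^sup>+x. ennreal ((norm (F k x - G x))\<^sup>2) \<partial>lborel)
        = (\<integral>\<^sup>+x. liminf (\<lambda>m. ennreal ((norm (F k x - F m x))\<^sup>2)) \<partial>lborel)"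
    proof (rule nn_integral_cong_AE)
      show "AE x in lborel. ennreal ((norm (F k x - G x))\<^sup>2) = liminf (\<lambda>m. ennreal ((norm (F k x - F m x))\<^sup>2))"
        using lim
      proof eventually_elim
        fix x assume "(\<lambda>k. F k x) \<longlonglongrightarrow> G x"
        then have "(\<lambda>m. ennreal ((norm (F k x - F m x))\<^sup>2)) \<longlonglongrightarrow> ennreal ((norm (F k x - G x))\<^sup>2)"
          by (intro tendsto_intros)
        then show "ennreal ((norm (F k x - G x))\<^sup>2) = liminf (\<lambda>m. ennreal ((norm (F k x - F m x))\<^sup>2))"
          using lim_imp_Liminf[OF sequentially_bot] by fastforce
      qed
    qed
    also have "\<dots> \<le> liminf (\<lambda>m. \<integral>\<^sup>+x. ennreal ((norm (F k x - F m x))\<^sup>2) \<partial>lborel)"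
      by (rule nn_integral_liminf) auto
    also have "\<dots> \<le> ennreal ((e k)\<^sup>2)"
    proof (rule Liminf_le)
      show "\<forall>\<^sub>F m in sequentially. (\<integral>\<^sup>+x. ennreal ((norm (F k x - F m x))\<^sup>2) \<partial>lborel) \<le> ennreal ((e k)\<^sup>2)"
        using eventually_ge_at_top[of k] by eventually_elim (auto intro: close)
    qed auto
    finally show ?thesis .
  qed
  have "square_integrable (\<lambda>x. F 0 x - G x)"
    unfolding square_integrable_def
    using le_less_trans[OF bound[of 0]] by (auto intro!: integrableI_bounded simp: ennreal_less_top)
  then have "square_integrable (\<lambda>x. F 0 x - (F 0 x - G x))"
    by (rule square_integrable_diff[OF sqF])
  moreover have "(\<lambda>x. F 0 x - (F 0 x - G x)) = G" by (simp add: fun_eq_iff)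
  ultimately have sqG: "square_integrable G" by simp
  have "(\<lambda>k. \<integral>\<^sup>+x. ennreal ((norm (F k x - G x))\<^sup>2) \<partial>lborel) \<longlonglongrightarrow> 0"
  proof (rule tendsto_sandwich[of "\<lambda>_. 0"])
    have "(\<lambda>k. (1/4::real) ^ k) \<longlonglongrightarrow> 0" by (rule LIMSEQ_power_zero) simp
    then have "(\<lambda>k. ennreal ((1/4) ^ k)) \<longlonglongrightarrow> ennreal 0" by (intro tendsto_ennrealI)
    moreover have "(e k)\<^sup>2 = (1/4) ^ k" for k
      by (simp add: e_def power2_eq_square flip: power_mult_distrib)
    ultimately show "(\<lambda>k. ennreal ((e k)\<^sup>2)) \<longlonglongrightarrow> 0" by simp
  qed (use bound in auto)
  then have "(\<lambda>k. X (r k)) \<longlonglongrightarrow> abs_L2 G"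
    unfolding XF by (intro tendsto_abs_L2I sqF sqG)
  then have "X \<longlonglongrightarrow> abs_L2 G"
    by (intro Cauchy_converges_subseq[OF X r_mono]) (simp add: comp_def)
  then show "convergent X" by (auto simp: convergent_def)
qed

lemma countable_subbasis_if_dense:
  fixes C :: "'a::metric_space set"
  assumes "countable C" and dense: "closure C = UNIV"
  shows "\<exists>B::'a set set. countable B \<and> open = generate_topology B"
proof -
  define B where "B = (\<lambda>(c, n). ball c (1 / real (Suc n))) ` (C \<times> (UNIV :: nat set))"
  have "countable B" using assms by (auto simp: B_def)
  moreover have "topological_basis B"
  proof (rule topological_basisI)
    show "open b" if "b \<in> B" for b using that by (auto simp: B_def)
    fix U and x :: 'a assume "open U" "x \<in> U"
    then obtain d where d: "d > 0" "ball x d \<subseteq> U" by (auto simp: open_contains_ball)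
    obtain n where n: "1 / real (Suc n) < d / 2"
      using d reals_Archimedean[of "d / 2"] by (auto simp: inverse_eq_divide)
    have "x \<in> closure C" using dense by simp
    then obtain c where c: "c \<in> C" "dist c x < 1 / real (Suc n)"
      unfolding closure_approachable by (meson of_nat_0_less_iff zero_less_Suc zero_less_divide_1_iff)
    have "ball c (1 / real (Suc n)) \<subseteq> ball x d"
    proof
      fix y assume "y \<in> ball c (1 / real (Suc n))"
      then show "y \<in> ball x d" using n c dist_triangle[of x y c] by (auto simp: dist_commute)
    qed
    with c d show "\<exists>b\<in>B. x \<in> b \<and> b \<subseteq> U"
      by (auto simp: B_def intro!: bexI[of _ "ball c (1 / real (Suc n))"])
  qed
  ultimately show ?thesis using topological_basis_imp_subbasis by blast
qed

lemma closure_rational_combinations: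
  fixes D :: "'a::real_normed_vector set"
  assumes "countable D"
  obtains C where "countable C" "subspace (closure C)" "D \<subseteq> closure C"
proof -
  define comb :: "(rat \<times> 'a) list \<Rightarrow> 'a"
    where "comb xs = (\<Sum>(q, d)\<leftarrow>xs. real_of_rat q *\<^sub>R d)" for xs
  define C where "C = comb ` lists (UNIV \<times> D)"
  have "countable C"
    using assms by (auto simp: C_def intro!: countable_image countable_lists)
  have C_0: "0 \<in> C"
    unfolding C_def by (rule image_eqI[of _ _ "[]"]) (auto simp: comb_def)
  have C_add: "x + y \<in> C" if xy: "x \<in> C" "y \<in> C" for x y
  proof -
    obtain xs ys where "xs \<in> lists (UNIV \<times> D)" "x = comb xs" "ys \<in> lists (UNIV \<times> D)" "y = comb ys"
      using xy unfolding C_def by blast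
    then show ?thesis
      unfolding C_def by (intro image_eqI[of _ _ "xs @ ys"]) (auto simp: comb_def)
  qed
  have C_scale: "real_of_rat q *\<^sub>R x \<in> C" if x: "x \<in> C" for q x
  proof -
    obtain xs where xs: "xs \<in> lists (UNIV \<times> D)" "x = comb xs"
      using x unfolding C_def by blast
    have "real_of_rat q *\<^sub>R comb xs = comb (map (\<lambda>(r, d). (q * r, d)) xs)"
      unfolding comb_def by (induction xs) (auto simp: scaleR_add_right of_rat_mult)
    then show ?thesis
      unfolding C_def using xs by (intro image_eqI[of _ _ "map (\<lambda>(r, d). (q * r, d)) xs"]) auto
  qed
  have "subspace (closure C)"
  proof (rule subspaceI)
    show "0 \<in> closure C" using C_0 closure_subset by blast
  next
    fix x y assume "x \<in> closure C" "y \<in> closure C"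
    then obtain f g where f: "\<And>n. f n \<in> C" "f \<longlonglongrightarrow> x" and g: "\<And>n. g n \<in> C" "g \<longlonglongrightarrow> y"
      unfolding closure_sequential by blast
    have "(\<lambda>n. f n + g n) \<longlonglongrightarrow> x + y" by (intro tendsto_intros f g)
    then show "x + y \<in> closure C"
      unfolding closure_sequential using C_add f g by (intro exI[of _ "\<lambda>n. f n + g n"]) auto
  next
    fix x and c :: real assume "x \<in> closure C"
    then obtain f where f: "\<And>n. f n \<in> C" "f \<longlonglongrightarrow> x"
      unfolding closure_sequential by blast
    have "\<exists>q. \<bar>real_of_rat q - c\<bar> < 1 / real (Suc n)" for n
    proof -
      obtain q where "c < real_of_rat q" "real_of_rat q < c + 1 / real (Suc n)"
        using of_rat_dense[of c "c + 1 / real (Suc n)"] by auto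
      then show ?thesis by (intro exI[of _ q]) auto
    qed
    then obtain q where q: "\<And>n. \<bar>real_of_rat (q n) - c\<bar> < 1 / real (Suc n)" by metis
    have "(\<lambda>n. real_of_rat (q n) - c) \<longlonglongrightarrow> 0"
    proof (rule Lim_null_comparison)
      show "\<forall>\<^sub>F n in sequentially. norm (real_of_rat (q n) - c) \<le> 1 / real (Suc n)"
        using q by (auto intro!: always_eventually less_imp_le)
      show "(\<lambda>n. 1 / real (Suc n)) \<longlonglongrightarrow> 0" using LIMSEQ_inverse_real_of_nat
        by (simp add: inverse_eq_divide)
    qed
    then have "(\<lambda>n. real_of_rat (q n)) \<longlonglongrightarrow> c" using LIM_zero_iff by blast
    then have "(\<lambda>n. real_of_rat (q n) *\<^sub>R f n) \<longlonglongrightarrow> c *\<^sub>R x" by (intro tendsto_intros f)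
    then show "c *\<^sub>R x \<in> closure C"
      unfolding closure_sequential using C_scale f
      by (intro exI[of _ "\<lambda>n. real_of_rat (q n) *\<^sub>R f n"]) auto
  qed
  moreover have "D \<subseteq> C"
  proof
    fix d assume "d \<in> D"
    then show "d \<in> C"
      unfolding C_def by (intro image_eqI[of _ _ "[(1, d)]"]) (auto simp: comb_def)
  qed
  ultimately show thesis
    using that[of C] \<open>countable C\<close> closure_subset by blast
qed

lemma square_integrable_indicator:
  "A \<in> sets borel \<Longrightarrow> emeasure lborel A < \<infinity> \<Longrightarrow> square_integrable (\<lambda>x. indicator A x *\<^sub>R y)"
proof -
  assume A: "A \<in> sets borel" "emeasure lborel A < \<infinity>"
  have "(\<lambda>x. (norm (indicator A x *\<^sub>R y))\<^sup>2) = (\<lambda>x. indicator A x * (norm y)\<^sup>2)"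
    by (auto simp: indicator_def)
  with A show ?thesis by (auto simp: square_integrable_def)
qed

lemma tendsto_indicator_L2I:
  assumes A: "\<And>n. A n \<in> sets borel" "\<And>n. emeasure lborel (A n) < \<infinity>"
    and B: "B \<in> sets borel" "emeasure lborel B < \<infinity>"
    and lim: "(\<lambda>n. emeasure lborel ((A n - B) \<union> (B - A n))) \<longlonglongrightarrow> 0"
  shows "(\<lambda>n. abs_L2 (\<lambda>x. indicator (A n) x *\<^sub>R y)) \<longlonglongrightarrow> abs_L2 (\<lambda>x. indicator B x *\<^sub>R y)"
proof (rule tendsto_abs_L2I)
  have "(\<integral>\<^sup>+x. ennreal ((norm (indicator (A n) x *\<^sub>R y - indicator B x *\<^sub>R y))\<^sup>2) \<partial>lborel)
      = ennreal ((norm y)\<^sup>2) * emeasure lborel ((A n - B) \<union> (B - A n))" for n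
  proof -
    have "(\<integral>\<^sup>+x. ennreal ((norm (indicator (A n) x *\<^sub>R y - indicator B x *\<^sub>R y))\<^sup>2) \<partial>lborel)
      = (\<integral>\<^sup>+x. ennreal ((norm y)\<^sup>2) * indicator ((A n - B) \<union> (B - A n)) x \<partial>lborel)"
      by (intro nn_integral_cong) (auto simp: indicator_def)
    also have "\<dots> = ennreal ((norm y)\<^sup>2) * emeasure lborel ((A n - B) \<union> (B - A n))"
      using A B by (intro nn_integral_cmult_indicator) auto
    finally show ?thesis .
  qed
  moreover have "(\<lambda>n. ennreal ((norm y)\<^sup>2) * emeasure lborel ((A n - B) \<union> (B - A n)))
      \<longlonglongrightarrow> ennreal ((norm y)\<^sup>2) * 0"
    by (intro ennreal_tendsto_cmult lim) auto
  ultimately show "(\<lambda>n. \<integral>\<^sup>+x. ennreal ((norm (indicator (A n) x *\<^sub>R y - indicator B x *\<^sub>R y))\<^sup>2) \<partial>lborel)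
      \<longlonglongrightarrow> 0"
    by simp
qed (use A B in \<open>auto intro!: square_integrable_indicator\<close>)

instance L2 :: (euclidean_space, euclidean_space) second_countable_topology
proof
  obtain \<B> :: "'a set set" where \<B>: "countable \<B>" "topological_basis \<B>"
    using ex_countable_basis by blast
  define \<U> where "\<U> = Union ` {F. finite F \<and> F \<subseteq> \<B>}"
  have \<U>: "countable \<U>"
    using \<B> by (simp add: \<U>_def countable_Collect_finite_subset)
  have \<U>_open: "open U" if "U \<in> \<U>" for U
    using that topological_basis_open[OF \<B>(2)] by (auto simp: \<U>_def)
  define D :: "('a, 'b) L2 set" where
    "D = (\<lambda>(U, b). abs_L2 (\<lambda>x. indicator U x *\<^sub>R b)) ` ({U\<in>\<U>. emeasure lborel U < \<infinity>} \<times> Basis)"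
  have "countable D"
    unfolding D_def using \<U>
    by (intro countable_image countable_SIGMA) (auto simp: countable_finite intro: countable_subset)
  then obtain C where C: "countable C" "subspace (closure C)" "D \<subseteq> closure C"
    by (rule closure_rational_combinations)
  have lim_in: "x \<in> closure C" if "\<And>n. f n \<in> closure C" "f \<longlonglongrightarrow> x" for f x
    using that closed_sequentially[of "closure C"] by blast
  have open_in: "abs_L2 (\<lambda>x. indicator U x *\<^sub>R b) \<in> closure C"
    if U: "open U" "emeasure lborel U < \<infinity>" and b: "b \<in> Basis" for U b
  proof -
    obtain F where F: "F \<subseteq> \<B>" "\<Union>F = U"
      using U \<B>(2) unfolding topological_basis_def by blast
    have cF: "countable F" using F \<B> countable_subset by blast
    define S where "S n = \<Union>{X \<in> F. to_nat_on F X < n}" for n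
    have S_in: "S n \<in> \<U>" for n
    proof -
      have "finite {X \<in> F. to_nat_on F X < n}"
        by (rule finite_imageD[of "to_nat_on F"])
          (auto intro: finite_subset[of _ "{..<n}"] inj_on_subset[OF inj_on_to_nat_on[OF cF]])
      then show ?thesis using F by (auto simp: S_def \<U>_def)
    qed
    have S_sub: "S n \<subseteq> U" for n using F by (auto simp: S_def)
    have S_UN: "(\<Union>n. S n) = U"
    proof
      show "(\<Union>n. S n) \<subseteq> U" using S_sub by blast
      show "U \<subseteq> (\<Union>n. S n)"
      proof
        fix x assume "x \<in> U"
        then obtain X where "X \<in> F" "x \<in> X" using F by blast
        then have "x \<in> S (Suc (to_nat_on F X))" by (auto simp: S_def)
        then show "x \<in> (\<Union>n. S n)" by blast
      qed
    qed
    have S_mono: "S m \<subseteq> S n" if "m \<le> n" for m n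
      using that by (fastforce simp: S_def)
    have S_borel: "S n \<in> sets borel" for n using \<U>_open[OF S_in] by simp
    have S_fin: "emeasure lborel (S n) < \<infinity>" for n
      using le_less_trans[OF emeasure_mono[OF S_sub[of n], of lborel] U(2)] U by simp
    have "(\<lambda>n. emeasure lborel (U - S n)) \<longlonglongrightarrow> emeasure lborel (\<Inter>n. U - S n)"
    proof (rule Lim_emeasure_decseq)
      show "decseq (\<lambda>n. U - S n)" using S_mono by (simp add: decseq_def) blast
      show "range (\<lambda>n. U - S n) \<subseteq> sets lborel" using U S_borel by auto
      show "emeasure lborel (U - S n) \<noteq> \<infinity>" for n
        using le_less_trans[OF emeasure_mono[of "U - S n" U lborel] U(2)] U by auto
    qed
    moreover have "(\<Inter>n. U - S n) = {}" using S_UN by auto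
    ultimately have "(\<lambda>n. emeasure lborel ((S n - U) \<union> (U - S n))) \<longlonglongrightarrow> 0"
      using S_sub by (simp add: Diff_eq_empty_iff[THEN iffD2])
    then have "(\<lambda>n. abs_L2 (\<lambda>x. indicator (S n) x *\<^sub>R b)) \<longlonglongrightarrow> abs_L2 (\<lambda>x. indicator U x *\<^sub>R b)"
      by (intro tendsto_indicator_L2I S_borel S_fin) (use U in auto)
    moreover have "abs_L2 (\<lambda>x. indicator (S n) x *\<^sub>R b) \<in> closure C" for n
    proof (rule subsetD[OF C(3)])
      have "(S n, b) \<in> {U\<in>\<U>. emeasure lborel U < \<infinity>} \<times> Basis"
        using S_in[of n] S_fin[of n] b by blast
      then show "abs_L2 (\<lambda>x. indicator (S n) x *\<^sub>R b) \<in> D"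
        unfolding D_def by (rule rev_image_eqI) simp
    qed
    ultimately show ?thesis by (rule lim_in[rotated])
  qed
  have Basis_in: "abs_L2 (\<lambda>x. indicator A x *\<^sub>R b) \<in> closure C"
    if A: "A \<in> sets borel" "emeasure lborel A < \<infinity>" and b: "b \<in> Basis" for A b
  proof -
    have "\<exists>U. open U \<and> A \<subseteq> U \<and> emeasure lborel (U - A) < ennreal (1 / real (Suc n))" for n
    proof -
      obtain U where "open U" "A \<subseteq> U" "emeasure lebesgue (U - A) < ennreal (1 / real (Suc n))"
        using sets_lebesgue_outer_open[of A "1 / real (Suc n)"] A by auto
      then show ?thesis using A by (intro exI[of _ U]) auto
    qed
    then obtain U where U: "\<And>n. open (U n)" "\<And>n. A \<subseteq> U n"
      "\<And>n. emeasure lborel (U n - A) < ennreal (1 / real (Suc n))" by metis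
    have U_fin: "emeasure lborel (U n) < \<infinity>" for n
    proof -
      have "emeasure lborel (U n) \<le> emeasure lborel A + emeasure lborel (U n - A)"
        using emeasure_subadditive[of A lborel "U n - A"] A U[of n] by (simp add: Un_absorb1)
      also have "\<dots> < \<infinity>"
        using A less_trans[OF U(3)[of n] ennreal_less_top] by simp
      finally show ?thesis .
    qed
    have "(\<lambda>n. emeasure lborel (U n - A)) \<longlonglongrightarrow> 0"
    proof (rule tendsto_sandwich[of "\<lambda>_. 0"])
      have "(\<lambda>n. ennreal (1 / real (Suc n))) \<longlonglongrightarrow> ennreal 0"
        using LIMSEQ_inverse_real_of_nat by (intro tendsto_ennrealI) (simp add: inverse_eq_divide)
      then show "(\<lambda>n. ennreal (1 / real (Suc n))) \<longlonglongrightarrow> 0" by simp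
    qed (use U(3) in \<open>auto intro!: always_eventually less_imp_le\<close>)
    then have "(\<lambda>n. emeasure lborel ((U n - A) \<union> (A - U n))) \<longlonglongrightarrow> 0"
      using U(2) by (simp add: Diff_eq_empty_iff[THEN iffD2])
    then have "(\<lambda>n. abs_L2 (\<lambda>x. indicator (U n) x *\<^sub>R b)) \<longlonglongrightarrow> abs_L2 (\<lambda>x. indicator A x *\<^sub>R b)"
      by (intro tendsto_indicator_L2I U_fin) (use U A in auto)
    then show ?thesis by (rule lim_in[rotated]) (rule open_in[OF U(1) U_fin b])
  qed
  have indicator_in: "abs_L2 (\<lambda>x. indicator A x *\<^sub>R y) \<in> closure C"
    if A: "A \<in> sets borel" "emeasure lborel A < \<infinity>" for A y
  proof -
    have sum_sq: "square_integrable (\<lambda>x. \<Sum>b\<in>I. indicator A x *\<^sub>R c b *\<^sub>R b) \<and>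
      abs_L2 (\<lambda>x. \<Sum>b\<in>I. indicator A x *\<^sub>R c b *\<^sub>R b) \<in> closure C"
      if "finite I" "I \<subseteq> Basis" for I and c :: "'b \<Rightarrow> real"
      using that
    proof (induction I)
      case empty
      show ?case using subspace_0[OF C(2)]
        by (auto simp: square_integrable_0 zero_L2.abs_eq[symmetric])
    next
      case (insert b I)
      have 1: "square_integrable (\<lambda>x. indicator A x *\<^sub>R c b *\<^sub>R b)"
        by (rule square_integrable_indicator[OF A])
      have "abs_L2 (\<lambda>x. indicator A x *\<^sub>R c b *\<^sub>R b) = c b *\<^sub>R abs_L2 (\<lambda>x. indicator A x *\<^sub>R b)"
        by (subst scaleR_abs_L2) (auto simp: square_integrable_indicator[OF A] mult.commute)
      moreover have "\<dots> \<in> closure C"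
        using Basis_in[OF A] insert by (intro subspace_scale[OF C(2)]) auto
      ultimately have 2: "abs_L2 (\<lambda>x. indicator A x *\<^sub>R c b *\<^sub>R b) \<in> closure C" by simp
      from insert have IH: "square_integrable (\<lambda>x. \<Sum>b\<in>I. indicator A x *\<^sub>R c b *\<^sub>R b)"
        "abs_L2 (\<lambda>x. \<Sum>b\<in>I. indicator A x *\<^sub>R c b *\<^sub>R b) \<in> closure C" by auto
      have eq: "(\<lambda>x. \<Sum>b\<in>insert b I. indicator A x *\<^sub>R c b *\<^sub>R b)
          = (\<lambda>x. indicator A x *\<^sub>R c b *\<^sub>R b + (\<Sum>b\<in>I. indicator A x *\<^sub>R c b *\<^sub>R b))"
        by (simp only: sum.insert[OF insert.hyps(1,2)])
      show ?case
        unfolding eq add_abs_L2[OF 1 IH(1), symmetric]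
        by (intro conjI square_integrable_add[OF 1 IH(1)] subspace_add[OF C(2) 2 IH(2)])
    qed
    have "(\<lambda>x. indicator A x *\<^sub>R y) = (\<lambda>x. \<Sum>b\<in>Basis. indicator A x *\<^sub>R (y \<bullet> b) *\<^sub>R b)"
      by (simp only: scaleR_sum_right[symmetric] euclidean_representation)
    then show ?thesis using sum_sq[of Basis "\<lambda>b. y \<bullet> b"] by simp
  qed
  have simple_in: "abs_L2 f \<in> closure C"
    if f: "simple_function lborel f" "square_integrable f" for f
  proof -
    define A where "A y = f -` {y}" for y
    have A: "A y \<in> sets borel" for y
      using simple_functionD(2)[OF f(1), of "{y}"] by (simp add: A_def)
    have A_fin: "emeasure lborel (A y) < \<infinity>" if "y \<noteq> 0" for y
    proof -
      have "ennreal ((norm y)\<^sup>2) * emeasure lborel (A y) = (\<integral>\<^sup>+x. ennreal ((norm y)\<^sup>2) * indicator (A y) x \<partial>lborel)"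
        using A by (subst nn_integral_cmult_indicator) auto
      also have "\<dots> \<le> (\<integral>\<^sup>+x. ennreal ((norm (f x))\<^sup>2) \<partial>lborel)"
        by (intro nn_integral_mono) (auto simp: A_def indicator_def)
      also have "\<dots> = ennreal ((norm (abs_L2 f))\<^sup>2)"
        by (rule norm_abs_L2_nn_integral[OF f(2), symmetric])
      also have "\<dots> < \<infinity>" by simp
      finally show ?thesis
        using that by (auto simp: ennreal_mult_less_top top.not_eq_extremum)
    qed
    have sum_in: "square_integrable (\<lambda>x. \<Sum>y\<in>I. indicator (A y) x *\<^sub>R y) \<and>
        abs_L2 (\<lambda>x. \<Sum>y\<in>I. indicator (A y) x *\<^sub>R y) \<in> closure C"
      if "finite I" "0 \<notin> I" for I
      using that
    proof (induction I)
      case empty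
      show ?case using subspace_0[OF C(2)]
        by (auto simp: square_integrable_0 zero_L2.abs_eq[symmetric])
    next
      case (insert y I)
      then have 1: "square_integrable (\<lambda>x. indicator (A y) x *\<^sub>R y)"
        and 2: "abs_L2 (\<lambda>x. indicator (A y) x *\<^sub>R y) \<in> closure C"
        using A A_fin by (auto intro!: square_integrable_indicator indicator_in)
      from insert have IH: "square_integrable (\<lambda>x. \<Sum>y\<in>I. indicator (A y) x *\<^sub>R y)"
        "abs_L2 (\<lambda>x. \<Sum>y\<in>I. indicator (A y) x *\<^sub>R y) \<in> closure C" by auto
      have eq: "(\<lambda>x. \<Sum>y\<in>insert y I. indicator (A y) x *\<^sub>R y)
          = (\<lambda>x. indicator (A y) x *\<^sub>R y + (\<Sum>y\<in>I. indicator (A y) x *\<^sub>R y))"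
        by (simp only: sum.insert[OF insert.hyps(1,2)])
      show ?case
        unfolding eq add_abs_L2[OF 1 IH(1), symmetric]
        by (intro conjI square_integrable_add[OF 1 IH(1)] subspace_add[OF C(2) 2 IH(2)])
    qed
    have fin: "finite (range f)" using simple_functionD(1)[OF f(1)] by simp
    have "f = (\<lambda>x. \<Sum>y\<in>range f - {0}. indicator (A y) x *\<^sub>R y)"
    proof
      fix x
      have "(\<Sum>y\<in>range f - {0}. indicator (A y) x *\<^sub>R y)
          = (\<Sum>y\<in>range f - {0}. if y = f x then y else 0)"
        by (intro sum.cong) (auto simp: A_def indicator_def)
      also have "\<dots> = f x" using fin by (subst sum.delta) auto
      finally show "f x = (\<Sum>y\<in>range f - {0}. indicator (A y) x *\<^sub>R y)" by simp
    qed
    then show ?thesis using sum_in[of "range f - {0}"] fin by auto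
  qed
  have "u \<in> closure C" for u
  proof -
    define f where "f = rep_L2 u"
    have sqf: "square_integrable f" by (simp add: f_def square_integrable_rep_L2)
    then have [measurable]: "f \<in> borel_measurable lborel" by (simp add: square_integrable_def)
    obtain s where s: "\<And>i. simple_function lborel (s i)" "\<And>x. (\<lambda>i. s i x) \<longlonglongrightarrow> f x"
      "\<And>i x. norm (s i x) \<le> 2 * norm (f x)"
      using borel_measurable_implies_sequence_metric[of f lborel 0] by auto
    have [measurable]: "s i \<in> borel_measurable lborel" for i
      using s(1) by (rule borel_measurable_simple_function)
    have sqs: "square_integrable (s i)" for i
    proof -
      have "integrable lborel (\<lambda>x. (norm (s i x))\<^sup>2)"
      proof (rule Bochner_Integration.integrable_bound)
        show "integrable lborel (\<lambda>x. 4 * (norm (f x))\<^sup>2)" using sqf by (simp add: square_integrable_def)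
        show "AE x in lborel. norm ((norm (s i x))\<^sup>2) \<le> norm (4 * (norm (f x))\<^sup>2)"
          using power_mono[OF s(3) norm_ge_zero, of i _ 2] by (auto simp: power_mult_distrib)
      qed measurable
      then show ?thesis by (simp add: square_integrable_def)
    qed
    have "(\<lambda>i. \<integral>\<^sup>+x. ennreal ((norm (s i x - f x))\<^sup>2) \<partial>lborel) \<longlonglongrightarrow> (\<integral>\<^sup>+x. 0 \<partial>(lborel :: 'a measure))"
    proof (rule nn_integral_dominated_convergence)
      show "AE x in lborel. ennreal ((norm (s i x - f x))\<^sup>2) \<le> ennreal (9 * (norm (f x))\<^sup>2)" for i
      proof (intro always_eventually allI ennreal_leI)
        fix x
        have "norm (s i x - f x) \<le> 3 * norm (f x)"
          using norm_triangle_ineq4[of "s i x" "f x"] s(3)[of i x] by simp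
        from power_mono[OF this norm_ge_zero, of 2]
        show "(norm (s i x - f x))\<^sup>2 \<le> 9 * (norm (f x))\<^sup>2" by (simp add: power_mult_distrib)
      qed
      have "integrable lborel (\<lambda>x. 9 * (norm (f x))\<^sup>2)" using sqf by (simp add: square_integrable_def)
      then show "(\<integral>\<^sup>+x. ennreal (9 * (norm (f x))\<^sup>2) \<partial>lborel) < \<infinity>"
        by (subst nn_integral_eq_integral) auto
      show "AE x in lborel. (\<lambda>i. ennreal ((norm (s i x - f x))\<^sup>2)) \<longlonglongrightarrow> 0"
      proof (intro always_eventually allI)
        fix x
        have "(\<lambda>i. ennreal ((norm (s i x - f x))\<^sup>2)) \<longlonglongrightarrow> ennreal ((norm (f x - f x))\<^sup>2)"
          by (intro tendsto_intros s(2))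
        then show "(\<lambda>i. ennreal ((norm (s i x - f x))\<^sup>2)) \<longlonglongrightarrow> 0" by simp
      qed
    qed measurable
    then have "(\<lambda>i. abs_L2 (s i)) \<longlonglongrightarrow> abs_L2 f"
      by (intro tendsto_abs_L2I sqs sqf) simp
    moreover have "abs_L2 f = u" by (simp add: f_def abs_rep_L2)
    ultimately show ?thesis using lim_in[of "\<lambda>i. abs_L2 (s i)"] simple_in[OF s(1) sqs] by simp
  qed
  then have "closure C = UNIV" by blast
  then show "\<exists>B::('a, 'b) L2 set set. countable B \<and> open = generate_topology B"
    using countable_subbasis_if_dense C(1) by blast
qed

definition L2_on :: "'a::euclidean_space set \<Rightarrow> ('a, 'b::euclidean_space) L2 set"
  where "L2_on \<Omega> = {u. AE x in lborel. x \<notin> \<Omega> \<longrightarrow> rep_L2 u x = 0}"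


section \<open>Lipschitz domains and the Sobolev space of functions with zero trace\<close>

text \<open>
  Near each boundary point, and in rotated coordinates with last axis \<open>e\<close>, the set is the strict
  epigraph of a Lipschitz function \<open>\<gamma>\<close> on the hyperplane orthogonal to \<open>e\<close>.
\<close>

definition bounded_lipschitz_domain :: "'a::euclidean_space set \<Rightarrow> bool"
  where "bounded_lipschitz_domain \<Omega> \<longleftrightarrow>
    open \<Omega> \<and> connected \<Omega> \<and> \<Omega> \<noteq> {} \<and> bounded \<Omega> \<and>
    (\<forall>x\<in>frontier \<Omega>. \<exists>e \<gamma> L \<rho>. norm e = 1 \<and> \<rho> > 0 \<and>
      L-lipschitz_on {z. z \<bullet> e = 0} (\<gamma> :: 'a \<Rightarrow> real) \<and>
      \<Omega> \<inter> ball x \<rho> = {y \<in> ball x \<rho>. \<gamma> (y - (y \<bullet> e) *\<^sub>R e) < y \<bullet> e})"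

primrec Ck :: "nat \<Rightarrow> ('a::euclidean_space \<Rightarrow> real) \<Rightarrow> bool"
  where
    "Ck 0 \<phi> \<longleftrightarrow> continuous_on UNIV \<phi>"
  | "Ck (Suc k) \<phi> \<longleftrightarrow> (\<forall>x. \<phi> differentiable (at x)) \<and>
      (\<forall>i\<in>Basis. Ck k (\<lambda>x. frechet_derivative \<phi> (at x) i))"

definition test_functions :: "'a::euclidean_space set \<Rightarrow> ('a \<Rightarrow> real) set"
  where "test_functions \<Omega> =
    {\<phi>. (\<forall>k. Ck k \<phi>) \<and> (\<exists>S. compact S \<and> S \<subseteq> \<Omega> \<and> (\<forall>x. x \<notin> S \<longrightarrow> \<phi> x = 0))}"

definition gradient :: "('a::euclidean_space \<Rightarrow> real) \<Rightarrow> 'a \<Rightarrow> 'a"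
  where "gradient \<phi> x = (\<Sum>i\<in>Basis. frechet_derivative \<phi> (at x) i *\<^sub>R i)"

text \<open>
  $H_0^1(\<Omega>)$ is the closure of the test functions in the $H^1$ norm. An element \<open>u\<close> is represented by
  the pair of its class in $L^2$, \<open>fst u\<close>, and its weak gradient, \<open>snd u\<close>; the norm of the product type
  is then exactly the $H^1$ norm. Hence \<open>fst\<close> is the embedding into $L^2(\<Omega>)$ and \<open>snd\<close> is $\nabla$.
\<close>

type_synonym 'a H1 = "('a, real) L2 \<times> ('a, 'a) L2"

definition H01 :: "'a::euclidean_space set \<Rightarrow> 'a H1 set"
  where "H01 \<Omega> = closure ((\<lambda>\<phi>. (abs_L2 \<phi>, abs_L2 (gradient \<phi>))) ` test_functions \<Omega>)"

lemma square_integrable_compact_support: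
  assumes "continuous_on UNIV f" "compact S" "\<And>x. x \<notin> S \<Longrightarrow> f x = 0"
  shows "square_integrable f"
proof -
  have "integrable lborel (\<lambda>x. indicator S x *\<^sub>R (norm (f x))\<^sup>2)"
    using assms by (intro borel_integrable_compact continuous_intros)
      (auto intro: continuous_on_subset)
  moreover have "(\<lambda>x. indicator S x *\<^sub>R (norm (f x))\<^sup>2) = (\<lambda>x. (norm (f x))\<^sup>2)"
    using assms(3) by (auto simp: indicator_def fun_eq_iff)
  ultimately show ?thesis
    using borel_measurable_continuous_onI[OF assms(1)] by (simp add: square_integrable_def)
qed

lemma test_function_square_integrable:
  assumes "\<phi> \<in> test_functions \<Omega>"
  shows "square_integrable \<phi>" "square_integrable (gradient \<phi>)"
proof -
  obtain S where S: "compact S" "\<And>x. x \<notin> S \<Longrightarrow> \<phi> x = 0"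
    using assms unfolding test_functions_def by blast
  have Ck: "Ck k \<phi>" for k using assms by (simp add: test_functions_def)
  show "square_integrable \<phi>"
    using Ck[of 0] S by (intro square_integrable_compact_support) auto
  have "continuous_on UNIV (gradient \<phi>)"
    unfolding gradient_def[abs_def] using Ck[of "Suc 0"] by (auto intro!: continuous_intros)
  moreover have "gradient \<phi> x = 0" if "x \<notin> S" for x
  proof -
    have "(\<phi> has_derivative (\<lambda>_. 0)) (at x)"
      by (rule has_derivative_transform_within_open[of "\<lambda>_. 0" _ _ _ "- S"])
        (use S that in \<open>auto simp: compact_imp_closed\<close>)
    then show ?thesis
      by (simp add: gradient_def frechet_derivative_at[symmetric])
  qed
  ultimately show "square_integrable (gradient \<phi>)"
    using S(1) by (intro square_integrable_compact_support)
qed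


section \<open>Spaces of functions of time\<close>

abbreviation time_measure :: "real \<Rightarrow> real measure"
  where "time_measure T \<equiv> restrict_space lborel {0<..<T}"

definition Lp_space ::
    "ereal \<Rightarrow> real \<Rightarrow> 'z::{banach, second_countable_topology} set \<Rightarrow> (real \<Rightarrow> 'z) set"
  where "Lp_space p T Z = {u \<in> borel_measurable (time_measure T).
    (AE t in time_measure T. u t \<in> Z) \<and>
    (if p = \<infinity> then \<exists>C. AE t in time_measure T. norm (u t) \<le> C
     else integrable (time_measure T) (\<lambda>t. norm (u t) powr real_of_ereal p))}"

definition Linf_norm :: "real \<Rightarrow> (real \<Rightarrow> 'z::{banach, second_countable_topology}) \<Rightarrow> real"
  where "Linf_norm T u = real_of_ereal (esssup (time_measure T) (\<lambda>t. ereal (norm (u t))))"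

text \<open>
  \<open>v\<close> is the continuous representative of an element of $H^1(0,T;Z)$ and \<open>v'\<close> its time derivative.
\<close>

definition H1_time ::
    "real \<Rightarrow> 'z::{banach, second_countable_topology} set \<Rightarrow> (real \<Rightarrow> 'z) \<Rightarrow> (real \<Rightarrow> 'z) \<Rightarrow> bool"
  where "H1_time T Z v v' \<longleftrightarrow> v 0 \<in> Z \<and> v' \<in> Lp_space 2 T Z \<and>
    (\<forall>t\<in>{0..T}. v t = v 0 + (LINT s:{0..t}|lborel. v' s))"


section \<open>Convolution kernels\<close>

text \<open>
  A finite real measure on the time interval is given as a difference \<open>fst \<mu> - snd \<mu>\<close> of two finite
  positive measures on \<open>[0, T]\<close>. All notions below depend on the difference only.
\<close>

type_synonym real_measure = "real measure \<times> real measure"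

definition finite_real_measure :: "real \<Rightarrow> real_measure \<Rightarrow> bool"
  where "finite_real_measure T \<mu> \<longleftrightarrow> (\<forall>M\<in>{fst \<mu>, snd \<mu>}.
    sets M = sets borel \<and> finite_measure M \<and> emeasure M (- {0..T}) = 0)"

definition scale_real_measure :: "real \<Rightarrow> real_measure \<Rightarrow> real_measure"
  where "scale_real_measure r \<mu> =
    (if r \<ge> 0 then (scale_measure (ennreal r) (fst \<mu>), scale_measure (ennreal r) (snd \<mu>))
     else (scale_measure (ennreal (- r)) (snd \<mu>), scale_measure (ennreal (- r)) (fst \<mu>)))"

definition conv_measure ::
    "real_measure \<Rightarrow> (real \<Rightarrow> 'z::{banach, second_countable_topology}) \<Rightarrow> real \<Rightarrow> 'z"
  where "conv_measure \<mu> g t =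
    (LINT s:{0..t}|fst \<mu>. g (t - s)) - (LINT s:{0..t}|snd \<mu>. g (t - s))"

definition conv_fun ::
    "(real \<Rightarrow> real) \<Rightarrow> (real \<Rightarrow> 'z::{banach, second_countable_topology}) \<Rightarrow> real \<Rightarrow> 'z"
  where "conv_fun k g t = (LINT s:{0..t}|lborel. k s *\<^sub>R g (t - s))"

text \<open>
  For a convolution operator \<open>C = (\<KK> * \<cdot>)\<close>, the predicate \<open>has_conv_deriv C T u u\<^sub>0 g\<close> expresses
  \<open>\<KK> * u\<^sub>t = g\<close> on $(0,T)$ in the weak sense, that is \<open>\<KK> * (u - u\<^sub>0) = 1 * g\<close> almost everywhere;
  \<open>u\<^sub>0\<close> is the initial value. The Dirac measure at $0$, for which \<open>C\<close> is the identity, gives the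
  time derivative itself.
\<close>

definition has_conv_deriv ::
    "((real \<Rightarrow> 'z) \<Rightarrow> real \<Rightarrow> 'z) \<Rightarrow> real \<Rightarrow>
      (real \<Rightarrow> 'z::{banach, second_countable_topology}) \<Rightarrow> 'z \<Rightarrow> (real \<Rightarrow> 'z) \<Rightarrow> bool"
  where "has_conv_deriv C T u u\<^sub>0 g \<longleftrightarrow> integrable (time_measure T) g \<and>
    (AE t in time_measure T. C (\<lambda>s. u s - u\<^sub>0) t = (LINT s:{0..t}|lborel. g s))"

abbreviation has_time_deriv ::
    "real \<Rightarrow> (real \<Rightarrow> 'z::{banach, second_countable_topology}) \<Rightarrow> 'z \<Rightarrow> (real \<Rightarrow> 'z) \<Rightarrow> bool"
  where "has_time_deriv \<equiv> has_conv_deriv (\<lambda>w. w)"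

definition X_space ::
    "((real \<Rightarrow> 'z) \<Rightarrow> real \<Rightarrow> 'z) \<Rightarrow> ereal \<Rightarrow> real \<Rightarrow>
      'z::{banach, second_countable_topology} set \<Rightarrow> (real \<Rightarrow> 'z) set"
  where "X_space C p T Z =
    {u \<in> Lp_space p T Z. \<exists>u\<^sub>0\<in>Z. \<exists>g\<in>Lp_space p T Z. has_conv_deriv C T u u\<^sub>0 g}"

definition has_Lq_resolvent :: "real \<Rightarrow> real_measure \<Rightarrow> bool"
  where "has_Lq_resolvent T \<KK>\<^sub>1 \<longleftrightarrow> (\<exists>q::real. q > 1 \<and>
    (\<exists>k\<in>Lp_space (ereal q) T (UNIV :: real set). AE t in time_measure T. conv_measure \<KK>\<^sub>1 k t = 1))"

definition kernel_factorization ::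
    "real \<Rightarrow> (real \<Rightarrow> real) \<Rightarrow> real_measure \<Rightarrow> (real \<Rightarrow> real) \<Rightarrow> bool"
  where "kernel_factorization T \<rr> \<KK>\<^sub>1 \<KK>\<^sub>2 \<longleftrightarrow>
    \<rr> \<in> Lp_space 1 T UNIV \<and> \<KK>\<^sub>2 \<in> Lp_space 1 T UNIV \<and>
    (AE t in time_measure T. \<KK>\<^sub>2 t = conv_measure \<KK>\<^sub>1 \<rr> t)"

definition conv_nonneg :: "((real \<Rightarrow> real) \<Rightarrow> real \<Rightarrow> real) \<Rightarrow> real \<Rightarrow> bool"
  where "conv_nonneg C T \<longleftrightarrow> (\<forall>t\<in>{0<..T}. \<forall>y\<in>Lp_space 2 t UNIV.
    0 \<le> (LINT s:{0..t}|lborel. C y s * y s))"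

definition conv_deriv_bounded_below :: "(real \<Rightarrow> real) \<Rightarrow> real \<Rightarrow> bool"
  where "conv_deriv_bounded_below \<KK>\<^sub>2 T \<longleftrightarrow> (\<exists>C. \<forall>t\<in>{0<..T}. \<forall>(y :: real \<Rightarrow> real) g.
    continuous_on {0..t} y \<and> g \<in> Lp_space 1 t UNIV \<and> has_conv_deriv (conv_fun \<KK>\<^sub>2) t y (y 0) g \<longrightarrow>
    (LINT s:{0..t}|lborel. g s * y s) \<ge> - C * \<bar>y 0\<bar>\<^sup>2)"

text \<open>\<open>k\<^sub>0\<close> is the value at $0$ of the continuous representative of \<open>\<KK>\<^sub>2\<close>.\<close>

definition W11_deriv_nonneg :: "(real \<Rightarrow> real) \<Rightarrow> real \<Rightarrow> bool"
  where "W11_deriv_nonneg \<KK>\<^sub>2 T \<longleftrightarrow> (\<exists>k\<^sub>0 k'. \<KK>\<^sub>2 \<in> Lp_space 1 T UNIV \<and> k' \<in> Lp_space 1 T UNIV \<and>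
    has_time_deriv T \<KK>\<^sub>2 k\<^sub>0 k' \<and> k\<^sub>0 \<ge> 0 \<and> conv_nonneg (conv_fun k') T)"


section \<open>The wave equation with relaxation time and its limit\<close>

definition solution_space ::
    "'a::euclidean_space set \<Rightarrow> real \<Rightarrow> real_measure \<Rightarrow> (real \<Rightarrow> 'a H1) set"
  where "solution_space \<Omega> T \<mu> = {\<psi> \<in> X_space (conv_measure \<mu>) \<infinity> T (H01 \<Omega>).
    \<exists>v\<^sub>0 \<psi>\<^sub>t. has_time_deriv T (\<lambda>t. fst (\<psi> t)) v\<^sub>0 \<psi>\<^sub>t \<and>
      \<psi>\<^sub>t \<in> X_space (conv_measure \<mu>) \<infinity> T (L2_on \<Omega>)}"

text \<open>
  In \<open>solves_P\<^sub>\<tau>\<close>, \<open>g\<^sub>1\<close>, \<open>g\<^sub>2\<close> and \<open>h\<close> stand for \<open>\<KK>\<^sub>1 * \<psi>\<^sub>t\<close>, \<open>\<KK>\<^sub>1 * \<psi>\<^sub>t\<^sub>t\<close> and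
  \<open>\<KK>\<^sub>2 * \<psi>\<^sub>t\<close>; the initial conditions \<open>\<psi>(0) = \<psi>\<^sub>0\<close> and \<open>\<psi>\<^sub>t(0) = 0\<close> are the initial values
  in their defining relations. Test functions are given by their continuous representatives.
\<close>

definition solves_P\<^sub>\<tau> ::
    "'a::euclidean_space set \<Rightarrow> real \<Rightarrow> real \<Rightarrow> real \<Rightarrow> real \<Rightarrow> real \<Rightarrow> real \<Rightarrow> real \<Rightarrow> real \<Rightarrow>
      real_measure \<Rightarrow> (real \<Rightarrow> real) \<Rightarrow> 'a H1 \<Rightarrow> ('a, real) L2 \<Rightarrow> (real \<Rightarrow> ('a, real) L2) \<Rightarrow>
      real \<Rightarrow> (real \<Rightarrow> 'a H1) \<Rightarrow> bool"
  where "solves_P\<^sub>\<tau> \<Omega> T c \<delta> \<tau>\<^sub>\<theta> a b \<aa> \<bb> \<KK>\<^sub>1 \<KK>\<^sub>2 \<psi>\<^sub>0 \<psi>\<^sub>2 f \<tau> \<psi> \<longleftrightarrow>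
    \<psi> \<in> solution_space \<Omega> T (scale_real_measure (\<tau> powr a) \<KK>\<^sub>1) \<and>
    (\<exists>\<psi>\<^sub>t g\<^sub>1 g\<^sub>2 h.
      has_time_deriv T (\<lambda>t. fst (\<psi> t)) (fst \<psi>\<^sub>0) \<psi>\<^sub>t \<and>
      has_conv_deriv (conv_measure \<KK>\<^sub>1) T \<psi> \<psi>\<^sub>0 g\<^sub>1 \<and>
      has_conv_deriv (conv_measure \<KK>\<^sub>1) T \<psi>\<^sub>t 0 g\<^sub>2 \<and>
      has_conv_deriv (conv_fun \<KK>\<^sub>2) T \<psi> \<psi>\<^sub>0 h \<and>
      (\<forall>v v'. H1_time T (H01 \<Omega>) v v' \<and> v T = 0 \<longrightarrow>
        - (\<tau> powr a) * (LINT s:{0..T}|lborel. g\<^sub>2 s \<bullet> fst (v' s))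
        - (LINT s:{0..T}|lborel. (\<aa> *\<^sub>R \<psi>\<^sub>t s) \<bullet> fst (v' s))
        + c\<^sup>2 * (LINT s:{0..T}|lborel. (\<bb> *\<^sub>R snd (\<psi> s)) \<bullet> snd (v s))
        + \<tau> powr a * c\<^sup>2 * (LINT s:{0..T}|lborel. snd (g\<^sub>1 s) \<bullet> snd (v s))
        - \<tau>\<^sub>\<theta> powr b * \<delta> * (LINT s:{0..T}|lborel. snd (h s) \<bullet> snd (v' s))
        = - (\<tau> powr a) * (\<psi>\<^sub>2 \<bullet> fst (v 0)) + (LINT s:{0..T}|lborel. f s \<bullet> fst (v s))))"

definition solves_P\<^sub>0 ::
    "'a::euclidean_space set \<Rightarrow> real \<Rightarrow> real \<Rightarrow> real \<Rightarrow> real \<Rightarrow> real \<Rightarrow> real \<Rightarrow> real \<Rightarrow>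
      (real \<Rightarrow> real) \<Rightarrow> 'a H1 \<Rightarrow> (real \<Rightarrow> ('a, real) L2) \<Rightarrow> (real \<Rightarrow> 'a H1) \<Rightarrow> bool"
  where "solves_P\<^sub>0 \<Omega> T c \<delta> \<tau>\<^sub>\<theta> b \<aa> \<bb> \<KK>\<^sub>2 \<psi>\<^sub>0 f \<psi> \<longleftrightarrow>
    \<psi> \<in> Lp_space \<infinity> T (H01 \<Omega>) \<and>
    (\<exists>\<psi>\<^sub>t\<in>Lp_space \<infinity> T (L2_on \<Omega>).
      has_time_deriv T (\<lambda>t. fst (\<psi> t)) (fst \<psi>\<^sub>0) \<psi>\<^sub>t \<and>
      (\<forall>v v' v''. H1_time T (H01 \<Omega>) v v' \<and> H1_time T (H01 \<Omega>) v' v'' \<and> v T = 0 \<and> v' T = 0 \<longrightarrow>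
        - (LINT s:{0..T}|lborel. (\<aa> *\<^sub>R \<psi>\<^sub>t s) \<bullet> fst (v' s))
        + c\<^sup>2 * (LINT s:{0..T}|lborel. (\<bb> *\<^sub>R snd (\<psi> s)) \<bullet> snd (v s))
        + \<tau>\<^sub>\<theta> powr b * \<delta> * (LINT s:{0..T}|lborel. conv_fun \<KK>\<^sub>2 (\<lambda>t. snd (\<psi> t)) s \<bullet> snd (v'' s))
        = - (\<tau>\<^sub>\<theta> powr b) * \<delta> * (LINT s:{0..T}|lborel. (\<KK>\<^sub>2 s *\<^sub>R snd \<psi>\<^sub>0) \<bullet> snd (v' s))
        + (LINT s:{0..T}|lborel. f s \<bullet> fst (v s))))"

end

theory Submission
  imports Defs
begin

text \<open>
  Subtract the two problems, integrate once in time and test with the difference \<open>V\<close>: the left-hand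
  side controls $\|V\|^2$, and the right-hand side is \<open>\<tau>\<^sup>a\<close> times quantities bounded by
  $\|\psi_t\|_{L^2}$ and $\|\nabla\psi\|_{L^2}$, whence the rate \<open>\<tau>\<^bsup>a/2\<^esup>\<close>. These two norms are bounded uniformly
  in \<open>\<tau>\<close> by testing with the derivative of \<open>\<alpha> \<psi> + \<tau>\<^sup>a \<KK>\<^sub>1 * \<psi>\<^sub>t\<close>, where \<open>\<bb> < \<alpha> < \<aa>\<close> in case (a) and
  \<open>\<alpha> = \<aa>/2\<close>, with \<open>\<tau>\<close> small, in case (c). The weak solutions are not regular enough to be test
  functions; since all operators are causal convolutions in time, the equations survive a fourfold
  Steklov average, which provides the three time derivatives that the energy estimates need. All
  bounds are uniform in the averaging width, which is sent to zero only at the very end.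
\<close>

section \<open>Causal functions, primitives and convolutions\<close>

text \<open>The half-order rate is due to one term. In the once integrated difference equation K_1 *
  psi_tt has no bound uniform in tau, so its time derivative is moved onto V; V_t is merely bounded,
  and the right-hand side is of order tau^a and no smaller.

  Membership of the tested averages in H_0^1 is never shown. At each time the equation says that a
  residual is orthogonal to H_0^1; the solution lies in H_0^1 at almost every time, hence everything
  built from it by primitives, difference quotients and convolutions is orthogonal to that residual
  too.

  The source f is only L^1 in time. The energy is therefore examined at a time where it is largest,
  which gives E \<le> const * sqrt E without a Gronwall factor.

  Subtracting psi_0 turns its gradient into a forcing by a step function. The averaged step is
  nondecreasing and stays below 1 for every averaging width, so integrating that term by parts in
  time costs a fixed constant.

  Kernel positivity is assumed for scalar functions only; it reaches L^2-valued functions through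
  projections onto finite-dimensional subspaces.\<close>

definition causal :: "(real \<Rightarrow> 'b::{banach,second_countable_topology}) \<Rightarrow> bool"
  where "causal u \<longleftrightarrow> (\<forall>x<0. u x = 0) \<and> (\<forall>t. set_integrable lborel {..t} u)"

text \<open>Vanishing up to and including 0 removes all boundary terms at the initial time and keeps
  the class closed under backward shifts.\<close>

definition ccont :: "(real \<Rightarrow> 'b::{banach,second_countable_topology}) \<Rightarrow> bool"
  where "ccont y \<longleftrightarrow> continuous_on UNIV y \<and> (\<forall>t\<le>0. y t = 0)"

definition prim :: "(real \<Rightarrow> 'b::{banach,second_countable_topology}) \<Rightarrow> real \<Rightarrow> 'b"
  where "prim u t = (LINT s:{0..t}|lborel. u s)"

lemma causal_neg: "causal u \<Longrightarrow> x < 0 \<Longrightarrow> u x = 0"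
  and causal_integrable: "causal u \<Longrightarrow> set_integrable lborel {..t} u"
  by (auto simp: causal_def)

lemma ccont_nonpos: "ccont y \<Longrightarrow> t \<le> 0 \<Longrightarrow> y t = 0"
  and ccont_continuous: "ccont y \<Longrightarrow> continuous_on S y"
  by (auto simp: ccont_def intro: continuous_on_subset)

lemma ccont_isCont: "ccont y \<Longrightarrow> isCont y t"
  by (auto simp: ccont_def continuous_on_eq_continuous_at)

lemma ccont_measurable: "ccont y \<Longrightarrow> y \<in> borel_measurable borel"
  by (auto simp: ccont_def intro: borel_measurable_continuous_onI)

lemma causal_measurable:
  assumes "causal u" shows "u \<in> borel_measurable borel"
proof (rule borel_measurable_LIMSEQ_metric)
  show "(\<lambda>x. indicator {..real i} x *\<^sub>R u x) \<in> borel_measurable borel" for i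
    using causal_integrable[OF assms, of "real i"] by (simp add: set_integrable_def)
  show "(\<lambda>i. indicator {..real i} x *\<^sub>R u x) \<longlonglongrightarrow> u x" for x
  proof -
    have "eventually (\<lambda>i. indicator {..real i} x *\<^sub>R u x = u x) sequentially"
      using eventually_ge_at_top[of "nat \<lceil>x\<rceil>"]
      by eventually_elim (auto simp: indicator_def)
    then show ?thesis by (rule tendsto_eventually)
  qed
qed

lemma causal_0: "causal (\<lambda>_. 0)"
  by (simp add: causal_def set_integrable_def)

lemma causal_integrable_Icc: "causal u \<Longrightarrow> set_integrable lborel {a..b} u"
  by (rule set_integrable_subset[OF causal_integrable[of u b]]) auto

lemma causalI_integrable:
  assumes "integrable lborel u" "\<And>x. x < 0 \<Longrightarrow> u x = 0"
  shows "causal u"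
  using assms by (auto simp: causal_def set_integrable_def intro: integrable_mult_indicator)

lemma causal_add: "causal u \<Longrightarrow> causal v \<Longrightarrow> causal (\<lambda>t. u t + v t)"
  by (auto simp: causal_def intro: set_integral_add)

lemma causal_diff: "causal u \<Longrightarrow> causal v \<Longrightarrow> causal (\<lambda>t. u t - v t)"
  by (auto simp: causal_def intro: set_integral_diff)

lemma causal_bounded_linear:
  assumes "bounded_linear L" "causal u"
  shows "causal (\<lambda>t. L (u t))"
proof -
  interpret L: bounded_linear L by fact
  have "set_integrable lborel {..t} (\<lambda>t. L (u t))" for t
    using integrable_bounded_linear[OF assms(1), of lborel "\<lambda>x. indicator {..t} x *\<^sub>R u x"]
      causal_integrable[OF assms(2), of t]
    by (simp add: set_integrable_def L.scaleR)
  then show ?thesis using causal_neg[OF assms(2)] by (auto simp: causal_def L.zero)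
qed

lemma causal_norm: "causal u \<Longrightarrow> causal (\<lambda>t. norm (u t))"
  by (auto simp: causal_def intro: set_integrable_norm)

lemma ccont_causal:
  assumes "ccont y" shows "causal y"
proof -
  have "set_integrable lborel {..t} y" for t
  proof -
    have "integrable lborel (\<lambda>x. indicator {0..t} x *\<^sub>R y x)"
      by (rule borel_integrable_compact) (auto intro: ccont_continuous[OF assms])
    moreover have "(\<lambda>x. indicator {0..t} x *\<^sub>R y x) = (\<lambda>x. indicator {..t} x *\<^sub>R y x)"
      using ccont_nonpos[OF assms] by (auto simp: indicator_def fun_eq_iff not_le)
        (metis linear)
    ultimately show ?thesis by (simp add: set_integrable_def)
  qed
  then show ?thesis using ccont_nonpos[OF assms] by (auto simp: causal_def)
qed

lemma ccont_add: "ccont u \<Longrightarrow> ccont v \<Longrightarrow> ccont (\<lambda>t. u t + v t)"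
  by (auto simp: ccont_def intro: continuous_intros)

lemma ccont_diff: "ccont u \<Longrightarrow> ccont v \<Longrightarrow> ccont (\<lambda>t. u t - v t)"
  by (auto simp: ccont_def intro: continuous_intros)

lemma ccont_scaleR: "ccont u \<Longrightarrow> ccont (\<lambda>t. c *\<^sub>R u t)"
  by (auto simp: ccont_def intro: continuous_intros)

lemma ccont_bounded_linear:
  assumes "bounded_linear L" "ccont u" shows "ccont (\<lambda>t. L (u t))"
  using assms linear_0[OF bounded_linear.linear[OF assms(1)]]
  by (auto simp: ccont_def intro: bounded_linear.continuous_on)

lemma ccont_inner: "ccont u \<Longrightarrow> ccont (\<lambda>t. (u t :: 'b::{real_inner,banach,second_countable_topology}) \<bullet> x)"
  by (rule ccont_bounded_linear[OF bounded_linear_inner_left])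

lemma ccont_bounded:
  assumes "ccont y" obtains B where "B \<ge> 0" "\<And>x. x \<le> t \<Longrightarrow> norm (y x) \<le> B"
proof -
  have "bounded (y ` {0..t})"
    by (intro compact_imp_bounded compact_continuous_image ccont_continuous[OF assms]) auto
  then obtain B where B: "\<And>x. x \<in> {0..t} \<Longrightarrow> norm (y x) \<le> B" "B > 0"
    unfolding bounded_pos by (metis imageI)
  show ?thesis
  proof (rule that[of B])
    show "norm (y x) \<le> B" if "x \<le> t" for x
      using B that ccont_nonpos[OF assms, of x] by (cases "x \<le> 0") auto
  qed (use B in auto)
qed

lemma prim_atMost: "causal u \<Longrightarrow> prim u t = (LINT s:{..t}|lborel. u s)"
  unfolding prim_def set_lebesgue_integral_def
  by (rule Bochner_Integration.integral_cong) (auto simp: indicator_def dest: causal_neg intro: leI)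

lemma prim_neg: "t < 0 \<Longrightarrow> prim u t = 0"
  by (simp add: prim_def set_lebesgue_integral_def)

lemma prim_add: "causal u \<Longrightarrow> causal v \<Longrightarrow> prim (\<lambda>t. u t + v t) t = prim u t + prim v t"
  by (simp add: prim_def set_integral_add(2) causal_integrable_Icc)

lemma prim_diff: "causal u \<Longrightarrow> causal v \<Longrightarrow> prim (\<lambda>t. u t - v t) t = prim u t - prim v t"
  by (simp add: prim_def set_integral_diff(2) causal_integrable_Icc)

lemma prim_scaleR: "prim (\<lambda>t. c *\<^sub>R u t) t = c *\<^sub>R prim u t"
  by (simp add: prim_def)

lemma prim_bounded_linear:
  assumes "bounded_linear L" "causal u"
  shows "prim (\<lambda>t. L (u t)) t = L (prim u t)"
proof -
  interpret L: bounded_linear L by fact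
  show ?thesis
    using integral_bounded_linear[OF assms(1), of lborel "\<lambda>x. indicator {0..t} x *\<^sub>R u x"]
      causal_integrable_Icc[OF assms(2), of 0 t]
    by (simp add: prim_def set_lebesgue_integral_def set_integrable_def L.scaleR)
qed

lemma prim_inner:
  fixes u :: "real \<Rightarrow> 'b::{real_inner,banach,second_countable_topology}"
  shows "causal u \<Longrightarrow> prim (\<lambda>t. u t \<bullet> x) t = prim u t \<bullet> x"
  by (rule prim_bounded_linear[OF bounded_linear_inner_left])

lemma prim_cong_AE:
  assumes "causal u" "causal v" "AE s in lborel. 0 \<le> s \<and> s \<le> t \<longrightarrow> u s = v s"
  shows "prim u t = prim v t"
proof -
  have [measurable]: "u \<in> borel_measurable borel" "v \<in> borel_measurable borel"
    using assms(1,2) by (auto intro: causal_measurable)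
  show ?thesis unfolding prim_def set_lebesgue_integral_def
    by (rule integral_cong_AE, measurable) (use assms(3) in \<open>auto simp: indicator_def\<close>)
qed

lemma prim_cong: "(\<And>s. 0 \<le> s \<Longrightarrow> s \<le> t \<Longrightarrow> u s = v s) \<Longrightarrow> prim u t = prim v t"
  unfolding prim_def by (rule set_lebesgue_integral_cong) auto

lemma prim_mono:
  fixes u v :: "real \<Rightarrow> real"
  assumes "causal u" "causal v" "\<And>s. 0 \<le> s \<Longrightarrow> s \<le> t \<Longrightarrow> u s \<le> v s"
  shows "prim u t \<le> prim v t"
  unfolding prim_def
  by (intro set_integral_mono causal_integrable_Icc assms) (use assms in auto)

lemma norm_prim_le:
  assumes "causal u" shows "norm (prim u t) \<le> prim (\<lambda>s. norm (u s)) t"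
  unfolding prim_def by (rule set_integral_norm_bound) (rule causal_integrable_Icc[OF assms])

lemma prim_diff_Ioc:
  assumes "causal u" "a \<le> b"
  shows "prim u b - prim u a = (LINT s:{a<..b}|lborel. u s)"
proof -
  have "(LINT s:{..a} \<union> {a<..b}|lborel. u s) = (LINT s:{..a}|lborel. u s) + (LINT s:{a<..b}|lborel. u s)"
    by (rule set_integral_Un) (auto intro: causal_integrable[OF assms(1)]
      set_integrable_subset[OF causal_integrable[OF assms(1), of b]])
  moreover have "{..a} \<union> {a<..b} = {..b}" using assms by auto
  ultimately show ?thesis by (simp add: prim_atMost[OF assms(1)])
qed

lemma ccont_prim:
  assumes "causal u" shows "ccont (prim u)"
proof -
  have [measurable]: "u \<in> borel_measurable borel" by (rule causal_measurable[OF assms])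
  have "isCont (prim u) t" for t
  proof (unfold continuous_at_sequentially comp_def, intro allI impI)
    fix X assume X: "X \<longlonglongrightarrow> t"
    then have "Bseq X" by (intro convergent_imp_Bseq) (auto simp: convergent_def)
    then obtain c where "\<And>n. norm (X n) \<le> c" unfolding Bseq_def by blast
    then have c: "X n \<le> c" for n by (metis abs_le_D1 real_norm_def)
    show "(\<lambda>n. prim u (X n)) \<longlonglongrightarrow> prim u t"
      unfolding prim_atMost[OF assms] set_lebesgue_integral_def
    proof (rule integral_dominated_convergence)
      show "integrable lborel (\<lambda>x. norm (indicator {..c} x *\<^sub>R u x))"
        using causal_integrable[OF assms, of c] by (intro integrable_norm) (simp add: set_integrable_def)
      show "AE x in lborel. norm (indicator {..X n} x *\<^sub>R u x) \<le> norm (indicator {..c} x *\<^sub>R u x)" for n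
        using c[of n] by (auto simp: indicator_def)
      have "(\<lambda>n. indicator {..X n} x *\<^sub>R u x) \<longlonglongrightarrow> indicator {..t} x *\<^sub>R u x" if "x \<noteq> t" for x
      proof -
        have "eventually (\<lambda>n. indicator {..X n} x *\<^sub>R u x = indicator {..t} x *\<^sub>R u x) sequentially"
        proof (cases "x < t")
          case True
          show ?thesis using order_tendstoD(1)[OF X True]
            by eventually_elim (use True in \<open>auto simp: indicator_def\<close>)
        next
          case False
          then have "t < x" using that by simp
          show ?thesis using order_tendstoD(2)[OF X \<open>t < x\<close>]
            by eventually_elim (use \<open>t < x\<close> in \<open>auto simp: indicator_def\<close>)
        qed
        then show ?thesis by (rule tendsto_eventually)
      qed
      then show "AE x in lborel. (\<lambda>n. indicator {..X n} x *\<^sub>R u x) \<longlonglongrightarrow> indicator {..t} x *\<^sub>R u x"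
        using AE_lborel_singleton[of t] by (rule eventually_mono[rotated]) auto
    qed measurable
  qed
  moreover have "prim u t = 0" if "t \<le> 0" for t
  proof (cases "t < 0")
    case False
    then have "t = 0" using that by simp
    have "prim u 0 = prim (\<lambda>_. 0) 0"
      using AE_lborel_singleton[of 0] by (intro prim_cong_AE assms causal_0) (auto elim!: eventually_mono)
    then show ?thesis using \<open>t = 0\<close> by (simp add: prim_def set_lebesgue_integral_def)
  qed (simp add: prim_neg)
  ultimately show ?thesis by (auto simp: ccont_def continuous_on_eq_continuous_at)
qed

lemma causal_prim: "causal u \<Longrightarrow> causal (prim u)"
  by (rule ccont_causal[OF ccont_prim])

lemma prim_has_vector_derivative:
  assumes "ccont y" shows "(prim y has_vector_derivative y t) (at t)"
  unfolding has_vector_derivative_def has_derivative_at_alt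
proof (intro conjI allI impI)
  show "bounded_linear (\<lambda>x. x *\<^sub>R y t)" by (rule bounded_linear_scaleR_left)
  fix e :: real assume "e > 0"
  then obtain d where d: "d > 0" "\<And>x. \<bar>x - t\<bar> < d \<Longrightarrow> norm (y x - y t) < e"
    using ccont_isCont[OF assms, of t] unfolding continuous_at_eps_delta dist_norm
    by (metis dist_norm real_norm_def)
  have causal: "causal y" by (rule ccont_causal[OF assms])
  have bound: "norm (prim y b - prim y a - (b - a) *\<^sub>R y t) \<le> e * (b - a)"
    if ab: "a \<le> b" "\<bar>a - t\<bar> < d" "\<bar>b - t\<bar> < d" for a b
  proof -
    have int: "set_integrable lborel {a<..b} y"
      by (rule set_integrable_subset[OF causal_integrable[OF causal, of b]]) auto
    have const: "set_integrable lborel {a<..b} (\<lambda>_. y t)"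
      using ab by (simp add: set_integrable_def integrable_scaleR_left)
    have "prim y b - prim y a - (b - a) *\<^sub>R y t = (LINT s:{a<..b}|lborel. y s - y t)"
      using ab by (simp add: prim_diff_Ioc[OF causal] set_integral_diff[OF int const]
        set_integral_const)
    also have "norm \<dots> \<le> (LINT s:{a<..b}|lborel. norm (y s - y t))"
      by (intro set_integral_norm_bound set_integral_diff int const)
    also have "\<dots> \<le> (LINT s:{a<..b}|lborel. e)"
    proof (rule set_integral_mono)
      show "set_integrable lborel {a<..b} (\<lambda>s. norm (y s - y t))"
        by (intro set_integrable_norm set_integral_diff int const)
      show "norm (y s - y t) \<le> e" if "s \<in> {a<..b}" for s
        using that ab by (intro less_imp_le d) auto
    qed (use ab in \<open>simp add: set_integrable_def\<close>)
    also have "\<dots> = e * (b - a)" using ab by (simp add: set_integral_const)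
    finally show ?thesis .
  qed
  show "\<exists>d>0. \<forall>x. norm (x - t) < d \<longrightarrow>
    norm (prim y x - prim y t - (x - t) *\<^sub>R y t) \<le> e * norm (x - t)"
  proof (intro exI[of _ d] conjI d(1) allI impI)
    fix x assume x: "norm (x - t) < d"
    show "norm (prim y x - prim y t - (x - t) *\<^sub>R y t) \<le> e * norm (x - t)"
    proof (cases "t \<le> x")
      case True
      then show ?thesis using bound[of t x] x d by simp
    next
      case False
      have "prim y x - prim y t - (x - t) *\<^sub>R y t = - (prim y t - prim y x - (t - x) *\<^sub>R y t)"
        by (simp add: algebra_simps)
      then show ?thesis using False bound[of x t] x d by (simp only: norm_minus_cancel) simp
    qed
  qed
qed

lemma prim_derivative:
  fixes F F' :: "real \<Rightarrow> real"
  assumes "\<And>s. (F has_real_derivative F' s) (at s)" "continuous_on UNIV F'" "0 \<le> t"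
  shows "prim F' t = F t - F 0"
proof -
  have "isCont F' s" for s using assms(2) by (simp add: continuous_on_eq_continuous_at)
  then show ?thesis
    unfolding prim_def set_lebesgue_integral_def
    using integral_FTC_Icc_real[of 0 t F F'] assms by (auto simp: mult.commute)
qed

section \<open>Convolution with finite measures on the half line\<close>

definition nn_kernel :: "real measure \<Rightarrow> bool"
  where "nn_kernel M \<longleftrightarrow> sets M = sets borel \<and> finite_measure M \<and> emeasure M {..<0} = 0"

text \<open>Integrated over the whole line: for a causal argument and a measure without mass on the
  negative axis this is the Laplace convolution, a point mass at 0 included.\<close>

definition mconv :: "real measure \<Rightarrow> (real \<Rightarrow> 'b::{banach,second_countable_topology}) \<Rightarrow> real \<Rightarrow> 'b"
  where "mconv M u t = (LINT s|M. u (t - s))"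

definition fconv :: "(real \<Rightarrow> real) \<Rightarrow> (real \<Rightarrow> 'b::{banach,second_countable_topology}) \<Rightarrow> real \<Rightarrow> 'b"
  where "fconv b p t = (LINT s|lborel. b (t - s) *\<^sub>R p s)"

lemma nn_kernel_AE: "nn_kernel M \<Longrightarrow> AE s in M. 0 \<le> s"
  by (rule AE_I[of _ _ "{..<0}"]) (auto simp: nn_kernel_def not_le)

lemma nn_kernel_measurable: "nn_kernel M \<Longrightarrow> f \<in> borel_measurable borel \<Longrightarrow> f \<in> borel_measurable M"
  by (simp add: nn_kernel_def cong: measurable_cong_sets)

lemma integrable_translate:
  fixes p :: "real \<Rightarrow> 'b::{banach,second_countable_topology}"
  assumes "integrable lborel p"
  shows "integrable lborel (\<lambda>s. p (s - x))"
    and "(LINT s|lborel. p (s - x)) = (LINT s|lborel. p s)"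
  using lborel_integrable_real_affine[of p 1 "- x"] assms
    lborel_integral_real_affine[of 1 p "- x"]
  by (simp_all add: algebra_simps)

lemma fconv_integrable:
  assumes "causal p" "b \<in> borel_measurable borel" "\<And>x. x < 0 \<Longrightarrow> b x = 0"
    "\<And>t. \<exists>B. \<forall>x\<le>t. \<bar>b x\<bar> \<le> B"
  shows "integrable lborel (\<lambda>s. b (t - s) *\<^sub>R p s)"
proof -
  have [measurable]: "p \<in> borel_measurable borel" "b \<in> borel_measurable borel"
    using assms causal_measurable by auto
  obtain B where B: "\<And>x. x \<le> t \<Longrightarrow> \<bar>b x\<bar> \<le> B" using assms(4) by blast
  show ?thesis
  proof (rule Bochner_Integration.integrable_bound)
    show "integrable lborel (\<lambda>s. B * norm (indicator {..t} s *\<^sub>R p s))"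
      using causal_integrable[OF assms(1), of t]
      by (intro integrable_mult_right integrable_norm) (simp add: set_integrable_def)
    have "norm (b (t - s) *\<^sub>R p s) \<le> norm (B * norm (indicator {..t} s *\<^sub>R p s))" for s
      using B[of "t - s"] causal_neg[OF assms(1), of s] assms(3)[of "t - s"]
      by (cases "s < 0"; cases "s \<le> t") (auto simp: mult_right_mono abs_mult)
    then show "AE s in lborel. norm (b (t - s) *\<^sub>R p s) \<le> norm (B * norm (indicator {..t} s *\<^sub>R p s))"
      by simp
  qed measurable
qed

text \<open>Fubini, with the shift by \<open>x\<close> moved from \<open>p\<close> onto the time:
  for fixed \<open>x\<close> the inner integral is \<open>fconv b p (t - x)\<close>. A bound for
  \<open>b\<close> on half lines suffices, since causality confines both arguments. With
  \<open>b\<close> the unit step, primitives are seen to commute with the convolution and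
  \<open>mconv M p\<close> to be locally integrable.\<close>

lemma fconv_mconv:
  assumes M: "nn_kernel M" and p: "causal p"
    and b: "b \<in> borel_measurable borel" "\<And>x. x < 0 \<Longrightarrow> b x = 0" "\<And>t. \<exists>B. \<forall>x\<le>t. \<bar>b x\<bar> \<le> B"
  shows "integrable lborel (\<lambda>s. b (t - s) *\<^sub>R mconv M p s)"
    and "fconv b (mconv M p) t = mconv M (fconv b p) t"
proof -
  have [measurable]: "p \<in> borel_measurable borel" "b \<in> borel_measurable borel"
    using p b causal_measurable by auto
  have [measurable_cong]: "sets M = sets borel" using M by (simp add: nn_kernel_def)
  interpret M: finite_measure M using M by (simp add: nn_kernel_def)
  interpret pair_sigma_finite M lborel by unfold_locales
  define F where "F x s = b (t - s) *\<^sub>R p (s - x)" for x s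
  have [measurable]: "(\<lambda>(x, s). F x s) \<in> borel_measurable (M \<Otimes>\<^sub>M lborel)"
    unfolding F_def by measurable
  obtain B where B: "\<And>x. x \<le> t \<Longrightarrow> \<bar>b x\<bar> \<le> B" using b(3) by blast
  \<comment> \<open>Both factors become functions of \<open>s - x\<close>, so translation invariance
    of Lebesgue measure applies.\<close>
  have F_alt: "F x s = b ((t - x) - (s - x)) *\<^sub>R p (s - x)" for x s by (simp add: F_def)
  have F_int: "integrable lborel (F x)" for x
    unfolding F_alt
    by (intro integrable_translate(1)[where p = "\<lambda>r. b ((t - x) - r) *\<^sub>R p r"] fconv_integrable p b)
  have F_eq: "(LINT s|lborel. F x s) = fconv b p (t - x)" for x
    unfolding F_alt fconv_def
    by (intro integrable_translate(2)[where p = "\<lambda>r. b ((t - x) - r) *\<^sub>R p r"] fconv_integrable p b)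
  have F_norm: "norm (LINT s|lborel. norm (F x s)) \<le> B * (LINT s|lborel. norm (indicator {..t} s *\<^sub>R p s))"
    if "0 \<le> x" for x
  proof -
    have int: "integrable lborel (\<lambda>s. norm (indicator {..t} s *\<^sub>R p s))"
      using causal_integrable[OF p, of t] by (intro integrable_norm) (simp add: set_integrable_def)
    have "norm (F x s) \<le> B * norm (indicator {..t} (s - x) *\<^sub>R p (s - x))" for s
      using B[of "t - s"] causal_neg[OF p, of "s - x"] b(2)[of "t - s"] that
      by (cases "s < x"; cases "s \<le> t") (auto simp: F_def mult_right_mono)
    then have "(LINT s|lborel. norm (F x s))
        \<le> (LINT s|lborel. B * norm (indicator {..t} (s - x) *\<^sub>R p (s - x)))"
      by (intro integral_mono integrable_norm F_int integrable_mult_right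
        integrable_translate(1)[OF int, of x])
    also have "\<dots> = B * (LINT s|lborel. norm (indicator {..t} s *\<^sub>R p s))"
      using integrable_translate(2)[OF int, of x] by simp
    finally show ?thesis by simp
  qed
  have "integrable (M \<Otimes>\<^sub>M lborel) (\<lambda>(x, s). F x s)"
  proof (rule Fubini_integrable)
    show "integrable M (\<lambda>x. LINT s|lborel. norm (case (x, s) of (x, s) \<Rightarrow> F x s))"
      using nn_kernel_AE[OF M] F_norm
      by (intro M.integrable_const_bound[where B = "B * (LINT s|lborel. norm (indicator {..t} s *\<^sub>R p s))"])
        (auto elim!: eventually_mono)
  qed (auto simp: F_int)
  note int = this
  have eq: "(LINT x|M. F x s) = b (t - s) *\<^sub>R mconv M p s" for s
    by (simp add: F_def mconv_def)
  from integrable_snd[OF int] show "integrable lborel (\<lambda>s. b (t - s) *\<^sub>R mconv M p s)"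
    by (simp add: eq)
  from Fubini_integral[OF int] show "fconv b (mconv M p) t = mconv M (fconv b p) t"
    by (simp add: eq F_eq fconv_def[of b "mconv M p"] mconv_def[of M "fconv b p"])
qed

lemma prim_eq_fconv: "causal p \<Longrightarrow> prim p = fconv (indicator {0..}) p"
  by (auto simp: prim_atMost fconv_def set_lebesgue_integral_def indicator_def fun_eq_iff
      intro!: Bochner_Integration.integral_cong)

lemma unit_step_bounded: "\<exists>B. \<forall>x\<le>t. \<bar>indicator {0..} x\<bar> \<le> (B :: real)"
  by (intro exI[of _ 1]) (auto simp: indicator_def)

lemma causal_mconv:
  assumes "nn_kernel M" "causal p" shows "causal (mconv M p)"
proof -
  have "mconv M p t = 0" if "t < 0" for t
    unfolding mconv_def
    by (intro integral_eq_zero_AE eventually_mono[OF nn_kernel_AE[OF assms(1)]] causal_neg[OF assms(2)])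
      (use that in auto)
  moreover have "set_integrable lborel {..t} (mconv M p)" for t
  proof -
    have "(\<lambda>s. indicator {0..} (t - s) *\<^sub>R mconv M p s) = (\<lambda>s. indicator {..t} s *\<^sub>R mconv M p s)"
      by (auto simp: indicator_def fun_eq_iff)
    then show ?thesis
      using fconv_mconv(1)[OF assms _ _ unit_step_bounded, of t] by (simp add: set_integrable_def)
  qed
  ultimately show ?thesis by (simp add: causal_def)
qed

lemma prim_mconv:
  assumes "nn_kernel M" "causal p"
  shows "prim (mconv M p) t = mconv M (prim p) t"
  unfolding prim_eq_fconv[OF assms(2)] prim_eq_fconv[OF causal_mconv[OF assms]]
  by (rule fconv_mconv(2)[OF assms _ _ unit_step_bounded]) auto

lemma integrable_mconv:
  assumes "nn_kernel M" "ccont y" shows "integrable M (\<lambda>s. y (t - s))"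
proof -
  interpret M: finite_measure M using assms by (simp add: nn_kernel_def)
  have [measurable]: "y \<in> borel_measurable borel" by (rule ccont_measurable[OF assms(2)])
  obtain B where "\<And>x. x \<le> t \<Longrightarrow> norm (y x) \<le> B" using ccont_bounded[OF assms(2)] by metis
  then show ?thesis
    using nn_kernel_AE[OF assms(1)]
    by (intro M.integrable_const_bound[where B = B] nn_kernel_measurable[OF assms(1)])
      (auto elim!: eventually_mono)
qed

lemma ccont_mconv:
  assumes "nn_kernel M" "ccont y" shows "ccont (mconv M y)"
proof -
  interpret M: finite_measure M using assms by (simp add: nn_kernel_def)
  have [measurable]: "y \<in> borel_measurable borel" by (rule ccont_measurable[OF assms(2)])
  have "isCont (mconv M y) t" for t
  proof (unfold continuous_at_sequentially comp_def, intro allI impI)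
    fix X assume X: "X \<longlonglongrightarrow> t"
    then have "Bseq X" by (intro convergent_imp_Bseq) (auto simp: convergent_def)
    then obtain c where "\<And>n. norm (X n) \<le> c" unfolding Bseq_def by blast
    then have c: "X n \<le> c" for n by (metis abs_le_D1 real_norm_def)
    obtain B where B: "\<And>x. x \<le> c \<Longrightarrow> norm (y x) \<le> B" using ccont_bounded[OF assms(2)] by metis
    show "(\<lambda>n. mconv M y (X n)) \<longlonglongrightarrow> mconv M y t"
      unfolding mconv_def
    proof (rule integral_dominated_convergence)
      show "AE x in M. norm (y (X n - x)) \<le> B" for n
        using nn_kernel_AE[OF assms(1)]
      proof eventually_elim
        case (elim x)
        then show ?case using c[of n] by (intro B) linarith
      qed
      have "(\<lambda>n. y (X n - x)) \<longlonglongrightarrow> y (t - x)" for x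
        by (intro isCont_tendsto_compose[OF ccont_isCont[OF assms(2)]] tendsto_intros X)
      then show "AE x in M. (\<lambda>n. y (X n - x)) \<longlonglongrightarrow> y (t - x)" by simp
    qed (auto intro!: nn_kernel_measurable[OF assms(1)])
  qed
  moreover have "mconv M y t = 0" if "t \<le> 0" for t
    unfolding mconv_def
    by (intro integral_eq_zero_AE eventually_mono[OF nn_kernel_AE[OF assms(1)]] ccont_nonpos[OF assms(2)])
      (use that in auto)
  ultimately show ?thesis by (auto simp: ccont_def continuous_on_eq_continuous_at)
qed

lemma norm_mconv_le:
  assumes "nn_kernel M" "ccont y" "\<And>x. x \<le> t \<Longrightarrow> norm (y x) \<le> B"
  shows "norm (mconv M y t) \<le> measure M UNIV * B"
proof -
  interpret M: finite_measure M using assms by (simp add: nn_kernel_def)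
  have "norm (mconv M y t) \<le> (LINT s|M. norm (y (t - s)))"
    unfolding mconv_def by (rule integral_norm_bound)
  also have "\<dots> \<le> (LINT s|M. B)"
  proof (rule integral_mono_AE)
    show "AE x in M. norm (y (t - x)) \<le> B"
      using nn_kernel_AE[OF assms(1)] by eventually_elim (auto intro: assms)
  qed (use integrable_mconv[OF assms(1,2)] in auto)
  also have "\<dots> = measure M UNIV * B"
    using sets_eq_imp_space_eq[of M borel] assms(1) by (simp add: nn_kernel_def)
  finally show ?thesis .
qed

definition real_kernel :: "real_measure \<Rightarrow> bool"
  where "real_kernel \<mu> \<longleftrightarrow> nn_kernel (fst \<mu>) \<and> nn_kernel (snd \<mu>)"

definition sconv :: "real_measure \<Rightarrow> (real \<Rightarrow> 'b::{banach,second_countable_topology}) \<Rightarrow> real \<Rightarrow> 'b"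
  where "sconv \<mu> u t = mconv (fst \<mu>) u t - mconv (snd \<mu>) u t"

text \<open>Dominates the total variation; the two measures are not assumed mutually
  singular.\<close>

definition total_mass :: "real_measure \<Rightarrow> real"
  where "total_mass \<mu> = measure (fst \<mu>) UNIV + measure (snd \<mu>) UNIV"

lemma total_mass_nonneg: "0 \<le> total_mass \<mu>"
  by (simp add: total_mass_def)

lemma ccont_sconv: "real_kernel \<mu> \<Longrightarrow> ccont y \<Longrightarrow> ccont (sconv \<mu> y)"
  unfolding sconv_def[abs_def] real_kernel_def by (intro ccont_diff ccont_mconv) auto

lemma causal_sconv: "real_kernel \<mu> \<Longrightarrow> causal y \<Longrightarrow> causal (sconv \<mu> y)"
  unfolding sconv_def[abs_def] real_kernel_def by (intro causal_diff causal_mconv) auto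

lemma prim_sconv:
  assumes "real_kernel \<mu>" "causal p"
  shows "prim (sconv \<mu> p) = sconv \<mu> (prim p)"
proof
  fix t
  have "prim (sconv \<mu> p) t = prim (mconv (fst \<mu>) p) t - prim (mconv (snd \<mu>) p) t"
    unfolding sconv_def[abs_def] using assms by (intro prim_diff causal_mconv) (auto simp: real_kernel_def)
  also have "\<dots> = sconv \<mu> (prim p) t"
    using assms by (simp add: prim_mconv real_kernel_def sconv_def)
  finally show "prim (sconv \<mu> p) t = sconv \<mu> (prim p) t" .
qed

lemma fconv_sconv:
  assumes "real_kernel \<mu>" "causal p" "ccont b"
  shows "fconv b (sconv \<mu> p) t = sconv \<mu> (fconv b p) t"
proof -
  have b: "b \<in> borel_measurable borel" "\<And>x. x < 0 \<Longrightarrow> b x = 0" "\<And>t. \<exists>B. \<forall>x\<le>t. \<bar>b x\<bar> \<le> B"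
    using ccont_measurable[OF assms(3)] ccont_nonpos[OF assms(3)] ccont_bounded[OF assms(3)]
    by (auto, metis real_norm_def)
  have M: "nn_kernel (fst \<mu>)" "nn_kernel (snd \<mu>)" using assms by (auto simp: real_kernel_def)
  show ?thesis
    unfolding sconv_def[abs_def]
    using fconv_mconv(2)[OF M(1) assms(2) b] fconv_mconv(2)[OF M(2) assms(2) b]
      fconv_mconv(1)[OF M(1) assms(2) b] fconv_mconv(1)[OF M(2) assms(2) b]
    by (simp add: fconv_def[of b "\<lambda>t. _ t - _ t"] scaleR_diff_right fconv_def[of b "mconv _ p"])
qed

lemma norm_sconv_le:
  assumes "real_kernel \<mu>" "ccont y" "\<And>x. x \<le> t \<Longrightarrow> norm (y x) \<le> B"
  shows "norm (sconv \<mu> y t) \<le> total_mass \<mu> * B"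
proof -
  have "norm (mconv (fst \<mu>) y t) \<le> measure (fst \<mu>) UNIV * B" "norm (mconv (snd \<mu>) y t) \<le> measure (snd \<mu>) UNIV * B"
    using assms by (auto intro!: norm_mconv_le simp: real_kernel_def)
  then show ?thesis
    using norm_triangle_ineq4[of "mconv (fst \<mu>) y t" "mconv (snd \<mu>) y t"]
    by (simp add: sconv_def total_mass_def distrib_right)
qed

lemma sconv_bounded_linear:
  assumes "bounded_linear L" "real_kernel \<mu>" "ccont y"
  shows "sconv \<mu> (\<lambda>s. L (y s)) t = L (sconv \<mu> y t)"
proof -
  interpret L: bounded_linear L by fact
  show ?thesis
    using assms(2) by (simp add: sconv_def mconv_def L.diff real_kernel_def
      integral_bounded_linear[OF assms(1)] integrable_mconv assms(3))
qed

lemma sconv_add: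
  assumes "real_kernel \<mu>" "ccont u" "ccont v"
  shows "sconv \<mu> (\<lambda>s. u s + v s) t = sconv \<mu> u t + sconv \<mu> v t"
  using assms by (simp add: sconv_def mconv_def real_kernel_def integrable_mconv)

lemma sconv_diff:
  assumes "real_kernel \<mu>" "ccont u" "ccont v"
  shows "sconv \<mu> (\<lambda>s. u s - v s) t = sconv \<mu> u t - sconv \<mu> v t"
  using assms by (simp add: sconv_def mconv_def real_kernel_def integrable_mconv)

text \<open>Causality: \<open>norm_sconv_le\<close> for the difference, with the bound 0 on the past
  of \<open>t\<close>.\<close>

lemma sconv_cong:
  assumes "real_kernel \<mu>" "ccont u" "ccont v" "\<And>s. s \<le> t \<Longrightarrow> u s = v s"
  shows "sconv \<mu> u t = sconv \<mu> v t"
  using norm_sconv_le[OF assms(1) ccont_diff[OF assms(2,3)], of t 0] assms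
  by (simp add: sconv_diff)

text \<open>No differentiation under the integral is involved: \<open>sconv \<mu> (prim y)\<close>
  is itself the primitive of the continuous function \<open>sconv \<mu> y\<close>.\<close>

lemma sconv_prim_has_vector_derivative:
  assumes "real_kernel \<mu>" "ccont y"
  shows "(sconv \<mu> (prim y) has_vector_derivative sconv \<mu> y t) (at t)"
  using prim_has_vector_derivative[OF ccont_sconv[OF assms], of t]
  by (simp add: prim_sconv[OF assms(1) ccont_causal[OF assms(2)]])

lemma has_real_derivative_inner:
  assumes "(u has_vector_derivative u') (at t)" "(v has_vector_derivative v') (at t)"
  shows "((\<lambda>t. u t \<bullet> v t) has_real_derivative (u t \<bullet> v' + u' \<bullet> v t)) (at t)"
  using bounded_bilinear.has_vector_derivative[OF bounded_bilinear_inner assms]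
  by (simp add: has_real_derivative_iff_has_vector_derivative)

subsection \<open>Steklov averages\<close>

text \<open>The quotient looks backward, so causality is preserved and an equation known only for
  times before T remains valid there.\<close>

definition dq :: "real \<Rightarrow> (real \<Rightarrow> 'b::{banach,second_countable_topology}) \<Rightarrow> real \<Rightarrow> 'b"
  where "dq h u t = (1 / h) *\<^sub>R (u t - u (t - h))"

definition steklov :: "real \<Rightarrow> (real \<Rightarrow> 'b::{banach,second_countable_topology}) \<Rightarrow> real \<Rightarrow> 'b"
  where "steklov h u = dq h (prim u)"

lemma ccont_shift: "ccont u \<Longrightarrow> 0 \<le> h \<Longrightarrow> ccont (\<lambda>t. u (t - h))"
  by (auto simp: ccont_def intro!: continuous_on_compose2[of UNIV u] continuous_intros)

lemma ccont_dq: "0 < h \<Longrightarrow> ccont u \<Longrightarrow> ccont (dq h u)"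
  unfolding dq_def[abs_def] by (intro ccont_scaleR ccont_diff ccont_shift) auto

lemma ccont_dq_pow: "0 < h \<Longrightarrow> ccont u \<Longrightarrow> ccont ((dq h ^^ n) u)"
  by (induction n) (auto intro: ccont_dq)

lemma causal_prim_pow: "causal u \<Longrightarrow> causal ((prim ^^ n) u)"
  by (induction n) (auto intro: causal_prim)

lemma ccont_prim_pow_causal: "causal u \<Longrightarrow> 0 < n \<Longrightarrow> ccont ((prim ^^ n) u)"
  by (cases n) (auto intro: ccont_prim causal_prim_pow)

lemma prim_shift:
  assumes "ccont u" "0 \<le> h" shows "prim (\<lambda>t. u (t - h)) t = prim u (t - h)"
proof -
  have "integrable lborel (\<lambda>x. indicator {..t - h} x *\<^sub>R u x)"
    using causal_integrable[OF ccont_causal[OF assms(1)]] by (simp add: set_integrable_def)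
  from integrable_translate(2)[OF this, of h]
  have "(LINT s|lborel. indicator {..t} s *\<^sub>R u (s - h)) = prim u (t - h)"
    by (simp add: prim_atMost ccont_causal assms(1) set_lebesgue_integral_def indicator_def)
  then show ?thesis
    by (simp add: prim_atMost ccont_causal ccont_shift assms set_lebesgue_integral_def)
qed

lemma prim_dq:
  assumes "ccont u" "0 < h" shows "prim (dq h u) = dq h (prim u)"
proof
  fix t
  show "prim (dq h u) t = dq h (prim u) t"
    using assms by (simp add: dq_def[abs_def] prim_scaleR prim_diff ccont_causal ccont_shift prim_shift)
qed

lemma prim_dq_pow:
  assumes "ccont u" "0 < h" shows "prim ((dq h ^^ n) u) = (dq h ^^ n) (prim u)"
  by (induction n) (simp_all add: prim_dq ccont_dq_pow assms)

lemma sconv_dq: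
  assumes "real_kernel \<mu>" "ccont u" "0 < h" shows "sconv \<mu> (dq h u) = dq h (sconv \<mu> u)"
proof
  fix t
  have sh: "ccont (\<lambda>t. u (t - h))" using assms by (simp add: ccont_shift)
  have "sconv \<mu> (dq h u) t = (1 / h) *\<^sub>R (sconv \<mu> u t - sconv \<mu> (\<lambda>t. u (t - h)) t)"
    using sconv_bounded_linear[OF bounded_linear_scaleR_right assms(1) ccont_diff[OF assms(2) sh], of "1 / h" t]
    unfolding dq_def[abs_def] by (simp add: sconv_diff[OF assms(1,2) sh])
  also have "sconv \<mu> (\<lambda>t. u (t - h)) t = sconv \<mu> u (t - h)"
    by (simp add: sconv_def mconv_def algebra_simps)
  finally show "sconv \<mu> (dq h u) t = dq h (sconv \<mu> u) t"
    unfolding dq_def[of h "sconv \<mu> u" t] .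
qed

lemma sconv_dq_pow:
  assumes "real_kernel \<mu>" "ccont u" "0 < h"
  shows "sconv \<mu> ((dq h ^^ n) u) = (dq h ^^ n) (sconv \<mu> u)"
  by (induction n) (simp_all add: sconv_dq ccont_dq_pow assms)

lemma dq_pow_add: "(dq h ^^ n) (\<lambda>t. u t + v t) t = (dq h ^^ n) u t + (dq h ^^ n) v t"
  by (induction n arbitrary: t) (simp_all add: dq_def algebra_simps)

lemma dq_pow_diff: "(dq h ^^ n) (\<lambda>t. u t - v t) t = (dq h ^^ n) u t - (dq h ^^ n) v t"
  by (induction n arbitrary: t) (simp_all add: dq_def algebra_simps flip: scaleR_diff_right)

lemma dq_pow_linear: "linear L \<Longrightarrow> (dq h ^^ n) (\<lambda>t. L (u t)) t = L ((dq h ^^ n) u t)"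
  by (induction n arbitrary: t) (simp_all add: dq_def linear_diff linear_scale)

lemma dq_pow_zero:
  assumes "0 < h" "\<And>s. s < T \<Longrightarrow> u s = 0" "t < T" shows "(dq h ^^ n) u t = 0"
  using assms(3)
proof (induction n arbitrary: t)
  case (Suc n)
  then have "t - h < T" using assms(1) by simp
  then show ?case using Suc by (simp add: dq_def)
qed (use assms in auto)

lemma ccont_steklov: "causal u \<Longrightarrow> 0 < h \<Longrightarrow> ccont (steklov h u)"
  by (simp add: steklov_def ccont_dq ccont_prim)

lemma causal_steklov_pow: "causal u \<Longrightarrow> 0 < h \<Longrightarrow> causal ((steklov h ^^ n) u)"
  by (induction n) (auto intro: ccont_causal ccont_steklov)

text \<open>Primitives and difference quotients commute on continuous causal functions, so all
  primitives can be collected inside. Omitting some of them then yields the derivatives of the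
  average.\<close>

lemma steklov_pow:
  assumes "causal u" "0 < h" shows "(steklov h ^^ n) u = (dq h ^^ n) ((prim ^^ n) u)"
proof (induction n)
  case (Suc n)
  have "prim ((dq h ^^ n) ((prim ^^ n) u)) = (dq h ^^ n) (prim ((prim ^^ n) u))"
  proof (cases n)
    case (Suc m)
    then show ?thesis
      by (intro prim_dq_pow ccont_prim_pow_causal assms) auto
  qed simp
  with Suc show ?case by (simp add: steklov_def)
qed simp

lemma steklov_Ioc:
  "causal u \<Longrightarrow> 0 < h \<Longrightarrow> steklov h u t = (1 / h) *\<^sub>R (LINT s:{t - h<..t}|lborel. u s)"
  by (simp add: steklov_def dq_def prim_diff_Ioc)

lemma set_integrable_Ioc: "causal u \<Longrightarrow> set_integrable lborel {a<..b} u"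
  by (rule set_integrable_subset[OF causal_integrable[of u b]]) auto

lemma steklov_mono_AE:
  fixes u v :: "real \<Rightarrow> real"
  assumes "causal u" "causal v" "0 < h" "AE s in lborel. s \<le> t \<longrightarrow> u s \<le> v s"
  shows "steklov h u t \<le> steklov h v t"
  unfolding steklov_Ioc[OF assms(1,3)] steklov_Ioc[OF assms(2,3)] real_scaleR_def
proof (rule mult_left_mono)
  show "(LINT s:{t - h<..t}|lborel. u s) \<le> (LINT s:{t - h<..t}|lborel. v s)"
    unfolding set_lebesgue_integral_def
    using set_integrable_Ioc[OF assms(1), of "t - h" t] set_integrable_Ioc[OF assms(2), of "t - h" t]
    by (intro integral_mono_AE) (use assms(4) in \<open>auto simp: set_integrable_def indicator_def elim!: eventually_mono\<close>)
qed (use assms in auto)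

lemma norm_steklov:
  assumes "causal u" "0 < h" shows "norm (steklov h u t) \<le> steklov h (\<lambda>s. norm (u s)) t"
  using set_integral_norm_bound[OF set_integrable_Ioc[OF assms(1), of "t - h" t]] assms
  by (simp add: steklov_Ioc causal_norm divide_right_mono)

lemma steklov_const_bound:
  assumes "causal u" "0 < h" "AE s in lborel. s \<le> t \<longrightarrow> norm (u s - x) \<le> B \<or> s \<le> t - h"
  shows "norm (steklov h u t - x) \<le> B"
proof -
  have int: "set_integrable lborel {t - h<..t} u"
    by (rule set_integrable_Ioc[OF assms(1)])
  have c: "set_integrable lborel {t - h<..t} (\<lambda>_. x)"
    using assms(2) by (simp add: set_integrable_def integrable_scaleR_left)
  have "(LINT s:{t - h<..t}|lborel. u s - x) = (LINT s:{t - h<..t}|lborel. u s) - h *\<^sub>R x"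
    using assms(2) by (simp add: set_integral_diff(2)[OF int c] set_integral_const)
  then have "steklov h u t - x = (1 / h) *\<^sub>R (LINT s:{t - h<..t}|lborel. u s - x)"
    using assms by (simp add: steklov_Ioc scaleR_diff_right)
  moreover have "norm (LINT s:{t - h<..t}|lborel. u s - x) \<le> (LINT s:{t - h<..t}|lborel. norm (u s - x))"
    by (intro set_integral_norm_bound set_integral_diff(1) int c)
  moreover have "\<dots> \<le> (LINT s:{t - h<..t}|lborel. B)"
    unfolding set_lebesgue_integral_def
  proof (rule integral_mono_AE)
    show "integrable lborel (\<lambda>s. indicator {t - h<..t} s *\<^sub>R norm (u s - x))"
      using set_integrable_norm[OF set_integral_diff(1)[OF int c]] by (simp add: set_integrable_def)
    show "integrable lborel (\<lambda>s. indicator {t - h<..t} s *\<^sub>R B)"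
      using assms(2) by (simp add: integrable_scaleR_left)
    show "AE s in lborel. indicator {t - h<..t} s *\<^sub>R norm (u s - x) \<le> indicator {t - h<..t} s *\<^sub>R B"
      using assms(3) by eventually_elim (auto simp: indicator_def)
  qed
  moreover have "(LINT s:{t - h<..t}|lborel. B) = h * B"
    using assms(2) by (simp add: set_integral_const)
  ultimately have "norm (steklov h u t - x) = (1 / h) * norm (LINT s:{t - h<..t}|lborel. u s - x)"
    and "norm (LINT s:{t - h<..t}|lborel. u s - x) \<le> h * B"
    using assms(2) by auto
  then have "h * norm (steklov h u t - x) \<le> h * B" using assms(2) by (simp add: field_simps)
  then show ?thesis using assms(2) by simp
qed

lemma norm_steklov_pow_le:
  assumes "causal u" "0 < h" "0 < n" "AE s in lborel. s \<le> t \<longrightarrow> norm (u s) \<le> B" "s \<le> t"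
  shows "norm ((steklov h ^^ n) u s) \<le> B"
  using assms(3,5)
proof (induction n arbitrary: s)
  case (Suc n)
  have "AE r in lborel. r \<le> s \<longrightarrow> norm ((steklov h ^^ n) u r) \<le> B"
  proof (cases "n = 0")
    case True
    then show ?thesis using assms(4) by eventually_elim (use True Suc.prems in auto)
  next
    case False
    then have "norm ((steklov h ^^ n) u r) \<le> B" if "r \<le> s" for r
      using that Suc by (intro Suc.IH) auto
    then show ?thesis by simp
  qed
  then have "AE r in lborel. r \<le> s \<longrightarrow> norm ((steklov h ^^ n) u r - 0) \<le> B \<or> r \<le> s - h"
    by eventually_elim auto
  from steklov_const_bound[OF causal_steklov_pow[OF assms(1,2)] assms(2) this] show ?case by simp
qed simp

lemma norm_steklov_pow:
  assumes "causal u" "0 < h"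
  shows "norm ((steklov h ^^ n) u t) \<le> (steklov h ^^ n) (\<lambda>s. norm (u s)) t"
proof (induction n arbitrary: t)
  case (Suc n)
  note c = causal_steklov_pow[OF assms(1,2)] causal_steklov_pow[OF causal_norm[OF assms(1)] assms(2)]
  have "norm ((steklov h ^^ Suc n) u t) \<le> steklov h (\<lambda>s. norm ((steklov h ^^ n) u s)) t"
    using norm_steklov[OF c(1) assms(2)] by simp
  also have "\<dots> \<le> steklov h ((steklov h ^^ n) (\<lambda>s. norm (u s))) t"
    using Suc by (intro steklov_mono_AE causal_norm c assms) auto
  finally show ?case by simp
qed simp

lemma steklov_mono_le:
  fixes u :: "real \<Rightarrow> real"
  assumes "causal u" "0 < h" "\<And>s. s \<le> t \<Longrightarrow> u s \<le> u t"
  shows "steklov h u t \<le> u t"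
proof -
  have "steklov h u t \<le> (1 / h) * (LINT s:{t - h<..t}|lborel. u t)"
    unfolding steklov_Ioc[OF assms(1,2)] real_scaleR_def using assms
    by (intro mult_left_mono set_integral_mono set_integrable_Ioc[OF assms(1)])
      (auto simp: set_integrable_def integrable_scaleR_left)
  then show ?thesis using assms(2) by (simp add: set_integral_const)
qed

lemma prim_nonneg_mono:
  fixes u :: "real \<Rightarrow> real"
  assumes "causal u" "\<And>s. 0 \<le> u s" "s \<le> t" shows "prim u s \<le> prim u t"
proof -
  have "0 \<le> (LINT s:{s<..t}|lborel. u s)"
    unfolding set_lebesgue_integral_def using assms by (intro Bochner_Integration.integral_nonneg) auto
  then show ?thesis using prim_diff_Ioc[OF assms(1,3)] by simp
qed

lemma steklov_nonneg:
  fixes u :: "real \<Rightarrow> real"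
  assumes "causal u" "0 < h" "\<And>s. 0 \<le> u s" shows "0 \<le> (steklov h ^^ n) u t"
proof (induction n arbitrary: t)
  case (Suc n)
  note c = causal_steklov_pow[OF assms(1,2)]
  have "0 \<le> (LINT s:{t - h<..t}|lborel. (steklov h ^^ n) u s)"
    unfolding set_lebesgue_integral_def using Suc by (intro Bochner_Integration.integral_nonneg) auto
  then show ?case using assms(2) by (simp add: steklov_Ioc[OF c assms(2)])
qed (use assms in auto)

text \<open>The primitive of an average is the average of the primitive, and a backward average of a
  nondecreasing function lies below its value at the right end. This bounds the averaged source in
  L^1 independently of \<open>h\<close>.\<close>

lemma prim_steklov_pow_le:
  fixes u :: "real \<Rightarrow> real"
  assumes "causal u" "0 < h" "\<And>s. 0 \<le> u s"
  shows "prim ((steklov h ^^ n) u) t \<le> prim u t"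
proof (induction n)
  case (Suc n)
  let ?v = "(steklov h ^^ n) u"
  note c = causal_steklov_pow[OF assms(1,2), of n]
  have "prim ((steklov h ^^ Suc n) u) t = steklov h (prim ?v) t"
    by (simp add: steklov_def prim_dq[OF ccont_prim[OF c] assms(2)])
  also have "\<dots> \<le> prim ?v t"
    by (intro steklov_mono_le causal_prim c assms prim_nonneg_mono steklov_nonneg)
  finally show ?case using Suc by simp
qed simp

text \<open>Shifting the window by \<open>t - s\<close> turns the average at \<open>t\<close> into
  an average at \<open>s\<close> of a pointwise larger function.\<close>

lemma steklov_mono_mono:
  fixes u :: "real \<Rightarrow> real"
  assumes "causal u" "0 < h" "\<And>s t. s \<le> t \<Longrightarrow> u s \<le> u t" "s \<le> t"
  shows "(steklov h ^^ n) u s \<le> (steklov h ^^ n) u t"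
  using assms(4)
proof (induction n arbitrary: s t)
  case (Suc n)
  let ?v = "(steklov h ^^ n) u"
  note c = causal_steklov_pow[OF assms(1,2), of n]
  have sh: "set_integrable lborel {s - h<..s} (\<lambda>r. ?v (r + (t - s)))"
    using integrable_translate(1)[of "\<lambda>r. indicator {t - h<..t} r *\<^sub>R ?v r" "s - t"]
      set_integrable_Ioc[OF c, of "t - h" t]
    by (simp add: set_integrable_def indicator_def algebra_simps)
  have "(LINT r:{s - h<..s}|lborel. ?v r) \<le> (LINT r:{s - h<..s}|lborel. ?v (r + (t - s)))"
    using Suc by (intro set_integral_mono sh set_integrable_Ioc[OF c]) auto
  also have "\<dots> = (LINT r:{t - h<..t}|lborel. ?v r)"
    using integrable_translate(2)[of "\<lambda>r. indicator {t - h<..t} r *\<^sub>R ?v r" "s - t"]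
      set_integrable_Ioc[OF c, of "t - h" t]
    by (simp add: set_integrable_def set_lebesgue_integral_def indicator_def algebra_simps)
  finally show ?case using assms(2) by (simp add: steklov_Ioc[OF c assms(2)] divide_right_mono)
qed (use assms in auto)

text \<open>Each average reaches back by \<open>h\<close>, so \<open>n\<close> of them see only the
  interval from \<open>t - n h\<close> to \<open>t\<close>. In the induction, \<open>n - m\<close>
  is the number of averages still to be taken.\<close>

lemma steklov_pow_close:
  assumes "causal u" "0 < h" "\<And>s. t - real n * h \<le> s \<Longrightarrow> s \<le> t \<Longrightarrow> norm (u s - x) \<le> B"
  shows "norm ((steklov h ^^ n) u t - x) \<le> B"
proof -
  have "norm ((steklov h ^^ m) u s - x) \<le> B" if "t - real (n - m) * h \<le> s" "s \<le> t" "m \<le> n" for m s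
    using that
  proof (induction m arbitrary: s)
    case 0
    then show ?case using assms(3) by simp
  next
    case (Suc m)
    have "norm ((steklov h ^^ m) u r - x) \<le> B" if "r \<le> s" "s - h < r" for r
      using that Suc.prems by (intro Suc.IH) (auto simp: of_nat_diff algebra_simps)
    then show ?case
      using steklov_const_bound[OF causal_steklov_pow[OF assms(1,2)] assms(2), of s m x B]
      by (force intro!: always_eventually)
  qed
  from this[of n t] show ?thesis by simp
qed

lemma steklov_pow_tendsto:
  assumes "ccont u"
  shows "((\<lambda>h. (steklov h ^^ n) u t) \<longlongrightarrow> u t) (at_right 0)"
proof (rule tendstoI)
  fix e :: real assume "e > 0"
  then obtain d where d: "d > 0" "\<And>s. \<bar>s - t\<bar> < d \<Longrightarrow> norm (u s - u t) < e / 2"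
    using ccont_isCont[OF assms, of t] unfolding continuous_at_eps_delta dist_norm
    by (metis half_gt_zero real_norm_def)
  show "\<forall>\<^sub>F h in at_right 0. dist ((steklov h ^^ n) u t) (u t) < e"
    unfolding eventually_at_right_field
  proof (intro exI[of _ "d / real (Suc n)"] conjI allI impI)
    fix h :: real assume h: "0 < h" "h < d / real (Suc n)"
    have "real n * h < d"
      using h by (simp add: field_simps)
    then have "norm ((steklov h ^^ n) u t - u t) \<le> e / 2"
      by (intro steklov_pow_close ccont_causal assms h less_imp_le[OF d(2)]) auto
    then show "dist ((steklov h ^^ n) u t) (u t) < e" using \<open>e > 0\<close> by (simp add: dist_norm)
  qed (use d in auto)
qed

section \<open>Positive kernels acting on Hilbert space valued functions\<close>

definition orthonormal_set :: "'h::real_inner set \<Rightarrow> bool"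
  where "orthonormal_set B \<longleftrightarrow> finite B \<and> (\<forall>a\<in>B. \<forall>b\<in>B. a \<bullet> b = (if a = b then 1 else 0))"

definition oproj :: "'h::real_inner set \<Rightarrow> 'h \<Rightarrow> 'h"
  where "oproj B x = (\<Sum>b\<in>B. (x \<bullet> b) *\<^sub>R b)"

lemma oproj_inner: "orthonormal_set B \<Longrightarrow> b \<in> B \<Longrightarrow> oproj B x \<bullet> b = x \<bullet> b"
proof -
  assume B: "orthonormal_set B" "b \<in> B"
  have "oproj B x \<bullet> b = (\<Sum>a\<in>B. if a = b then x \<bullet> b else 0)"
    unfolding oproj_def inner_sum_left
    by (rule sum.cong) (use B in \<open>auto simp: orthonormal_set_def\<close>)
  then show ?thesis using B by (simp add: orthonormal_set_def)
qed

lemma oproj_inner_oproj: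
  "orthonormal_set B \<Longrightarrow> oproj B x \<bullet> oproj B y = (\<Sum>b\<in>B. (x \<bullet> b) * (y \<bullet> b))"
  by (simp add: oproj_def[of B y] inner_sum_right oproj_inner mult.commute)

lemma norm_oproj_le:
  assumes "orthonormal_set B" shows "norm (oproj B x) \<le> norm x"
proof -
  have "norm (oproj B x) * norm (oproj B x) = x \<bullet> oproj B x"
    using oproj_inner_oproj[OF assms, of x x]
    by (simp add: oproj_def[of B x] inner_sum_right flip: power2_eq_square power2_norm_eq_inner)
  also have "\<dots> \<le> norm x * norm (oproj B x)" by (rule norm_cauchy_schwarz)
  finally show ?thesis by (cases "oproj B x = 0") auto
qed

lemma linear_oproj: "linear (oproj B)"
  unfolding oproj_def[abs_def]
  by (rule linearI) (simp_all add: inner_add_left scaleR_add_left sum.distrib scaleR_sum_right)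

lemma oproj_span:
  assumes "orthonormal_set B" "x \<in> span B" shows "oproj B x = x"
proof -
  have "oproj B b = b" if "b \<in> B" for b
  proof -
    have "oproj B b = (\<Sum>a\<in>B. if a = b then b else 0)"
      unfolding oproj_def by (rule sum.cong) (use assms that in \<open>auto simp: orthonormal_set_def\<close>)
    then show ?thesis using assms that by (simp add: orthonormal_set_def)
  qed
  then show ?thesis
    using linear_eq_on_span[OF linear_oproj linear_id, of B B x] assms by simp
qed

text \<open>One Gram-Schmidt step per element; a vector already in the span is skipped.\<close>

lemma orthonormal_set_spanning:
  assumes "finite (S :: 'h::real_inner set)"
  shows "\<exists>B. orthonormal_set B \<and> S \<subseteq> span B"
  using assms
proof induction
  case empty
  show ?case by (intro exI[of _ "{}"]) (auto simp: orthonormal_set_def)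
next
  case (insert x S)
  then obtain B where B: "orthonormal_set B" "S \<subseteq> span B" by blast
  define r where "r = x - oproj B x"
  have orth: "r \<bullet> b = 0" if "b \<in> B" for b
    using oproj_inner[OF B(1) that] by (simp add: r_def inner_diff_left)
  have in_span: "oproj B x \<in> span B"
    unfolding oproj_def by (intro span_sum span_scale span_base)
  show ?case
  proof (cases "r = 0")
    case True
    then show ?thesis using B in_span by (intro exI[of _ B]) (auto simp: r_def)
  next
    case False
    define e where "e = (1 / norm r) *\<^sub>R r"
    have e: "e \<bullet> e = 1" "\<And>b. b \<in> B \<Longrightarrow> e \<bullet> b = 0"
      using False orth by (auto simp: e_def dot_square_norm power2_eq_square)
    then have "\<And>b. b \<in> B \<Longrightarrow> b \<bullet> e = 0" by (simp add: inner_commute)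
    with e B(1) have "orthonormal_set (insert e B)"
      by (auto simp: orthonormal_set_def)
    moreover have "x \<in> span (insert e B)"
    proof -
      have "x = norm r *\<^sub>R e + oproj B x" using False by (simp add: e_def r_def)
      moreover have "oproj B x \<in> span (insert e B)"
        using in_span span_mono[of B "insert e B"] by blast
      ultimately show ?thesis by (metis span_add span_scale span_base insertI1)
    qed
    moreover have "S \<subseteq> span (insert e B)" using B(2) span_mono[of B "insert e B"] by blast
    ultimately show ?thesis by blast
  qed
qed

text \<open>The \<open>n\<close>-th set spans the first \<open>n + 1\<close> points of a dense
  sequence. The sets need not be nested: projections have norm at most 1, which carries the
  convergence from the dense points to every vector.\<close>

lemma orthonormal_approximation:
  obtains B :: "nat \<Rightarrow> 'h::{real_inner,second_countable_topology} set"
  where "\<And>n. orthonormal_set (B n)" "\<And>x. (\<lambda>n. oproj (B n) x) \<longlonglongrightarrow> x"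
proof -
  obtain D :: "'h set" where D: "countable D" "\<And>X. open X \<Longrightarrow> X \<noteq> {} \<Longrightarrow> \<exists>d\<in>D. d \<in> X"
    using countable_dense_setE by blast
  have "D \<noteq> {}" using D(2)[of UNIV] by auto
  have "\<exists>B. orthonormal_set B \<and> from_nat_into D ` {..n} \<subseteq> span B" for n
    by (rule orthonormal_set_spanning) simp
  then obtain B where B: "\<And>n. orthonormal_set (B n)" "\<And>n. from_nat_into D ` {..n} \<subseteq> span (B n)"
    by metis
  have "(\<lambda>n. oproj (B n) x) \<longlonglongrightarrow> x" for x
  proof (rule LIMSEQ_I)
    fix e :: real assume "e > 0"
    then obtain d where d: "d \<in> D" "dist x d < e / 2"
      using D(2)[of "ball x (e / 2)"] by auto
    then obtain k where k: "d = from_nat_into D k"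
      using from_nat_into_surj[OF D(1)] by metis
    show "\<exists>no. \<forall>n\<ge>no. norm (oproj (B n) x - x) < e"
    proof (intro exI[of _ k] allI impI)
      fix n assume "n \<ge> k"
      then have "oproj (B n) d = d" using B(2)[of n] k by (intro oproj_span B) auto
      then have "oproj (B n) x - x = oproj (B n) (x - d) - (x - d)"
        by (simp add: linear_diff[OF linear_oproj])
      also have "norm \<dots> \<le> norm (oproj (B n) (x - d)) + norm (x - d)" by (rule norm_triangle_ineq4)
      also have "\<dots> \<le> norm (x - d) + norm (x - d)" using norm_oproj_le[OF B(1)] by simp
      finally show "norm (oproj (B n) x - x) < e" using d(2) by (simp add: dist_norm)
    qed
  qed
  with B(1) show thesis by (rule that)
qed

lemma ccont_mult_inner:
  fixes u v :: "real \<Rightarrow> 'h::{real_inner,banach,second_countable_topology}"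
  shows "ccont u \<Longrightarrow> ccont v \<Longrightarrow> ccont (\<lambda>t. u t \<bullet> v t)"
  by (auto simp: ccont_def intro: continuous_intros)

lemma ccont_mult:
  fixes u v :: "real \<Rightarrow> real"
  shows "ccont u \<Longrightarrow> ccont v \<Longrightarrow> ccont (\<lambda>t. u t * v t)"
  by (auto simp: ccont_def intro: continuous_intros)

lemma ccont_cmult: "ccont u \<Longrightarrow> ccont (\<lambda>t. c * u t :: real)"
  using ccont_scaleR[of u c] by simp

lemma prim_cmult: "prim (\<lambda>t. c * u t :: real) t = c * prim u t"
  using prim_scaleR[of c u t] by simp

lemma ccont_norm: "ccont u \<Longrightarrow> ccont (\<lambda>t. norm (u t))"
  by (auto simp: ccont_def intro: continuous_intros)

lemma prim_sum:
  assumes "finite I" "\<And>i. i \<in> I \<Longrightarrow> causal (u i)"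
  shows "prim (\<lambda>s. \<Sum>i\<in>I. u i s) t = (\<Sum>i\<in>I. prim (u i) t)"
  using causal_integrable_Icc[OF assms(2), of _ 0 t]
  unfolding prim_def set_lebesgue_integral_def set_integrable_def scaleR_sum_right
  by (intro Bochner_Integration.integral_sum)

text \<open>For the projected functions the integral is a finite sum of the scalar integrals in the
  hypothesis. The product of the norms of \<open>X\<close> and \<open>y\<close> dominates the
  projected integrands, so the sign survives the limit.\<close>

lemma prim_inner_nonneg:
  fixes X y :: "real \<Rightarrow> 'h::{real_inner,banach,second_countable_topology}"
  assumes X: "ccont X" and y: "ccont y"
    and nonneg: "\<And>b. 0 \<le> prim (\<lambda>s. (X s \<bullet> b) * (y s \<bullet> b)) t"
  shows "0 \<le> prim (\<lambda>s. X s \<bullet> y s) t"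
proof -
  obtain B :: "nat \<Rightarrow> 'h set"
    where B: "\<And>n. orthonormal_set (B n)" "\<And>x. (\<lambda>n. oproj (B n) x) \<longlonglongrightarrow> x"
    using orthonormal_approximation by blast
  have [measurable]: "X \<in> borel_measurable borel" "y \<in> borel_measurable borel"
    using X y by (auto intro: ccont_measurable)
  have "(\<lambda>n. prim (\<lambda>s. oproj (B n) (X s) \<bullet> oproj (B n) (y s)) t) \<longlonglongrightarrow> prim (\<lambda>s. X s \<bullet> y s) t"
    unfolding prim_def set_lebesgue_integral_def
  proof (rule integral_dominated_convergence)
    have "causal (\<lambda>s. norm (X s) * norm (y s))"
      by (intro ccont_causal ccont_mult ccont_norm X y)
    then show "integrable lborel (\<lambda>s. indicator {0..t} s *\<^sub>R (norm (X s) * norm (y s)))"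
      by (rule causal_integrable_Icc[unfolded set_integrable_def])
    show "AE s in lborel. (\<lambda>n. indicator {0..t} s *\<^sub>R (oproj (B n) (X s) \<bullet> oproj (B n) (y s)))
        \<longlonglongrightarrow> indicator {0..t} s *\<^sub>R (X s \<bullet> y s)"
      by (intro always_eventually allI tendsto_intros B)
    show "AE s in lborel. norm (indicator {0..t} s *\<^sub>R (oproj (B n) (X s) \<bullet> oproj (B n) (y s)))
        \<le> indicator {0..t} s *\<^sub>R (norm (X s) * norm (y s))" for n
    proof (intro always_eventually allI)
      fix s
      have "\<bar>oproj (B n) (X s) \<bullet> oproj (B n) (y s)\<bar> \<le> norm (oproj (B n) (X s)) * norm (oproj (B n) (y s))"
        by (rule Cauchy_Schwarz_ineq2)
      also have "\<dots> \<le> norm (X s) * norm (y s)"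
        by (intro mult_mono norm_oproj_le B) auto
      finally show "norm (indicator {0..t} s *\<^sub>R (oproj (B n) (X s) \<bullet> oproj (B n) (y s)))
        \<le> indicator {0..t} s *\<^sub>R (norm (X s) * norm (y s))" by (auto simp: indicator_def)
    qed
    show "(\<lambda>s. indicator {0..t} s *\<^sub>R (oproj (B n) (X s) \<bullet> oproj (B n) (y s))) \<in> borel_measurable lborel" for n
      unfolding oproj_def by measurable
  qed measurable
  moreover have "0 \<le> prim (\<lambda>s. oproj (B n) (X s) \<bullet> oproj (B n) (y s)) t" for n
  proof -
    have "prim (\<lambda>s. oproj (B n) (X s) \<bullet> oproj (B n) (y s)) t
        = (\<Sum>b\<in>B n. prim (\<lambda>s. (X s \<bullet> b) * (y s \<bullet> b)) t)"
      unfolding oproj_inner_oproj[OF B(1)] using B(1)[of n]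
      by (intro prim_sum ccont_causal ccont_mult ccont_inner X y) (auto simp: orthonormal_set_def)
    then show ?thesis by (simp add: sum_nonneg nonneg)
  qed
  ultimately show ?thesis by (intro LIMSEQ_le_const) auto
qed

definition conv_pos :: "real_measure \<Rightarrow> real \<Rightarrow> bool"
  where "conv_pos \<mu> T \<longleftrightarrow>
    (\<forall>t<T. \<forall>y :: real \<Rightarrow> real. ccont y \<longrightarrow> 0 \<le> prim (\<lambda>s. sconv \<mu> y s * y s) t)"

text \<open>With \<open>u = prim y\<close> this is the sign of the integral of (K * u_t) u for
  functions with u(0) = 0. It is the common consequence of the alternative conditions on
  K_2.\<close>

definition conv_deriv_pos :: "real_measure \<Rightarrow> real \<Rightarrow> bool"
  where "conv_deriv_pos \<mu> T \<longleftrightarrow>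
    (\<forall>t<T. \<forall>y :: real \<Rightarrow> real. ccont y \<longrightarrow> 0 \<le> prim (\<lambda>s. sconv \<mu> y s * prim y s) t)"

lemma conv_pos_inner:
  fixes y :: "real \<Rightarrow> 'h::{real_inner,banach,second_countable_topology}"
  assumes "real_kernel \<mu>" "conv_pos \<mu> T" "t < T" "ccont y"
  shows "0 \<le> prim (\<lambda>s. sconv \<mu> y s \<bullet> y s) t"
proof (rule prim_inner_nonneg)
  show "0 \<le> prim (\<lambda>s. (sconv \<mu> y s \<bullet> b) * (y s \<bullet> b)) t" for b
    using assms(2,3) ccont_inner[OF assms(4), of b]
    unfolding conv_pos_def sconv_bounded_linear[OF bounded_linear_inner_left assms(1,4), symmetric] by blast
qed (use assms in \<open>auto intro: ccont_sconv\<close>)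

lemma conv_deriv_pos_inner:
  fixes y :: "real \<Rightarrow> 'h::{real_inner,banach,second_countable_topology}"
  assumes "real_kernel \<mu>" "conv_deriv_pos \<mu> T" "t < T" "ccont y"
  shows "0 \<le> prim (\<lambda>s. sconv \<mu> y s \<bullet> prim y s) t"
proof (rule prim_inner_nonneg)
  show "0 \<le> prim (\<lambda>s. (sconv \<mu> y s \<bullet> b) * (prim y s \<bullet> b)) t" for b
    using assms(2,3) ccont_inner[OF assms(4), of b]
    unfolding conv_deriv_pos_def sconv_bounded_linear[OF bounded_linear_inner_left assms(1,4), symmetric]
      prim_inner[OF ccont_causal[OF assms(4)], symmetric] by blast
qed (use assms in \<open>auto intro: ccont_sconv ccont_prim ccont_causal\<close>)

section \<open>Energy estimates\<close>

lemma prim_inner_deriv_self: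
  fixes u :: "real \<Rightarrow> 'h::{real_inner,banach,second_countable_topology}"
  assumes "ccont u" "ccont u'" "\<And>s. (u has_vector_derivative u' s) (at s)" "0 \<le> t"
  shows "prim (\<lambda>s. u s \<bullet> u' s) t = (norm (u t))\<^sup>2 / 2"
proof -
  have "prim (\<lambda>s. u s \<bullet> u' s) t = u t \<bullet> u t / 2 - u 0 \<bullet> u 0 / 2"
  proof (rule prim_derivative)
    show "((\<lambda>s. u s \<bullet> u s / 2) has_real_derivative u s \<bullet> u' s) (at s)" for s
      using has_real_derivative_inner[OF assms(3) assms(3), of s]
      by (auto intro!: derivative_eq_intros simp: inner_commute)
  qed (use assms in \<open>auto intro: ccont_continuous ccont_mult_inner\<close>)
  then show ?thesis using ccont_nonpos[OF assms(1)] by (simp add: power2_norm_eq_inner)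
qed

text \<open>The part of the test function with \<alpha> contributes a nonnegative integral by
  positivity of the kernel. The other part is the time derivative of the tested quantity and
  integrates to half a squared norm.\<close>

lemma relaxation_dissipation:
  fixes z :: "real \<Rightarrow> 'g::{real_inner,banach,second_countable_topology}"
  assumes \<mu>: "real_kernel \<mu>" "conv_pos \<mu> T" and z: "ccont z" and t: "0 \<le> t" "t < T"
    and "0 \<le> \<alpha>"
  shows "A / 2 * (norm (sconv \<mu> (prim z) t))\<^sup>2
    \<le> prim (\<lambda>s. sconv \<mu> (prim z) s \<bullet> (\<alpha> *\<^sub>R prim z s + A *\<^sub>R sconv \<mu> z s)) t"
proof -
  have c: "ccont (prim z)" "ccont (sconv \<mu> z)" "ccont (sconv \<mu> (prim z))"
    using \<mu> z by (auto intro!: ccont_sconv ccont_prim ccont_causal)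
  have "prim (\<lambda>s. sconv \<mu> (prim z) s \<bullet> (\<alpha> *\<^sub>R prim z s + A *\<^sub>R sconv \<mu> z s)) t
    = prim (\<lambda>s. \<alpha> *\<^sub>R (sconv \<mu> (prim z) s \<bullet> prim z s) + A *\<^sub>R (sconv \<mu> (prim z) s \<bullet> sconv \<mu> z s)) t"
    by (simp add: inner_add_right)
  also have "\<dots> = \<alpha> * prim (\<lambda>s. sconv \<mu> (prim z) s \<bullet> prim z s) t
      + A * prim (\<lambda>s. sconv \<mu> (prim z) s \<bullet> sconv \<mu> z s) t"
    by (subst prim_add) (auto intro!: ccont_causal ccont_cmult ccont_mult_inner c simp: prim_cmult)
  also have "prim (\<lambda>s. sconv \<mu> (prim z) s \<bullet> sconv \<mu> z s) t = (norm (sconv \<mu> (prim z) t))\<^sup>2 / 2"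
    by (intro prim_inner_deriv_self c sconv_prim_has_vector_derivative \<mu> z t)
  finally show ?thesis
    using conv_pos_inner[OF \<mu> t(2) c(1)] assms by simp
qed

lemma prim_le_bound:
  fixes u :: "real \<Rightarrow> real"
  assumes "causal u" "0 \<le> t" "\<And>s. 0 \<le> s \<Longrightarrow> s \<le> t \<Longrightarrow> u s \<le> B"
  shows "prim u t \<le> t * B"
proof -
  have "prim u t \<le> (LINT s:{0..t}|lborel. B)"
    unfolding prim_def using assms
    by (intro set_integral_mono causal_integrable_Icc[OF assms(1)])
      (auto simp: set_integrable_def integrable_scaleR_left)
  then show ?thesis using assms(2) by (simp add: set_integral_const)
qed

lemma norm_prim_bound:
  assumes "causal u" "0 \<le> t" "\<And>s. 0 \<le> s \<Longrightarrow> s \<le> t \<Longrightarrow> norm (u s) \<le> B"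
  shows "norm (prim u t) \<le> t * B"
  using norm_prim_le[OF assms(1), of t] prim_le_bound[OF causal_norm[OF assms(1)], of t B] assms by auto

text \<open>
  Testing with the derivative of \<open>\<alpha> U + A \<KK>\<^sub>1 * U'\<close>, where \<open>U''' = (y, z)\<close>. Any \<open>\<alpha>\<close> strictly below
  the coefficient \<open>m\<close> gives control of \<open>U'\<close>; the dissipation hypothesis then controls
  \<open>A \<KK>\<^sub>1 * U'\<close> separately, and hence \<open>U\<close>.
\<close>

lemma energy_bound:
  fixes y F :: "real \<Rightarrow> 'h::{real_inner,banach,second_countable_topology}"
    and z X :: "real \<Rightarrow> 'g::{real_inner,banach,second_countable_topology}"
    and \<alpha> A :: real and \<mu> :: real_measure
  defines "p \<equiv> \<lambda>t. \<alpha> *\<^sub>R prim (prim y) t + A *\<^sub>R sconv \<mu> (prim y) t"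
    and "q \<equiv> \<lambda>t. \<alpha> *\<^sub>R prim (prim (prim z)) t + A *\<^sub>R sconv \<mu> (prim (prim z)) t"
    and "q' \<equiv> \<lambda>t. \<alpha> *\<^sub>R prim (prim z) t + A *\<^sub>R sconv \<mu> (prim z) t"
  assumes \<mu>: "real_kernel \<mu>" "conv_pos \<mu> T"
    and y: "ccont y" and z: "ccont z" and F: "ccont F" and X: "ccont X" and \<eta>: "ccont \<eta>"
    and const: "0 \<le> A" "0 < \<alpha>" "\<alpha> < m" "0 < \<beta>" "0 \<le> Fb" "0 \<le> \<kappa>"
    and Fb: "\<And>t. t < T \<Longrightarrow> prim (\<lambda>s. norm (F s)) t \<le> Fb"
    and \<eta>_nonneg: "\<And>t. t < T \<Longrightarrow> 0 \<le> \<eta> t" and \<eta>_le: "\<And>t. t < T \<Longrightarrow> prim \<eta> t \<le> 1"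
    and dissip: "\<And>t. 0 \<le> t \<Longrightarrow> t < T \<Longrightarrow>
        \<kappa> / 2 * (norm (A *\<^sub>R sconv \<mu> (prim (prim z)) t))\<^sup>2 \<le> prim (\<lambda>s. X s \<bullet> q' s) t"
    and eq: "\<And>t. t < T \<Longrightarrow> (A *\<^sub>R sconv \<mu> y t + m *\<^sub>R prim y t - F t) \<bullet> p t
        + ((\<beta> / \<alpha>) *\<^sub>R q t + X t + prim \<eta> t *\<^sub>R \<zeta>) \<bullet> q' t = 0"
    and t: "0 \<le> t" "t < T"
  shows "(m - \<alpha>) * \<alpha> / 2 * (norm (prim (prim y) t))\<^sup>2 + \<beta> / (2 * \<alpha>) * (norm (q t))\<^sup>2
      + \<kappa> / 2 * (norm (A *\<^sub>R sconv \<mu> (prim (prim z)) t))\<^sup>2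
    \<le> (sqrt 2 * Fb + 2 * norm \<zeta> * sqrt (2 * \<alpha> / \<beta>))\<^sup>2"
proof -
  define p' where "p' t = \<alpha> *\<^sub>R prim y t + A *\<^sub>R sconv \<mu> y t" for t
  have c: "ccont (prim y)" "ccont (prim (prim y))" "ccont (prim z)" "ccont (prim (prim z))"
    "ccont (prim (prim (prim z)))"
    using y z by (auto intro!: ccont_prim ccont_causal)
  have cs: "ccont (sconv \<mu> y)" "ccont (sconv \<mu> (prim y))" "ccont (sconv \<mu> (prim z))"
    "ccont (sconv \<mu> (prim (prim z)))"
    using \<mu> c y z by (auto intro!: ccont_sconv)
  have cp: "ccont p" "ccont p'" "ccont q" "ccont q'"
    unfolding p_def p'_def[abs_def] q_def q'_def by (intro ccont_add ccont_scaleR c cs)+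
  have c\<eta>: "ccont (prim \<eta>)" by (intro ccont_prim ccont_causal \<eta>)
  have dp: "(p has_vector_derivative p' s) (at s)" for s
    unfolding p_def p'_def
    by (intro has_vector_derivative_add bounded_linear.has_vector_derivative[OF bounded_linear_scaleR_right]
      prim_has_vector_derivative sconv_prim_has_vector_derivative c y \<mu>)
  have dq: "(q has_vector_derivative q' s) (at s)" for s
    unfolding q_def q'_def
    by (intro has_vector_derivative_add bounded_linear.has_vector_derivative[OF bounded_linear_scaleR_right]
      prim_has_vector_derivative sconv_prim_has_vector_derivative c z \<mu>)
  have dy: "(prim (prim y) has_vector_derivative prim y s) (at s)" for s
    by (intro prim_has_vector_derivative c)
  have d\<eta>: "(prim \<eta> has_real_derivative \<eta> s) (at s)" for s
    unfolding has_real_derivative_iff_has_vector_derivative by (intro prim_has_vector_derivative \<eta>)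
  \<comment> \<open>The last term belongs to the step-shaped forcing:
    \<open>prim \<eta> s * (q' s \<bullet> \<zeta>)\<close> is written as a derivative minus
    \<open>\<eta> s * (q s \<bullet> \<zeta>)\<close>, because the energy controls \<open>q\<close>
    but not \<open>q'\<close>.\<close>
  define \<Phi> where "\<Phi> s = 1 / 2 * (p s \<bullet> p s) + (m - \<alpha>) * \<alpha> / 2 * (prim (prim y) s \<bullet> prim (prim y) s)
      + \<beta> / (2 * \<alpha>) * (q s \<bullet> q s) + prim \<eta> s * (q s \<bullet> \<zeta>)" for s
  define \<Phi>' where "\<Phi>' s = p s \<bullet> p' s + (m - \<alpha>) * \<alpha> * (prim (prim y) s \<bullet> prim y s)
      + \<beta> / \<alpha> * (q s \<bullet> q' s) + prim \<eta> s * (q' s \<bullet> \<zeta>) + \<eta> s * (q s \<bullet> \<zeta>)" for s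
  have d\<Phi>: "(\<Phi> has_real_derivative \<Phi>' s) (at s)" for s
  proof -
    have d: "((\<lambda>t. p t \<bullet> p t) has_real_derivative 2 * (p s \<bullet> p' s)) (at s)"
      "((\<lambda>t. q t \<bullet> q t) has_real_derivative 2 * (q s \<bullet> q' s)) (at s)"
      "((\<lambda>t. prim (prim y) t \<bullet> prim (prim y) t) has_real_derivative 2 * (prim (prim y) s \<bullet> prim y s)) (at s)"
      "((\<lambda>t. q t \<bullet> \<zeta>) has_real_derivative q' s \<bullet> \<zeta>) (at s)"
      using has_real_derivative_inner[OF dp dp, of s] has_real_derivative_inner[OF dq dq, of s]
        has_real_derivative_inner[OF dy dy, of s]
        has_real_derivative_inner[OF dq[of s] has_vector_derivative_const[of \<zeta>]]
      by (simp_all add: inner_commute)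
    show ?thesis unfolding \<Phi>_def[abs_def] \<Phi>'_def
      by (rule derivative_eq_intros d d\<eta> refl)+ (use const in \<open>simp add: field_simps\<close>)
  qed
  define R where "R s = F s \<bullet> p s + \<eta> s * (q s \<bullet> \<zeta>)" for s
  \<comment> \<open>Split \<open>m\<close> into \<alpha> and \<open>m - \<alpha>\<close>. The first
    part joins \<open>A *\<^sub>R sconv \<mu> y\<close> to form \<open>p'\<close>. The second,
    tested with \<open>p\<close>, gives the derivative of the second term of \<Phi> and a quantity
    whose integral is nonnegative by positivity of the kernel.\<close>
  have \<Phi>'_eq: "\<Phi>' s = R s - (m - \<alpha>) * A * (sconv \<mu> (prim y) s \<bullet> prim y s) - X s \<bullet> q' s" if "s < T" for s
  proof -
    have 1: "(A *\<^sub>R sconv \<mu> y s + m *\<^sub>R prim y s - F s) \<bullet> p s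
        = p s \<bullet> p' s + (m - \<alpha>) * (prim y s \<bullet> p s) - F s \<bullet> p s"
      unfolding p'_def by (simp add: inner_add_left inner_add_right inner_diff_left algebra_simps inner_commute)
    have 2: "prim y s \<bullet> p s = \<alpha> * (prim (prim y) s \<bullet> prim y s) + A * (sconv \<mu> (prim y) s \<bullet> prim y s)"
      unfolding p_def by (simp add: inner_add_right inner_commute)
    have 3: "((\<beta> / \<alpha>) *\<^sub>R q s + X s + prim \<eta> s *\<^sub>R \<zeta>) \<bullet> q' s
        = \<beta> / \<alpha> * (q s \<bullet> q' s) + X s \<bullet> q' s + prim \<eta> s * (q' s \<bullet> \<zeta>)"
      by (simp add: inner_add_left inner_commute[of "q' s" \<zeta>])
    show ?thesis using eq[OF that] unfolding \<Phi>'_def R_def 1 2 3 by (simp add: algebra_simps)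
  qed
  have cR: "ccont R" and cXq: "ccont (\<lambda>s. X s \<bullet> q' s)"
    and cyy: "ccont (\<lambda>s. (m - \<alpha>) * A * (sconv \<mu> (prim y) s \<bullet> prim y s))"
    unfolding R_def[abs_def]
    by (intro ccont_add ccont_mult[OF \<eta>] ccont_mult_inner ccont_inner F cp X c cs ccont_cmult)+
  have \<Phi>_le: "\<Phi> s \<le> prim R s - \<kappa> / 2 * (norm (A *\<^sub>R sconv \<mu> (prim (prim z)) s))\<^sup>2"
    if s: "0 \<le> s" "s < T" for s
  proof -
    have "\<Phi> s = \<Phi> s - \<Phi> 0"
      using cp c c\<eta> by (simp add: \<Phi>_def ccont_nonpos)
    also have "\<dots> = prim \<Phi>' s"
    proof (rule prim_derivative[symmetric, OF d\<Phi> _ s(1)])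
      show "continuous_on UNIV \<Phi>'"
        unfolding \<Phi>'_def[abs_def] by (intro continuous_intros ccont_continuous cp c c\<eta> \<eta>)
    qed
    also have "\<dots> = prim (\<lambda>s. R s - (m - \<alpha>) * A * (sconv \<mu> (prim y) s \<bullet> prim y s) - X s \<bullet> q' s) s"
      by (intro prim_cong \<Phi>'_eq) (use s in auto)
    also have "\<dots> = prim R s - (m - \<alpha>) * A * prim (\<lambda>s. sconv \<mu> (prim y) s \<bullet> prim y s) s
        - prim (\<lambda>s. X s \<bullet> q' s) s"
      using prim_scaleR[of "(m - \<alpha>) * A" "\<lambda>s. sconv \<mu> (prim y) s \<bullet> prim y s" s]
      by (simp add: prim_diff ccont_causal ccont_diff cR cXq cyy)
    also have "\<dots> \<le> prim R s - 0 - \<kappa> / 2 * (norm (A *\<^sub>R sconv \<mu> (prim (prim z)) s))\<^sup>2"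
      using conv_pos_inner[OF \<mu> s(2) c(1)] const dissip[OF s] by (intro diff_mono) auto
    finally show ?thesis by simp
  qed
  \<comment> \<open>The terms of definite sign in \<Phi>, together with the dissipation.\<close>
  define E where "E s = 1 / 2 * (norm (p s))\<^sup>2 + (m - \<alpha>) * \<alpha> / 2 * (norm (prim (prim y) s))\<^sup>2
      + \<beta> / (2 * \<alpha>) * (norm (q s))\<^sup>2 + \<kappa> / 2 * (norm (A *\<^sub>R sconv \<mu> (prim (prim z)) s))\<^sup>2" for s
  have "continuous_on {0..t} E"
    unfolding E_def[abs_def] by (intro continuous_intros ccont_continuous cp c cs)
  \<comment> \<open>At a maximum point of \<open>E\<close> the norms of \<open>p\<close> and
    \<open>q\<close> on the whole past are bounded by multiples of \<open>e = sqrt (E r)\<close>.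
    The right-hand side is then linear in \<open>e\<close> while the left is \<open>e * e\<close>;
    an L^1 bound on \<open>F\<close> is enough for this.\<close>
  then obtain r where r: "r \<in> {0..t}" "\<And>s. s \<in> {0..t} \<Longrightarrow> E s \<le> E r"
    using continuous_attains_sup[of "{0..t}" E] t by auto
  then have rT: "0 \<le> r" "r < T" using t by auto
  define e where "e = sqrt (E r)"
  have nonneg: "0 \<le> (m - \<alpha>) * \<alpha> / 2 * (norm (prim (prim y) s))\<^sup>2" "0 \<le> 1 / 2 * (norm (p s))\<^sup>2"
    "0 \<le> \<beta> / (2 * \<alpha>) * (norm (q s))\<^sup>2" "0 \<le> \<kappa> / 2 * (norm (A *\<^sub>R sconv \<mu> (prim (prim z)) s))\<^sup>2" for s
    using const by auto
  have E_nonneg: "0 \<le> E s" for s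
    unfolding E_def using nonneg[of s] by linarith
  have p_le: "norm (p s) \<le> sqrt 2 * e" if "0 \<le> s" "s \<le> r" for s
  proof -
    have "1 / 2 * (norm (p s))\<^sup>2 \<le> E s" unfolding E_def using nonneg[of s] by linarith
    also have "E s \<le> E r" using r that by auto
    finally have "norm (p s) \<le> sqrt (2 * E r)" by (intro real_le_rsqrt) simp
    then show ?thesis by (simp only: e_def real_sqrt_mult)
  qed
  have q_le: "norm (q s) \<le> sqrt (2 * \<alpha> / \<beta>) * e" if "0 \<le> s" "s \<le> r" for s
  proof -
    have "\<beta> / (2 * \<alpha>) * (norm (q s))\<^sup>2 \<le> E s" unfolding E_def using nonneg[of s] by linarith
    also have "E s \<le> E r" using r that by auto
    finally have "norm (q s) \<le> sqrt (2 * \<alpha> / \<beta> * E r)"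
      using const by (intro real_le_rsqrt) (simp add: field_simps)
    then show ?thesis by (simp only: e_def real_sqrt_mult)
  qed
  have e0: "0 \<le> e" using E_nonneg by (simp add: e_def)
  have q\<zeta>: "\<bar>q s \<bullet> \<zeta>\<bar> \<le> norm \<zeta> * (sqrt (2 * \<alpha> / \<beta>) * e)" if "0 \<le> s" "s \<le> r" for s
    using order_trans[OF Cauchy_Schwarz_ineq2 mult_right_mono[OF q_le[OF that] norm_ge_zero]]
    by (simp add: mult.commute)
  have "prim R r \<le> prim (\<lambda>s. (sqrt 2 * e) *\<^sub>R norm (F s) + (norm \<zeta> * (sqrt (2 * \<alpha> / \<beta>) * e)) *\<^sub>R \<eta> s) r"
  proof (rule prim_mono)
    show "causal R" by (rule ccont_causal[OF cR])
    show "causal (\<lambda>s. (sqrt 2 * e) *\<^sub>R norm (F s) + (norm \<zeta> * (sqrt (2 * \<alpha> / \<beta>) * e)) *\<^sub>R \<eta> s)"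
      by (intro ccont_causal ccont_add ccont_scaleR ccont_norm F \<eta>)
    fix s assume s: "0 \<le> s" "s \<le> r"
    have "F s \<bullet> p s \<le> norm (F s) * norm (p s)" by (rule norm_cauchy_schwarz)
    also have "\<dots> \<le> norm (F s) * (sqrt 2 * e)" by (intro mult_left_mono p_le s) auto
    moreover have "\<eta> s * (q s \<bullet> \<zeta>) \<le> \<eta> s * (norm \<zeta> * (sqrt (2 * \<alpha> / \<beta>) * e))"
      using q\<zeta>[OF s] \<eta>_nonneg[of s] s rT by (intro mult_left_mono) auto
    ultimately show "R s \<le> (sqrt 2 * e) *\<^sub>R norm (F s) + (norm \<zeta> * (sqrt (2 * \<alpha> / \<beta>) * e)) *\<^sub>R \<eta> s"
      by (simp add: R_def mult.commute)
  qed
  also have "\<dots> = sqrt 2 * e * prim (\<lambda>s. norm (F s)) r + norm \<zeta> * (sqrt (2 * \<alpha> / \<beta>) * e) * prim \<eta> r"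
    unfolding real_scaleR_def
    by (subst prim_add) (auto intro!: ccont_causal ccont_cmult ccont_norm F \<eta> simp: prim_cmult)
  also have "\<dots> \<le> sqrt 2 * e * Fb + norm \<zeta> * (sqrt (2 * \<alpha> / \<beta>) * e) * 1"
    using e0 const by (intro add_mono mult_left_mono Fb \<eta>_le rT) auto
  finally have R_le: "prim R r \<le> sqrt 2 * e * Fb + norm \<zeta> * (sqrt (2 * \<alpha> / \<beta>) * e)" by simp
  have "0 \<le> prim \<eta> r"
    using prim_mono[of "\<lambda>_. 0" \<eta> r] \<eta> \<eta>_nonneg rT
    by (simp add: causal_0 ccont_causal) (simp add: prim_def set_lebesgue_integral_def)
  \<comment> \<open>Second occurrence of this bound, after the one inside \<open>prim R r\<close>;
    hence the factor 2 in the final constant.\<close>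
  then have "\<bar>prim \<eta> r * (q r \<bullet> \<zeta>)\<bar> \<le> 1 * (norm \<zeta> * (sqrt (2 * \<alpha> / \<beta>) * e))"
    unfolding abs_mult using rT \<eta>_le q\<zeta>[of r] by (intro mult_mono) auto
  moreover have "E r = \<Phi> r - prim \<eta> r * (q r \<bullet> \<zeta>) + \<kappa> / 2 * (norm (A *\<^sub>R sconv \<mu> (prim (prim z)) r))\<^sup>2"
    by (simp add: E_def \<Phi>_def power2_norm_eq_inner)
  ultimately have "E r \<le> (sqrt 2 * Fb + 2 * norm \<zeta> * sqrt (2 * \<alpha> / \<beta>)) * e"
    using \<Phi>_le[OF rT] R_le by (simp add: algebra_simps)
  moreover have "E r = e * e" using E_nonneg by (simp add: e_def)
  ultimately have "e * e \<le> (sqrt 2 * Fb + 2 * norm \<zeta> * sqrt (2 * \<alpha> / \<beta>)) * e" by simp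
  moreover have "0 \<le> sqrt 2 * Fb + 2 * norm \<zeta> * sqrt (2 * \<alpha> / \<beta>)" using const by auto
  ultimately have "e \<le> sqrt 2 * Fb + 2 * norm \<zeta> * sqrt (2 * \<alpha> / \<beta>)"
    using e0 by (cases "e = 0") auto
  from power_mono[OF this e0, of 2] have "E r \<le> (sqrt 2 * Fb + 2 * norm \<zeta> * sqrt (2 * \<alpha> / \<beta>))\<^sup>2"
    using \<open>E r = e * e\<close> by (simp add: power2_eq_square)
  moreover have "E t \<le> E r" using r t by auto
  ultimately show ?thesis using nonneg(2)[of t] unfolding E_def[of t] by linarith
qed

text \<open>Here \<open>prim r\<^sub>1\<close> and \<open>prim r\<^sub>2\<close> play the roles of
  the averaged difference V and its gradient, \<open>g\<close> that of psi_tt and \<open>u\<close>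
  that of the gradient of psi. Only \<open>prim g\<close> is bounded, so the product of
  \<open>sconv \<mu> g\<close> with V is integrated by parts in time, which accounts for the cross
  term in \<Phi>. The convolution with \<nu> has a sign and is dropped.\<close>

lemma difference_bound:
  fixes g r\<^sub>1 :: "real \<Rightarrow> 'h::{real_inner,banach,second_countable_topology}"
    and u r\<^sub>2 :: "real \<Rightarrow> 'g::{real_inner,banach,second_countable_topology}"
  assumes \<mu>: "real_kernel \<mu>" and \<nu>: "real_kernel \<nu>" "conv_deriv_pos \<nu> T"
    and g: "ccont g" and u: "ccont u" and r\<^sub>1: "ccont r\<^sub>1" and r\<^sub>2: "ccont r\<^sub>2" and \<theta>: "ccont \<theta>"
    and const: "0 \<le> A" "0 < m" "0 \<le> \<beta>" "0 \<le> \<gamma>" "0 \<le> D" "0 \<le> C"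
    and \<theta>_le: "\<And>t. t < T \<Longrightarrow> \<bar>\<theta> t\<bar> \<le> 1"
    and bounds: "\<And>t. t < T \<Longrightarrow> norm (prim g t) \<le> C" "\<And>t. t < T \<Longrightarrow> norm (u t) \<le> C"
      "\<And>t. t < T \<Longrightarrow> norm (r\<^sub>1 t) \<le> C" "\<And>t. t < T \<Longrightarrow> norm (prim r\<^sub>2 t) \<le> C"
    and eq: "\<And>t. t < T \<Longrightarrow> (m *\<^sub>R r\<^sub>1 t + A *\<^sub>R sconv \<mu> g t + (A * \<theta> t) *\<^sub>R \<psi>) \<bullet> prim r\<^sub>1 t
        + (\<beta> *\<^sub>R prim (prim r\<^sub>2) t + (A * \<gamma>) *\<^sub>R sconv \<mu> u t + D *\<^sub>R sconv \<nu> r\<^sub>2 t) \<bullet> prim r\<^sub>2 t = 0"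
    and t: "0 \<le> t" "t < T"
  shows "m / 2 * (norm (prim r\<^sub>1 t))\<^sup>2 \<le> A * (T * (norm \<psi> * (T * C) + (\<gamma> + 2) * (total_mass \<mu> * C * C)))"
proof -
  define M where "M = total_mass \<mu> * C"
  have M0: "0 \<le> M" using const by (simp add: M_def total_mass_nonneg)
  have c: "ccont (prim r\<^sub>1)" "ccont (prim r\<^sub>2)" "ccont (prim (prim r\<^sub>2))" "ccont (prim g)"
    using r\<^sub>1 r\<^sub>2 g by (auto intro!: ccont_prim ccont_causal)
  have cs: "ccont (sconv \<mu> g)" "ccont (sconv \<mu> (prim g))" "ccont (sconv \<mu> u)" "ccont (sconv \<nu> r\<^sub>2)"
    using \<mu> \<nu> c g u r\<^sub>2 by (auto intro!: ccont_sconv)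
  define \<Phi> where "\<Phi> s = m / 2 * (prim r\<^sub>1 s \<bullet> prim r\<^sub>1 s) + \<beta> / 2 * (prim (prim r\<^sub>2) s \<bullet> prim (prim r\<^sub>2) s)
      + A * (sconv \<mu> (prim g) s \<bullet> prim r\<^sub>1 s)" for s
  define \<Phi>' where "\<Phi>' s = m * (r\<^sub>1 s \<bullet> prim r\<^sub>1 s) + \<beta> * (prim (prim r\<^sub>2) s \<bullet> prim r\<^sub>2 s)
      + A * (sconv \<mu> (prim g) s \<bullet> r\<^sub>1 s + sconv \<mu> g s \<bullet> prim r\<^sub>1 s)" for s
  have d\<Phi>: "(\<Phi> has_real_derivative \<Phi>' s) (at s)" for s
  proof -
    note d1 = prim_has_vector_derivative[OF r\<^sub>1, of s]
    note d2 = prim_has_vector_derivative[OF c(2), of s]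
    note d3 = sconv_prim_has_vector_derivative[OF \<mu> g, of s]
    show ?thesis unfolding \<Phi>_def[abs_def] \<Phi>'_def
      by (rule derivative_eq_intros has_real_derivative_inner[OF d1 d1]
        has_real_derivative_inner[OF d2 d2] has_real_derivative_inner[OF d3 d1] refl)+
        (simp add: algebra_simps inner_commute)
  qed
  define R where "R s = A * (sconv \<mu> (prim g) s \<bullet> r\<^sub>1 s) - A * \<theta> s * (\<psi> \<bullet> prim r\<^sub>1 s)
      - A * \<gamma> * (sconv \<mu> u s \<bullet> prim r\<^sub>2 s)" for s
  have \<Phi>'_eq: "\<Phi>' s = R s - D * (sconv \<nu> r\<^sub>2 s \<bullet> prim r\<^sub>2 s)" if "s < T" for s
    using eq[OF that] unfolding \<Phi>'_def R_def by (simp add: inner_add_left algebra_simps inner_commute)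
  have "ccont (\<lambda>s. prim r\<^sub>1 s \<bullet> \<psi>)" by (intro ccont_inner c)
  then have c\<psi>: "ccont (\<lambda>s. \<psi> \<bullet> prim r\<^sub>1 s)" by (simp add: inner_commute)
  have cR: "ccont R"
    unfolding R_def[abs_def] mult.assoc
    by (intro ccont_diff ccont_cmult ccont_mult[OF \<theta> c\<psi>] ccont_mult_inner c cs r\<^sub>1)
  have cD: "ccont (\<lambda>s. D * (sconv \<nu> r\<^sub>2 s \<bullet> prim r\<^sub>2 s))"
    by (intro ccont_mult_inner c cs ccont_cmult)
  have inner_bound: "\<bar>a \<bullet> b\<bar> \<le> K * L" if "norm a \<le> K" "norm b \<le> L" for a b :: "'v::real_inner" and K L
    using order_trans[OF Cauchy_Schwarz_ineq2 mult_mono[OF that]] order_trans[OF norm_ge_zero that(1)] by simp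
  have V: "norm (prim r\<^sub>1 s) \<le> T * C" if "0 \<le> s" "s < T" for s
  proof -
    have "norm (prim r\<^sub>1 s) \<le> s * C"
      using that by (intro norm_prim_bound ccont_causal r\<^sub>1 bounds) auto
    also have "\<dots> \<le> T * C" using that const by (intro mult_right_mono) auto
    finally show ?thesis .
  qed
  have N: "norm (sconv \<mu> (prim g) s) \<le> M" "norm (sconv \<mu> u s) \<le> M" if "s < T" for s
    unfolding M_def using that by (auto intro!: norm_sconv_le \<mu> c u bounds)
  have R_le: "R s \<le> A * (M * C + norm \<psi> * (T * C) + \<gamma> * (M * C))" if s: "0 \<le> s" "s < T" for s
  proof -
    have "A * (sconv \<mu> (prim g) s \<bullet> r\<^sub>1 s) \<le> A * (M * C)"
      using inner_bound[OF N(1) bounds(3), of s s] s const by (intro mult_left_mono) auto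
    moreover have "\<bar>A * \<theta> s * (\<psi> \<bullet> prim r\<^sub>1 s)\<bar> \<le> A * 1 * (norm \<psi> * (T * C))"
      unfolding abs_mult using s const \<theta>_le by (intro mult_mono inner_bound V) auto
    moreover have "\<bar>A * \<gamma> * (sconv \<mu> u s \<bullet> prim r\<^sub>2 s)\<bar> \<le> A * \<gamma> * (M * C)"
      unfolding abs_mult using s const by (intro mult_mono inner_bound N bounds) auto
    ultimately show ?thesis unfolding R_def by (simp add: algebra_simps)
  qed
  have "\<Phi> t = \<Phi> t - \<Phi> 0" using c cs by (simp add: \<Phi>_def ccont_nonpos)
  also have "\<dots> = prim \<Phi>' t"
  proof (rule prim_derivative[symmetric, OF d\<Phi> _ t(1)])
    show "continuous_on UNIV \<Phi>'"
      unfolding \<Phi>'_def[abs_def] by (intro continuous_intros ccont_continuous c cs r\<^sub>1 r\<^sub>2)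
  qed
  also have "\<dots> = prim (\<lambda>s. R s - D * (sconv \<nu> r\<^sub>2 s \<bullet> prim r\<^sub>2 s)) t"
    by (intro prim_cong \<Phi>'_eq) (use t in auto)
  also have "\<dots> = prim R t - D * prim (\<lambda>s. sconv \<nu> r\<^sub>2 s \<bullet> prim r\<^sub>2 s) t"
    using prim_scaleR[of D "\<lambda>s. sconv \<nu> r\<^sub>2 s \<bullet> prim r\<^sub>2 s" t]
    by (simp add: prim_diff ccont_causal cR cD)
  also have "\<dots> \<le> prim R t"
    using conv_deriv_pos_inner[OF \<nu> t(2) r\<^sub>2] const by simp
  also have "\<dots> \<le> t * (A * (M * C + norm \<psi> * (T * C) + \<gamma> * (M * C)))"
    using t by (intro prim_le_bound ccont_causal cR R_le) auto
  also have "\<dots> \<le> T * (A * (M * C + norm \<psi> * (T * C) + \<gamma> * (M * C)))"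
    using t const M0 by (intro mult_right_mono) auto
  finally have "\<Phi> t \<le> T * (A * (M * C + norm \<psi> * (T * C) + \<gamma> * (M * C)))" .
  \<comment> \<open>This boundary term of the integration by parts and the first term of
    \<open>R\<close> are of the same size and together produce the 2 in
    \<open>\<gamma> + 2\<close>.\<close>
  moreover have "\<bar>A * (sconv \<mu> (prim g) t \<bullet> prim r\<^sub>1 t)\<bar> \<le> A * (M * (T * C))"
    unfolding abs_mult using t const M0 by (intro mult_mono inner_bound V N) auto
  moreover have "0 \<le> \<beta> / 2 * (prim (prim r\<^sub>2) t \<bullet> prim (prim r\<^sub>2) t)" using const by simp
  ultimately show ?thesis
    unfolding \<Phi>_def M_def by (simp add: power2_norm_eq_inner algebra_simps)
qed

section \<open>Convolutions on a finite time interval\<close>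

text \<open>The point 0 is kept and T is dropped, so that integrals over \<open>{0..t}\<close> are
  reproduced exactly for every \<open>t < T\<close> and the result is causal.\<close>

definition trunc :: "real \<Rightarrow> (real \<Rightarrow> 'b::zero) \<Rightarrow> real \<Rightarrow> 'b"
  where "trunc T u t = (if 0 \<le> t \<and> t < T then u t else 0)"

lemma AE_time_measure: "(AE t in time_measure T. P t) \<longleftrightarrow> (AE t in lborel. 0 < t \<and> t < T \<longrightarrow> P t)"
  by (subst AE_restrict_space_iff) auto

lemma AE_trunc_lborel:
  assumes "AE t in time_measure T. P (u t)" "P 0"
  shows "AE t in lborel. P (trunc T u t)"
  using assms(1) AE_lborel_singleton[of 0] unfolding AE_time_measure
  by eventually_elim (use assms(2) in \<open>auto simp: trunc_def\<close>)

lemma trunc_eq: "trunc T u = (\<lambda>t. indicator {0<..<T} t *\<^sub>R u t + indicator {0} t *\<^sub>R trunc T u 0)"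
  for u :: "real \<Rightarrow> 'b::real_vector"
  by (auto simp: trunc_def indicator_def fun_eq_iff)

lemma integrable_trunc:
  fixes u :: "real \<Rightarrow> 'b::{banach,second_countable_topology}"
  assumes "integrable (time_measure T) u" shows "integrable lborel (trunc T u)"
proof -
  have "integrable lborel (\<lambda>t. indicator {0<..<T} t *\<^sub>R u t)"
    using assms by (subst (asm) integrable_restrict_space) auto
  then show ?thesis
    by (subst trunc_eq) (intro Bochner_Integration.integrable_add integrable_scaleR_left, auto)
qed

lemma causal_trunc:
  "integrable (time_measure T) u \<Longrightarrow> causal (trunc T u)"
  by (rule causalI_integrable[OF integrable_trunc]) (auto simp: trunc_def)

lemma prim_trunc: "t < T \<Longrightarrow> (LINT s:{0..t}|lborel. u s) = prim (trunc T u) t"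
  unfolding prim_def by (rule set_lebesgue_integral_cong) (auto simp: trunc_def)

lemma time_measure_const: "integrable (time_measure T) (\<lambda>_. x)"
  for x :: "'b::{banach,second_countable_topology}"
  using emeasure_bounded_finite[of "{0<..<T} :: real set"]
  by (subst integrable_restrict_space) auto

lemma finite_real_measure_kernel: "finite_real_measure T \<mu> \<Longrightarrow> real_kernel \<mu>"
proof -
  have "nn_kernel M" if "sets M = sets borel" "finite_measure M" "emeasure M (- {0..T}) = 0" for M
  proof -
    have "emeasure M {..<0} \<le> emeasure M (- {0..T})"
      by (rule emeasure_mono) (use that in auto)
    then show ?thesis using that by (simp add: nn_kernel_def)
  qed
  moreover assume "finite_real_measure T \<mu>"
  ultimately show ?thesis by (auto simp: finite_real_measure_def real_kernel_def)
qed

lemma conv_measure_eq_sconv: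
  assumes \<mu>: "real_kernel \<mu>" and g': "g' \<in> borel_measurable borel" "\<And>x. x < 0 \<Longrightarrow> g' x = 0"
    and eq: "\<And>x. 0 \<le> x \<Longrightarrow> x \<le> t \<Longrightarrow> g x = g' x"
  shows "conv_measure \<mu> g t = sconv \<mu> g' t"
proof -
  have "(LINT s:{0..t}|M. g (t - s)) = mconv M g' t" if M: "nn_kernel M" for M
  proof -
    have "(LINT s:{0..t}|M. g (t - s)) = (LINT s|M. indicator {0..} s *\<^sub>R g' (t - s))"
      unfolding set_lebesgue_integral_def
      by (rule Bochner_Integration.integral_cong) (auto simp: indicator_def eq g')
    also have "\<dots> = mconv M g' t"
      unfolding mconv_def
    proof (rule integral_cong_AE)
      have [measurable]: "g' \<in> borel_measurable borel" by fact
      show "(\<lambda>s. indicator {0..} s *\<^sub>R g' (t - s)) \<in> borel_measurable M" "(\<lambda>s. g' (t - s)) \<in> borel_measurable M"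
        by (intro nn_kernel_measurable[OF M]; measurable)+
      show "AE s in M. indicator {0..} s *\<^sub>R g' (t - s) = g' (t - s)"
        using nn_kernel_AE[OF M] by eventually_elim auto
    qed
    finally show ?thesis .
  qed
  then show ?thesis using \<mu> by (simp add: conv_measure_def sconv_def real_kernel_def)
qed

section \<open>Integrable functions as signed kernels, and factorization of kernels\<close>

definition fkernel :: "real \<Rightarrow> (real \<Rightarrow> real) \<Rightarrow> real_measure"
  where "fkernel T k = (density lborel (\<lambda>s. ennreal (max 0 (trunc T k s))),
    density lborel (\<lambda>s. ennreal (max 0 (- trunc T k s))))"

lemma nn_kernel_density:
  assumes "integrable lborel k" "\<And>s. s < 0 \<Longrightarrow> k s = 0"
  shows "nn_kernel (density lborel (\<lambda>s. ennreal (max 0 (k s))))"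
proof -
  have [measurable]: "k \<in> borel_measurable borel" using assms by auto
  have "integrable lborel (\<lambda>s. max 0 (k s))" using assms by (intro integrable_max) auto
  then have "(\<integral>\<^sup>+ s. ennreal (max 0 (k s)) \<partial>lborel) < \<infinity>"
    by (subst nn_integral_eq_integral) auto
  then have "finite_measure (density lborel (\<lambda>s. ennreal (max 0 (k s))))"
    by (intro finite_measureI) (auto simp: emeasure_density)
  moreover have "emeasure (density lborel (\<lambda>s. ennreal (max 0 (k s)))) {..<0} = 0"
  proof -
    have "emeasure (density lborel (\<lambda>s. ennreal (max 0 (k s)))) {..<0}
      = (\<integral>\<^sup>+ s. ennreal (max 0 (k s)) * indicator {..<0} s \<partial>lborel)"
      by (rule emeasure_density) auto
    also have "\<dots> = (\<integral>\<^sup>+ s. 0 \<partial>(lborel :: real measure))"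
      by (rule nn_integral_cong) (auto simp: assms(2) split: split_indicator)
    finally show ?thesis by simp
  qed
  ultimately show ?thesis by (simp add: nn_kernel_def)
qed

lemma real_kernel_fkernel:
  assumes "integrable (time_measure T) k" shows "real_kernel (fkernel T k)"
  unfolding real_kernel_def fkernel_def fst_conv snd_conv
proof (intro conjI)
  show "nn_kernel (density lborel (\<lambda>s. ennreal (max 0 (trunc T k s))))"
    by (intro nn_kernel_density integrable_trunc assms) (simp add: trunc_def)
  show "nn_kernel (density lborel (\<lambda>s. ennreal (max 0 (- trunc T k s))))"
    by (intro nn_kernel_density Bochner_Integration.integrable_minus integrable_trunc assms) (simp add: trunc_def)
qed

text \<open>The almost everywhere bound on \<open>u\<close> makes the integrals against the positive
  and the negative part of the density converge separately, so that they may be recombined.\<close>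

lemma sconv_fkernel:
  fixes u :: "real \<Rightarrow> 'b::{banach,second_countable_topology}"
  assumes k: "integrable (time_measure T) k"
    and u: "u \<in> borel_measurable borel" "\<And>x. x < 0 \<Longrightarrow> u x = 0" "AE s in lborel. s \<le> t \<longrightarrow> norm (u s) \<le> B"
  shows "sconv (fkernel T k) u t = (LINT s|lborel. trunc T k s *\<^sub>R u (t - s))"
proof -
  note int = integrable_trunc[OF k]
  have [measurable]: "trunc T k \<in> borel_measurable borel" "u \<in> borel_measurable borel" using int u by auto
  have AE: "AE s in lborel. t + (- 1) * s \<le> t \<longrightarrow> norm (u (t + (- 1) * s)) \<le> B"
    by (rule AE_borel_affine[where P = "\<lambda>s. s \<le> t \<longrightarrow> norm (u s) \<le> B"]) (use u in auto)
  have int': "integrable lborel (\<lambda>s. max 0 (k' s) *\<^sub>R u (t - s))"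
    if k': "integrable lborel k'" "\<And>s. s < 0 \<Longrightarrow> k' s = 0" for k'
  proof (rule Bochner_Integration.integrable_bound)
    have [measurable]: "k' \<in> borel_measurable borel" using k' by auto
    show "integrable lborel (\<lambda>s. B * k' s)" using k' by simp
    show "(\<lambda>s. max 0 (k' s) *\<^sub>R u (t - s)) \<in> borel_measurable lborel" by measurable
    show "AE s in lborel. norm (max 0 (k' s) *\<^sub>R u (t - s)) \<le> norm (B * k' s)"
      using AE
    proof eventually_elim
      case (elim s)
      show ?case
      proof (cases "s < 0")
        case False
        then have le: "norm (u (t - s)) \<le> B" using elim by simp
        have "norm (max 0 (k' s) *\<^sub>R u (t - s)) = max 0 (k' s) * norm (u (t - s))" by simp
        also have "\<dots> \<le> \<bar>k' s\<bar> * B" using le by (intro mult_mono) auto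
        also have "\<dots> \<le> norm (B * k' s)" by (simp add: abs_mult mult.commute mult_right_mono)
        finally show ?thesis .
      qed (simp add: k'(2))
    qed
  qed
  have dens: "(LINT s|density lborel (\<lambda>s. ennreal (max 0 (k' s))). u (t - s)) = (LINT s|lborel. max 0 (k' s) *\<^sub>R u (t - s))"
    if [measurable]: "k' \<in> borel_measurable borel" for k'
    by (subst integral_density) auto
  have "sconv (fkernel T k) u t = (LINT s|lborel. max 0 (trunc T k s) *\<^sub>R u (t - s))
      - (LINT s|lborel. max 0 (- trunc T k s) *\<^sub>R u (t - s))"
    unfolding sconv_def mconv_def fkernel_def fst_conv snd_conv
    by (subst dens, measurable, subst dens, measurable)
  also have "\<dots> = (LINT s|lborel. max 0 (trunc T k s) *\<^sub>R u (t - s) - max 0 (- trunc T k s) *\<^sub>R u (t - s))"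
    using int'[OF int] int'[OF Bochner_Integration.integrable_minus[OF int]]
    by (intro Bochner_Integration.integral_diff[symmetric]) (simp_all add: trunc_def)
  also have "\<dots> = (LINT s|lborel. trunc T k s *\<^sub>R u (t - s))"
    by (intro Bochner_Integration.integral_cong) (auto simp: max_def)
  finally show ?thesis .
qed

lemma conv_fun_eq_sconv:
  fixes u :: "real \<Rightarrow> 'b::{banach,second_countable_topology}"
  assumes k: "integrable (time_measure T) k" and "t < T"
    and u: "u \<in> borel_measurable borel" "\<And>x. x < 0 \<Longrightarrow> u x = 0" "AE s in lborel. s \<le> t \<longrightarrow> norm (u s) \<le> B"
    and eq: "\<And>x. 0 \<le> x \<Longrightarrow> x \<le> t \<Longrightarrow> g x = u x"
  shows "conv_fun k g t = sconv (fkernel T k) u t"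
proof -
  have "conv_fun k g t = (LINT s|lborel. trunc T k s *\<^sub>R u (t - s))"
    unfolding conv_fun_def set_lebesgue_integral_def
    by (rule Bochner_Integration.integral_cong)
      (use assms(2) in \<open>auto simp: indicator_def trunc_def eq u(2)\<close>)
  then show ?thesis using sconv_fkernel[OF k u] by simp
qed

lemma ccont_AE_bounded: "ccont y \<Longrightarrow> \<exists>B. AE s in lborel. s \<le> t \<longrightarrow> norm (y s) \<le> B"
  by (erule ccont_bounded[of y t]) auto

lemma conv_fun_eq_sconv_ccont:
  assumes "integrable (time_measure T) k" "t < T" "ccont y"
  shows "conv_fun k y t = sconv (fkernel T k) y t"
proof -
  obtain B where "AE s in lborel. s \<le> t \<longrightarrow> norm (y s) \<le> B" using ccont_AE_bounded[OF assms(3)] by blast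
  then show ?thesis
    using assms by (intro conv_fun_eq_sconv ccont_measurable) (auto intro: ccont_nonpos)
qed

lemma sconv_fkernel_fconv:
  assumes "integrable (time_measure T) k" "ccont (y :: real \<Rightarrow> real)"
  shows "sconv (fkernel T k) y t = fconv y (trunc T k) t"
proof -
  obtain B where "AE s in lborel. s \<le> t \<longrightarrow> norm (y s) \<le> B" using ccont_AE_bounded[OF assms(2)] by blast
  then show ?thesis
    unfolding fconv_def using assms
    by (subst sconv_fkernel[where B = B]) (auto intro: ccont_nonpos ccont_measurable simp: mult.commute)
qed

lemma mconv_commute:
  assumes M: "nn_kernel M" and N: "nn_kernel N" and y: "ccont y"
  shows "mconv M (mconv N y) t = mconv N (mconv M y) t"
proof -
  have [measurable]: "y \<in> borel_measurable borel" by (rule ccont_measurable[OF y])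
  have [measurable_cong]: "sets M = sets borel" "sets N = sets borel" using M N by (auto simp: nn_kernel_def)
  interpret M: finite_measure M using M by (simp add: nn_kernel_def)
  interpret N: finite_measure N using N by (simp add: nn_kernel_def)
  interpret pair_sigma_finite M N by unfold_locales
  obtain B where B: "\<And>x. x \<le> t \<Longrightarrow> norm (y x) \<le> B" "0 \<le> B" using ccont_bounded[OF y] by metis
  have int: "integrable (M \<Otimes>\<^sub>M N) (\<lambda>(r, s). y (t - r - s))"
  proof (rule Fubini_integrable)
    show "integrable M (\<lambda>r. LINT s|N. norm (case (r, s) of (r, s) \<Rightarrow> y (t - r - s)))"
    proof (rule M.integrable_const_bound[where B = "measure N UNIV * B"])
      show "AE r in M. norm (LINT s|N. norm (case (r, s) of (r, s) \<Rightarrow> y (t - r - s))) \<le> measure N UNIV * B"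
        using nn_kernel_AE[OF M]
      proof eventually_elim
        case (elim r)
        then show ?case
          using norm_mconv_le[OF N ccont_norm[OF y], of "t - r" B] B(1) by (simp add: mconv_def)
      qed
    qed measurable
  qed (auto simp: integrable_mconv N y)
  from Fubini_integral[OF int] show ?thesis
    by (simp add: mconv_def algebra_simps)
qed

lemma sconv_commute:
  assumes "real_kernel \<mu>" "real_kernel \<nu>" "ccont y"
  shows "sconv \<mu> (sconv \<nu> y) t = sconv \<nu> (sconv \<mu> y) t"
proof -
  have d: "mconv M (\<lambda>s. mconv N y s - mconv N' y s) t = mconv M (mconv N y) t - mconv M (mconv N' y) t"
    if "nn_kernel M" "nn_kernel N" "nn_kernel N'" for M N N'
    unfolding mconv_def[of M] using that assms(3)
    by (intro Bochner_Integration.integral_diff integrable_mconv ccont_mconv)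
  show ?thesis
    using assms unfolding sconv_def[abs_def] real_kernel_def
    by (simp add: d mconv_commute[of "fst \<mu>"] mconv_commute[of "snd \<mu>"])
qed

text \<open>Associativity of convolution. For scalar \<open>y\<close> it is
  \<open>fconv_sconv\<close>, with \<open>y\<close> as the bounded factor and the integrable
  function as the one convolved with \<mu>. The Hilbert space case follows by pairing with each
  fixed vector.\<close>

lemma sconv_factor:
  fixes y :: "real \<Rightarrow> 'h::{real_inner,banach,second_countable_topology}"
  assumes \<mu>: "real_kernel \<mu>" and k: "integrable (time_measure T) k" and r: "integrable (time_measure T) r"
    and eq: "AE t in time_measure T. k t = conv_measure \<mu> r t"
    and y: "ccont y" and "t < T"
  shows "sconv (fkernel T k) y t = sconv \<mu> (sconv (fkernel T r) y) t"
proof -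
  note cr = causal_trunc[OF r] and ck = causal_trunc[OF k]
  have AE: "AE s in lborel. s < T \<longrightarrow> trunc T k s = sconv \<mu> (trunc T r) s"
    using eq AE_lborel_singleton[of 0] unfolding AE_time_measure
  proof eventually_elim
    case (elim s)
    have "conv_measure \<mu> r s = sconv \<mu> (trunc T r) s" if "s < T"
      by (intro conv_measure_eq_sconv \<mu> causal_measurable cr) (use that in \<open>auto simp: trunc_def\<close>)
    with elim show ?case
      using causal_neg[OF causal_sconv[OF \<mu> cr], of s] by (cases "s < 0") (auto simp: trunc_def)
  qed
  have scalar: "sconv (fkernel T k) b t = sconv \<mu> (sconv (fkernel T r) b) t" if b: "ccont b" for b :: "real \<Rightarrow> real"
  proof -
    have [measurable]: "b \<in> borel_measurable borel" "trunc T k \<in> borel_measurable borel"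
      "sconv \<mu> (trunc T r) \<in> borel_measurable borel"
      using ccont_measurable[OF b] causal_measurable[OF ck] causal_measurable[OF causal_sconv[OF \<mu> cr]] by auto
    have "sconv (fkernel T k) b t = fconv b (trunc T k) t" by (rule sconv_fkernel_fconv[OF k b])
    also have "\<dots> = fconv b (sconv \<mu> (trunc T r)) t"
      unfolding fconv_def
    proof (rule integral_cong_AE)
      show "AE s in lborel. b (t - s) *\<^sub>R trunc T k s = b (t - s) *\<^sub>R sconv \<mu> (trunc T r) s"
        using AE by eventually_elim (use \<open>t < T\<close> ccont_nonpos[OF b] in \<open>force simp: not_less\<close>)
    qed measurable
    also have "\<dots> = sconv \<mu> (fconv b (trunc T r)) t" by (rule fconv_sconv[OF \<mu> cr b])
    also have "fconv b (trunc T r) = sconv (fkernel T r) b" by (auto simp: sconv_fkernel_fconv[OF r b])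
    finally show ?thesis .
  qed
  have "sconv (fkernel T k) y t \<bullet> x = sconv \<mu> (sconv (fkernel T r) y) t \<bullet> x" for x
  proof -
    have "sconv (fkernel T k) y t \<bullet> x = sconv \<mu> (sconv (fkernel T r) (\<lambda>s. y s \<bullet> x)) t"
      using scalar[OF ccont_inner[OF y, of x]]
        sconv_bounded_linear[OF bounded_linear_inner_left real_kernel_fkernel[OF k] y, of x t] by simp
    also have "sconv (fkernel T r) (\<lambda>s. y s \<bullet> x) = (\<lambda>s. sconv (fkernel T r) y s \<bullet> x)"
      by (rule ext) (rule sconv_bounded_linear[OF bounded_linear_inner_left real_kernel_fkernel[OF r] y])
    also have "sconv \<mu> \<dots> t = sconv \<mu> (sconv (fkernel T r) y) t \<bullet> x"
      by (rule sconv_bounded_linear[OF bounded_linear_inner_left \<mu> ccont_sconv[OF real_kernel_fkernel[OF r] y]])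
    finally show ?thesis .
  qed
  then show ?thesis using vector_eq_rdot by blast
qed

lemma sconv_fkernel_const:
  fixes y :: "real \<Rightarrow> 'h::{real_inner,banach,second_countable_topology}"
  assumes y: "ccont y" and "t < T"
  shows "sconv (fkernel T (\<lambda>_. c)) y t = c *\<^sub>R prim y t"
proof -
  have "sconv (fkernel T (\<lambda>_. c)) y t = conv_fun (\<lambda>_. c) y t"
    by (rule conv_fun_eq_sconv_ccont[symmetric]) (use assms time_measure_const in auto)
  also have "\<dots> = c *\<^sub>R (LINT s:{0..t}|lborel. y (t - s))"
    by (simp add: conv_fun_def)
  also have "(LINT s:{0..t}|lborel. y (t - s)) = prim y t"
    using lborel_integral_real_affine[of "-1" "\<lambda>s. indicator {0..t} s *\<^sub>R y s" t]
    by (simp add: prim_def set_lebesgue_integral_def indicator_def conj_commute)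
  finally show ?thesis .
qed

text \<open>Convolution with the constant 1 is the primitive.\<close>

lemma sconv_factor_const:
  fixes y :: "real \<Rightarrow> 'h::{real_inner,banach,second_countable_topology}"
  assumes \<mu>: "real_kernel \<mu>" and k: "integrable (time_measure T) k"
    and eq: "AE t in time_measure T. k t = conv_measure \<mu> (\<lambda>_. 1) t"
    and y: "ccont y" and "t < T"
  shows "sconv (fkernel T k) y t = sconv \<mu> (prim y) t"
  unfolding sconv_factor[OF \<mu> k time_measure_const eq y \<open>t < T\<close>]
  using assms
  by (intro sconv_cong ccont_sconv real_kernel_fkernel time_measure_const ccont_prim ccont_causal)
    (simp_all add: sconv_fkernel_const)

section \<open>From the kernel assumptions to positivity on causal functions\<close>

lemma ccont_Lp_space:
  fixes y :: "real \<Rightarrow> real"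
  assumes "ccont y" shows "y \<in> Lp_space 2 t UNIV"
proof -
  have m: "y \<in> borel_measurable borel" by (rule ccont_measurable[OF assms])
  then have m': "y \<in> borel_measurable (time_measure t)" by (intro measurable_restrict_space1) simp
  interpret finite_measure "time_measure t"
    using emeasure_bounded_finite[of "{0<..<t} :: real set"]
    by (intro finite_measureI) (simp add: emeasure_restrict_space space_restrict_space)
  obtain B where B: "\<And>x. x \<le> t \<Longrightarrow> norm (y x) \<le> B" "0 \<le> B" using ccont_bounded[OF assms] by metis
  have "integrable (time_measure t) (\<lambda>s. norm (y s) powr 2)"
    using m' B
    by (intro integrable_const_bound[where B = "B powr 2"])
      (auto simp: AE_time_measure power2_le_iff_abs_le intro!: always_eventually)
  then show ?thesis using m' by (simp add: Lp_space_def)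
qed

lemma conv_posI:
  assumes "conv_nonneg C T"
    and C: "\<And>y t. ccont y \<Longrightarrow> 0 \<le> t \<Longrightarrow> t < T \<Longrightarrow> C y t = sconv \<mu> y t"
  shows "conv_pos \<mu> T"
  unfolding conv_pos_def
proof (intro allI impI)
  fix t and y :: "real \<Rightarrow> real" assume t: "t < T" and y: "ccont y"
  show "0 \<le> prim (\<lambda>s. sconv \<mu> y s * y s) t"
  proof (cases "0 < t")
    case True
    then have "0 \<le> (LINT s:{0..t}|lborel. C y s * y s)"
      using assms(1) t ccont_Lp_space[OF y] by (auto simp: conv_nonneg_def)
    also have "\<dots> = prim (\<lambda>s. sconv \<mu> y s * y s) t"
      unfolding prim_def by (rule set_lebesgue_integral_cong) (use t C y in auto)
    finally show ?thesis .
  next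
    case False
    have "prim (\<lambda>s. sconv \<mu> y s * y s) t = prim (\<lambda>_. 0) t"
      by (rule prim_cong) (use False ccont_nonpos[OF y] in auto)
    then show ?thesis by (simp add: prim_def set_lebesgue_integral_def)
  qed
qed

lemma conv_pos_conv_measure:
  assumes "real_kernel \<mu>" "conv_nonneg (conv_measure \<mu>) T" shows "conv_pos \<mu> T"
  by (rule conv_posI[OF assms(2)])
    (intro conv_measure_eq_sconv assms ccont_measurable, auto intro: ccont_nonpos)

lemma conv_pos_conv_fun:
  assumes "integrable (time_measure T) r" "conv_nonneg (conv_fun r) T" shows "conv_pos (fkernel T r) T"
  by (rule conv_posI[OF assms(2)]) (intro conv_fun_eq_sconv_ccont assms)

text \<open>Since \<open>k\<close> is the primitive of \<mu>, k * y equals \<mu> * (prim y), and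
  positivity of \<mu> at \<open>prim y\<close> is all that is claimed.\<close>

lemma conv_deriv_pos_factor:
  assumes \<mu>: "real_kernel \<mu>" "conv_pos \<mu> T" and k: "integrable (time_measure T) k"
    and eq: "AE t in time_measure T. k t = conv_measure \<mu> (\<lambda>_. 1) t"
  shows "conv_deriv_pos (fkernel T k) T"
  unfolding conv_deriv_pos_def
proof (intro allI impI)
  fix t and y :: "real \<Rightarrow> real" assume t: "t < T" and y: "ccont y"
  have "prim (\<lambda>s. sconv (fkernel T k) y s * prim y s) t = prim (\<lambda>s. sconv \<mu> (prim y) s * prim y s) t"
    by (rule prim_cong) (use sconv_factor_const[OF \<mu>(1) k eq y] t in auto)
  then show "0 \<le> prim (\<lambda>s. sconv (fkernel T k) y s * prim y s) t"
    using \<mu>(2) t ccont_prim[OF ccont_causal[OF y]] by (simp add: conv_pos_def)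
qed

text \<open>From k = k_0 + 1 * k' one gets k * y = k' * (prim y) + k_0 (prim y). Tested with
  \<open>prim y\<close>, the first summand is nonnegative by assumption on k' and the second is a
  multiple of a square.\<close>

lemma conv_deriv_pos_W11:
  assumes "W11_deriv_nonneg k T" shows "conv_deriv_pos (fkernel T k) T"
proof -
  obtain k\<^sub>0 k' where k: "k \<in> Lp_space 1 T UNIV" and k': "k' \<in> Lp_space 1 T UNIV" "has_time_deriv T k k\<^sub>0 k'"
    and k\<^sub>0: "k\<^sub>0 \<ge> 0" and pos: "conv_nonneg (conv_fun k') T"
    using assms unfolding W11_deriv_nonneg_def by blast
  have int: "integrable (time_measure T) k" "integrable (time_measure T) k'"
    using k k' by (auto simp: Lp_space_def integrable_iff_bounded)
  have int0: "integrable (time_measure T) (\<lambda>t. k t - k\<^sub>0)"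
    by (intro Bochner_Integration.integrable_diff int time_measure_const)
  note \<kappa> = real_kernel_fkernel[OF int(2)]
  note pos' = conv_pos_conv_fun[OF int(2) pos]
  have one: "causal (trunc T (\<lambda>_. 1 :: real))" by (intro causal_trunc time_measure_const)
  \<comment> \<open>The relation between \<open>k\<close> and its derivative, read as a
    factorization of \<open>k - k\<^sub>0\<close> through the kernel of \<open>k'\<close> with
    constant factor 1.\<close>
  have eq: "AE t in time_measure T. k t - k\<^sub>0 = conv_measure (fkernel T k') (\<lambda>_. 1) t"
    using conjunct2[OF k'(2)[unfolded has_conv_deriv_def]] unfolding AE_time_measure
  proof (eventually_elim, intro impI)
    fix t assume "0 < t \<and> t < T \<longrightarrow> k t - k\<^sub>0 = (LINT s:{0..t}|lborel. k' s)" and t: "0 < t \<and> t < T"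
    then have "k t - k\<^sub>0 = (LINT s:{0..t}|lborel. k' s)" by blast
    also have "\<dots> = conv_fun k' (\<lambda>_. 1) t" by (simp add: conv_fun_def)
    also have "\<dots> = sconv (fkernel T k') (trunc T (\<lambda>_. 1)) t"
      using t by (intro conv_fun_eq_sconv[where B = 1] int causal_measurable[OF one]) (auto simp: trunc_def)
    also have "\<dots> = conv_measure (fkernel T k') (\<lambda>_. 1) t"
      using t by (intro conv_measure_eq_sconv[symmetric] \<kappa> causal_measurable[OF one]) (auto simp: trunc_def)
    finally show "k t - k\<^sub>0 = conv_measure (fkernel T k') (\<lambda>_. 1) t" .
  qed
  show ?thesis
    unfolding conv_deriv_pos_def
  proof (intro allI impI)
    fix t and y :: "real \<Rightarrow> real" assume t: "t < T" and y: "ccont y"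
    have c: "ccont (prim y)" by (intro ccont_prim ccont_causal y)
    have split: "sconv (fkernel T k) y s = sconv (fkernel T k') (prim y) s + k\<^sub>0 * prim y s" if "s < T" for s
    proof -
      obtain B where B: "AE r in lborel. r \<le> s \<longrightarrow> norm (y r) \<le> B" using ccont_AE_bounded[OF y] by blast
      have yb: "\<And>x. x < 0 \<Longrightarrow> y x = 0" "\<And>t. \<exists>B. \<forall>x\<le>t. \<bar>y x\<bar> \<le> B"
        using ccont_nonpos[OF y] ccont_bounded[OF y] by (auto, metis real_norm_def)
      \<comment> \<open>Positive parts of densities do not add up, so the splitting of
        \<open>k\<close> is done in the \<open>fconv\<close> form, which is linear in the
        density.\<close>
      have "sconv (fkernel T k) y s = fconv y (trunc T k) s"
        by (rule sconv_fkernel_fconv[OF int(1) y])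
      also have "\<dots> = (LINT r|lborel. y (s - r) *\<^sub>R trunc T (\<lambda>t. k t - k\<^sub>0) r + y (s - r) *\<^sub>R trunc T (\<lambda>_. k\<^sub>0) r)"
        unfolding fconv_def
        by (intro Bochner_Integration.integral_cong) (auto simp: trunc_def algebra_simps)
      also have "\<dots> = fconv y (trunc T (\<lambda>t. k t - k\<^sub>0)) s + fconv y (trunc T (\<lambda>_. k\<^sub>0)) s"
        unfolding fconv_def
        by (intro Bochner_Integration.integral_add fconv_integrable[OF causal_trunc ccont_measurable[OF y] yb]
            int0 time_measure_const)
      also have "\<dots> = sconv (fkernel T (\<lambda>t. k t - k\<^sub>0)) y s + sconv (fkernel T (\<lambda>_. k\<^sub>0)) y s"
        by (simp add: sconv_fkernel_fconv int0 time_measure_const y)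
      also have "\<dots> = sconv (fkernel T k') (prim y) s + k\<^sub>0 * prim y s"
        by (simp add: sconv_factor_const[OF \<kappa> int0 eq y that] sconv_fkernel_const[OF y that])
      finally show ?thesis .
    qed
    have "prim (\<lambda>s. sconv (fkernel T k) y s * prim y s) t
      = prim (\<lambda>s. sconv (fkernel T k') (prim y) s * prim y s + k\<^sub>0 * (prim y s * prim y s)) t"
      by (rule prim_cong) (use split t in \<open>auto simp: algebra_simps\<close>)
    also have "\<dots> = prim (\<lambda>s. sconv (fkernel T k') (prim y) s * prim y s) t + k\<^sub>0 * prim (\<lambda>s. prim y s * prim y s) t"
      by (subst prim_add) (auto intro!: ccont_causal ccont_mult ccont_cmult c ccont_sconv \<kappa> simp: prim_cmult)
    also have "\<dots> \<ge> 0"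
    proof (intro add_nonneg_nonneg mult_nonneg_nonneg k\<^sub>0)
      show "0 \<le> prim (\<lambda>s. sconv (fkernel T k') (prim y) s * prim y s) t"
        using pos' t c by (simp add: conv_pos_def)
      have "prim (\<lambda>_. 0) t \<le> prim (\<lambda>s. prim y s * prim y s) t"
        by (intro prim_mono causal_0 ccont_causal[OF ccont_mult] c) auto
      then show "0 \<le> prim (\<lambda>s. prim y s * prim y s) t" by (simp add: prim_def set_lebesgue_integral_def)
    qed
    finally show "0 \<le> prim (\<lambda>s. sconv (fkernel T k) y s * prim y s) t" .
  qed
qed

text \<open>The assumption is applied to \<open>prim y\<close>, which vanishes at 0, so the term
  with the constant disappears. Its weak derivative under the convolution is k * y because
  primitives commute with convolutions.\<close>

lemma conv_deriv_pos_bounded_below: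
  assumes int: "integrable (time_measure T) k" and "conv_deriv_bounded_below k T"
  shows "conv_deriv_pos (fkernel T k) T"
  unfolding conv_deriv_pos_def
proof (intro allI impI)
  obtain C where C: "\<forall>t\<in>{0<..T}. \<forall>(y :: real \<Rightarrow> real) g.
    continuous_on {0..t} y \<and> g \<in> Lp_space 1 t UNIV \<and> has_conv_deriv (conv_fun k) t y (y 0) g \<longrightarrow>
    (LINT s:{0..t}|lborel. g s * y s) \<ge> - C * \<bar>y 0\<bar>\<^sup>2"
    using assms(2) unfolding conv_deriv_bounded_below_def by (elim exE)
  fix t and y :: "real \<Rightarrow> real" assume t: "t < T" and y: "ccont y"
  have c: "ccont (prim y)" by (intro ccont_prim ccont_causal y)
  note \<kappa> = real_kernel_fkernel[OF int]
  have cg: "ccont (sconv (fkernel T k) y)" by (rule ccont_sconv[OF \<kappa> y])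
  have y0: "prim y 0 = 0" using ccont_nonpos[OF c] by simp
  show "0 \<le> prim (\<lambda>s. sconv (fkernel T k) y s * prim y s) t"
  proof (cases "0 < t")
    case True
    have gint: "integrable (time_measure t) (sconv (fkernel T k) y)"
    proof -
      have "set_integrable lborel {0<..<t} (sconv (fkernel T k) y)"
        by (rule set_integrable_subset[OF causal_integrable[OF ccont_causal[OF cg], of t]]) auto
      then show ?thesis by (subst integrable_restrict_space) (auto simp: set_integrable_def)
    qed
    have "has_conv_deriv (conv_fun k) t (prim y) (prim y 0) (sconv (fkernel T k) y)"
      unfolding has_conv_deriv_def AE_time_measure y0
    proof (intro conjI gint always_eventually allI impI)
      fix s assume "0 < s \<and> s < t"
      then have "conv_fun k (prim y) s = sconv (fkernel T k) (prim y) s"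
        using t by (intro conv_fun_eq_sconv_ccont int c) auto
      also have "\<dots> = prim (sconv (fkernel T k) y) s"
        by (simp add: prim_sconv \<kappa> ccont_causal y)
      finally show "conv_fun k (\<lambda>s. prim y s - 0) s = (LINT s:{0..s}|lborel. sconv (fkernel T k) y s)"
        by (simp add: prim_def[of "sconv (fkernel T k) y"])
    qed
    moreover have "sconv (fkernel T k) y \<in> Lp_space 1 t UNIV"
      using gint by (auto simp: Lp_space_def intro: integrable_norm)
    ultimately show ?thesis
      using C[THEN bspec, of t, THEN spec, of "prim y", THEN spec, of "sconv (fkernel T k) y"]
        True t ccont_continuous[OF c] y0
      by (simp add: prim_def[of "\<lambda>s. sconv (fkernel T k) y s * prim y s"])
  next
    case False
    have "prim (\<lambda>s. sconv (fkernel T k) y s * prim y s) t = prim (\<lambda>_. 0) t"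
      by (rule prim_cong) (use False ccont_nonpos[OF c] in auto)
    then show ?thesis by (simp add: prim_def set_lebesgue_integral_def)
  qed
qed

section \<open>Time-integrated forms of the two problems\<close>

lemma Ck_scale: "Ck k \<phi> \<Longrightarrow> Ck k (\<lambda>x. c * \<phi> x)"
proof (induction k arbitrary: \<phi>)
  case 0
  then show ?case by (auto intro: continuous_intros)
next
  case (Suc k)
  have d: "((\<lambda>x. c * \<phi> x) has_derivative (\<lambda>i. c * frechet_derivative \<phi> (at x) i)) (at x)" for x
    using Suc.prems by (auto intro!: derivative_eq_intros simp: frechet_derivative_works[symmetric])
  have "frechet_derivative (\<lambda>x. c * \<phi> x) (at x) i = c * frechet_derivative \<phi> (at x) i" for x i
    by (rule fun_cong[OF frechet_derivative_at[OF d, symmetric]])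
  moreover have "Ck k (\<lambda>x. c * frechet_derivative \<phi> (at x) i)" if "i \<in> Basis" for i
    using Suc.prems that by (intro Suc.IH) simp
  moreover have "(\<lambda>x. c * \<phi> x) differentiable (at x)" for x
    using d differentiableI by blast
  ultimately show ?case by simp
qed

lemma gradient_scale:
  assumes "\<phi> differentiable (at x)" shows "gradient (\<lambda>x. c * \<phi> x) x = c *\<^sub>R gradient \<phi> x"
proof -
  have "((\<lambda>x. c * \<phi> x) has_derivative (\<lambda>i. c * frechet_derivative \<phi> (at x) i)) (at x)"
    using assms by (auto intro!: derivative_eq_intros simp: frechet_derivative_works[symmetric])
  then have "frechet_derivative (\<lambda>x. c * \<phi> x) (at x) = (\<lambda>i. c * frechet_derivative \<phi> (at x) i)"
    by (rule frechet_derivative_at[symmetric])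
  then show ?thesis by (simp add: gradient_def scaleR_sum_right)
qed

text \<open>Scaling maps the pairs built from test functions into themselves, and closure commutes
  with it. It makes products of a scalar weight with a fixed \<open>\<xi>\<close>
  admissible.\<close>

lemma H01_scale:
  assumes "\<xi> \<in> H01 \<Omega>" shows "c *\<^sub>R \<xi> \<in> H01 \<Omega>"
proof -
  let ?S = "(\<lambda>\<phi>. (abs_L2 \<phi>, abs_L2 (gradient \<phi>))) ` test_functions \<Omega>"
  have "(*\<^sub>R) c ` ?S \<subseteq> ?S"
  proof (clarsimp simp: image_iff)
    fix \<phi> assume \<phi>: "\<phi> \<in> test_functions \<Omega>"
    then have Ck: "Ck k \<phi>" for k by (simp add: test_functions_def)
    have diff: "\<phi> differentiable (at x)" for x using Ck[of "Suc 0"] by simp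
    obtain S where "compact S" "S \<subseteq> \<Omega>" "\<forall>x. x \<notin> S \<longrightarrow> \<phi> x = 0"
      using \<phi> unfolding test_functions_def by blast
    then have "(\<lambda>x. c * \<phi> x) \<in> test_functions \<Omega>"
      unfolding test_functions_def using Ck_scale[OF Ck] by (intro CollectI conjI allI exI[of _ S]) auto
    moreover have "gradient (\<lambda>x. c * \<phi> x) = (\<lambda>x. c *\<^sub>R gradient \<phi> x)"
      using gradient_scale[OF diff] by auto
    ultimately show "\<exists>\<phi>'\<in>test_functions \<Omega>. c *\<^sub>R abs_L2 \<phi> = abs_L2 \<phi>' \<and>
        c *\<^sub>R abs_L2 (gradient \<phi>) = abs_L2 (gradient \<phi>')"
      using test_function_square_integrable[OF \<phi>]
      by (intro bexI[of _ "\<lambda>x. c * \<phi> x"]) (auto simp: scaleR_abs_L2)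
  qed
  then have "closure ((*\<^sub>R) c ` ?S) \<subseteq> closure ?S" by (rule closure_mono)
  moreover have "c *\<^sub>R \<xi> \<in> (*\<^sub>R) c ` closure ?S" using assms unfolding H01_def by (rule imageI)
  ultimately show ?thesis unfolding H01_def closure_scaleR by blast
qed

text \<open>
  The test functions are \<open>weight t n s *\<^sub>R \<xi>\<close>: integrating against them evaluates an
  iterated primitive at time \<open>t\<close>.
\<close>

definition weight :: "real \<Rightarrow> nat \<Rightarrow> real \<Rightarrow> real"
  where "weight t n s = (max 0 (t - s)) ^ n / fact n"

lemma weight_beyond: "0 < n \<Longrightarrow> t \<le> s \<Longrightarrow> weight t n s = 0"
  by (simp add: weight_def)

lemma weight_continuous: "continuous_on S (weight t n)"
  unfolding weight_def[abs_def] by (intro continuous_intros) auto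

lemma weight_integral_upto:
  assumes "r \<le> s" "s \<le> t"
  shows "(LINT x:{r..s}|lborel. weight t n x) = weight t (Suc n) r - weight t (Suc n) s"
proof -
  have "(LINT x:{r..s}|lborel. weight t n x) = (LINT x|lborel. (t - x) ^ n / fact n * indicator {r..s} x)"
    unfolding set_lebesgue_integral_def
    by (rule Bochner_Integration.integral_cong) (use assms in \<open>auto simp: indicator_def weight_def max_def\<close>)
  also have "\<dots> = - ((t - s) ^ Suc n / fact (Suc n)) - (- ((t - r) ^ Suc n / fact (Suc n)))"
  proof (rule integral_FTC_Icc_real[OF assms(1)])
    fix x
    have "((\<lambda>x. t - x) has_real_derivative - 1) (at x)" by (auto intro!: derivative_eq_intros)
    from DERIV_power[OF this, of "Suc n"]
    have "((\<lambda>x. (t - x) ^ Suc n) has_real_derivative - (real (Suc n) * (t - x) ^ n)) (at x)"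
      by (rule DERIV_cong) simp
    from DERIV_minus[OF DERIV_cdivide[OF this, of "fact (Suc n)"]]
    show "((\<lambda>x. - ((t - x) ^ Suc n / fact (Suc n))) has_real_derivative (t - x) ^ n / fact n) (at x)"
      by (rule DERIV_cong) (simp add: fact_Suc del: of_nat_Suc)
  qed (auto intro!: continuous_intros)
  also have "\<dots> = weight t (Suc n) r - weight t (Suc n) s"
    using assms by (simp add: weight_def max_def)
  finally show ?thesis .
qed

text \<open>The condition \<open>0 < n\<close> is essential: \<open>weight t 0\<close> is
  identically 1, also beyond \<open>t\<close>, because the zeroth power of 0 is 1.\<close>

lemma weight_primitive:
  assumes "0 \<le> s" "0 \<le> t" "0 < n"
  shows "(LINT x:{0..s}|lborel. weight t n x) = weight t (Suc n) 0 - weight t (Suc n) s"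
proof (cases "s \<le> t")
  case True
  then show ?thesis using assms by (intro weight_integral_upto)
next
  case False
  have "(LINT x:{0..s}|lborel. weight t n x) = (LINT x:{0..t}|lborel. weight t n x)"
    unfolding set_lebesgue_integral_def
    by (rule Bochner_Integration.integral_cong) (use False assms in \<open>auto simp: indicator_def weight_beyond\<close>)
  also have "\<dots> = weight t (Suc n) 0 - weight t (Suc n) t"
    using assms by (intro weight_integral_upto) auto
  finally show ?thesis using False by (simp add: weight_beyond)
qed

text \<open>Fubini on the triangle 0 \<le> r \<le> s \<le> t.\<close>

lemma integral_mult_prim:
  fixes u c :: "real \<Rightarrow> real"
  assumes u: "causal u" and c: "continuous_on UNIV c"
  shows "(LINT s:{0..t}|lborel. c s * prim u s) = (LINT r:{0..t}|lborel. (LINT s:{r..t}|lborel. c s) * u r)"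
proof -
  have [measurable]: "u \<in> borel_measurable borel" "c \<in> borel_measurable borel"
    using causal_measurable[OF u] borel_measurable_continuous_onI[OF c] by auto
  have "bounded (c ` {0..t})"
    by (intro compact_imp_bounded compact_continuous_image continuous_on_subset[OF c]) auto
  then obtain B where B: "\<And>x. 0 \<le> x \<Longrightarrow> x \<le> t \<Longrightarrow> \<bar>c x\<bar> \<le> B"
    unfolding bounded_iff by (metis atLeastAtMost_iff imageI real_norm_def)
  \<comment> \<open>The conditional makes joint measurability automatic; \<open>F_eq\<close> is the
    same function as a product of indicators, convenient for fixed \<open>s\<close>.\<close>
  define F where "F s r = indicator {0..t} s * c s * ((if 0 \<le> r \<and> r \<le> s then 1 else 0) * u r)" for s r
  have F_eq: "F s r = indicator {0..t} s * c s * (indicator {0..s} r * u r)" for s r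
    by (simp add: F_def indicator_def)
  have F_int: "integrable lborel (F s)" for s
    using causal_integrable_Icc[OF u, of 0 s] unfolding F_eq
    by (intro integrable_mult_right) (simp add: set_integrable_def)
  have int: "integrable (lborel \<Otimes>\<^sub>M lborel) (\<lambda>(s, r). F s r)"
  proof (rule lborel_pair.Fubini_integrable)
    show "(\<lambda>(s, r). F s r) \<in> borel_measurable (lborel \<Otimes>\<^sub>M lborel)"
      unfolding F_def split_beta by measurable
    show "integrable lborel (\<lambda>s. LINT r|lborel. norm (case (s, r) of (s, r) \<Rightarrow> F s r))"
    proof (rule Bochner_Integration.integrable_bound)
      show "integrable lborel (\<lambda>s. indicator {0..t} s * (B * prim (\<lambda>r. \<bar>u r\<bar>) t))"
        using emeasure_bounded_finite[of "{0..t} :: real set"]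
        by (intro integrable_mult_left integrable_real_indicator) auto
      have "causal (\<lambda>r. \<bar>u r\<bar>)" using causal_norm[OF u] by simp
      note mono = prim_nonneg_mono[OF this]
      have "norm (LINT r|lborel. norm (F s r)) \<le> norm (indicator {0..t} s * (B * prim (\<lambda>r. \<bar>u r\<bar>) t))" for s
      proof (cases "s \<in> {0..t}")
        case True
        have "(LINT r|lborel. norm (F s r)) = \<bar>c s\<bar> * prim (\<lambda>r. \<bar>u r\<bar>) s"
          using True by (simp add: F_eq prim_def set_lebesgue_integral_def abs_mult)
        moreover have "\<dots> \<le> B * prim (\<lambda>r. \<bar>u r\<bar>) t"
          using True B[of s] mono[of s t] mono[of "-1" s] by (intro mult_mono) (auto simp: prim_neg)
        moreover have "0 \<le> \<bar>c s\<bar> * prim (\<lambda>r. \<bar>u r\<bar>) s"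
          using True mono[of "-1" s] by (auto simp: prim_neg)
        ultimately show ?thesis using True by simp
      qed (simp add: F_eq)
      then show "AE s in lborel. norm (LINT r|lborel. norm (case (s, r) of (s, r) \<Rightarrow> F s r))
          \<le> norm (indicator {0..t} s * (B * prim (\<lambda>r. \<bar>u r\<bar>) t))" by simp
      show "(\<lambda>s. LINT r|lborel. norm (case (s, r) of (s, r) \<Rightarrow> F s r)) \<in> borel_measurable lborel"
        unfolding F_def split_beta fst_conv snd_conv by measurable
    qed
  qed (simp add: F_int)
  have "(LINT s:{0..t}|lborel. c s * prim u s) = (LINT s|lborel. LINT r|lborel. F s r)"
    unfolding F_eq set_lebesgue_integral_def prim_def
    by (intro Bochner_Integration.integral_cong refl) simp
  also have "\<dots> = (LINT r|lborel. LINT s|lborel. F s r)"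
    using lborel_pair.Fubini_integral[OF int] by simp
  also have "\<dots> = (LINT r:{0..t}|lborel. (LINT s:{r..t}|lborel. c s) * u r)"
    unfolding set_lebesgue_integral_def
  proof (intro Bochner_Integration.integral_cong refl)
    fix r
    have "(LINT s|lborel. F s r) = (LINT s|lborel. (indicator {0..} r * u r) * (indicator {r..t} s * c s))"
      unfolding F_eq by (intro Bochner_Integration.integral_cong refl) (auto simp: indicator_def)
    also have "\<dots> = (indicator {0..} r * u r) * (LINT s|lborel. indicator {r..t} s * c s)"
      by (rule integral_mult_right_zero)
    also have "\<dots> = indicator {0..t} r *\<^sub>R ((LINT s|lborel. indicator {r..t} s *\<^sub>R c s) * u r)"
    proof (cases "r \<le> t")
      case False
      then have "(\<lambda>s. indicator {r..t} s * c s) = (\<lambda>_. 0)" by auto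
      then show ?thesis using False by simp
    qed (simp add: indicator_def)
    finally show "(LINT s|lborel. F s r) = indicator {0..t} r *\<^sub>R ((LINT s|lborel. indicator {r..t} s *\<^sub>R c s) * u r)" .
  qed
  finally show ?thesis .
qed

text \<open>Cauchy's formula for repeated integration; the induction moves one primitive from
  \<open>u\<close> onto the weight.\<close>

lemma weight_integral_eq_prim_pow:
  fixes u :: "real \<Rightarrow> real"
  assumes "causal u"
  shows "(LINT s:{0..t}|lborel. weight t n s * u s) = (prim ^^ Suc n) u t"
  using assms
proof (induction n arbitrary: u)
  case 0
  then show ?case by (simp add: weight_def prim_def)
next
  case (Suc n)
  have "(prim ^^ Suc (Suc n)) u t = (prim ^^ Suc n) (prim u) t" by (simp add: funpow_Suc_right del: funpow.simps)
  also have "\<dots> = (LINT s:{0..t}|lborel. weight t n s * prim u s)"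
    by (rule Suc.IH[symmetric]) (rule causal_prim[OF Suc.prems])
  also have "\<dots> = (LINT r:{0..t}|lborel. (LINT s:{r..t}|lborel. weight t n s) * u r)"
    by (intro integral_mult_prim Suc.prems weight_continuous)
  also have "\<dots> = (LINT r:{0..t}|lborel. weight t (Suc n) r * u r)"
    by (intro set_lebesgue_integral_cong) (auto simp: weight_integral_upto weight_beyond)
  finally show ?case ..
qed

lemma prim_pow_bounded_linear:
  assumes "bounded_linear L" "causal u"
  shows "(prim ^^ n) (\<lambda>s. L (u s)) = (\<lambda>t. L ((prim ^^ n) u t))"
  by (induction n) (auto simp: prim_bounded_linear[OF assms(1)] causal_prim_pow assms(2))

lemma weighted_inner:
  fixes Y :: "real \<Rightarrow> 'h::{real_inner,banach,second_countable_topology}"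
  assumes "causal Y" "\<And>s. 0 \<le> s \<Longrightarrow> s \<le> t \<Longrightarrow> X s = Y s" "0 < n" "t \<le> T"
  shows "(LINT s:{0..T}|lborel. X s \<bullet> (weight t n s *\<^sub>R x)) = (prim ^^ Suc n) Y t \<bullet> x"
proof -
  have "(LINT s:{0..T}|lborel. X s \<bullet> (weight t n s *\<^sub>R x)) = (LINT s:{0..t}|lborel. weight t n s * (Y s \<bullet> x))"
    unfolding set_lebesgue_integral_def
    by (rule Bochner_Integration.integral_cong) (use assms in \<open>auto simp: indicator_def weight_beyond\<close>)
  also have "\<dots> = (prim ^^ Suc n) (\<lambda>s. Y s \<bullet> x) t"
    by (rule weight_integral_eq_prim_pow)
      (rule causal_bounded_linear[OF bounded_linear_inner_left assms(1)])
  finally show ?thesis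
    by (simp add: prim_pow_bounded_linear[OF bounded_linear_inner_left assms(1)] del: funpow.simps)
qed

text \<open>The minus sign compensates the sign from differentiating in \<open>s\<close>: minus the
  weight of order n + 1 has as derivative the weight of order n.\<close>

lemma H1_time_weight:
  assumes \<xi>: "\<xi> \<in> H01 \<Omega>" and t: "0 \<le> t" and n: "0 < n"
  shows "H1_time T (H01 \<Omega>) (\<lambda>s. (- weight t (Suc n) s) *\<^sub>R \<xi>) (\<lambda>s. weight t n s *\<^sub>R \<xi>)"
  unfolding H1_time_def
proof (intro conjI ballI)
  have cont: "continuous_on UNIV (\<lambda>s. weight t n s *\<^sub>R \<xi>)" by (intro continuous_intros weight_continuous)
  then have m: "(\<lambda>s. weight t n s *\<^sub>R \<xi>) \<in> borel_measurable (time_measure T)"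
    by (intro measurable_restrict_space1) (simp add: borel_measurable_continuous_onI)
  interpret finite_measure "time_measure T"
    using emeasure_bounded_finite[of "{0<..<T} :: real set"]
    by (intro finite_measureI) (simp add: emeasure_restrict_space space_restrict_space)
  have "weight t n s \<le> t ^ n / fact n" "0 \<le> weight t n s" if "0 < s" for s
    unfolding weight_def using that t by (intro divide_right_mono power_mono divide_nonneg_nonneg zero_le_power; simp)+
  then have le: "norm (weight t n s *\<^sub>R \<xi>) \<le> t ^ n / fact n * norm \<xi>" if "0 < s" for s
    using that mult_right_mono[of "weight t n s" "t ^ n / fact n" "norm \<xi>"] by simp
  have "integrable (time_measure T) (\<lambda>s. (norm (weight t n s *\<^sub>R \<xi>))\<^sup>2)"
  proof (rule integrable_const_bound)
    show "AE s in time_measure T. norm ((norm (weight t n s *\<^sub>R \<xi>))\<^sup>2) \<le> (t ^ n / fact n * norm \<xi>)\<^sup>2"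
      unfolding AE_time_measure
    proof (intro always_eventually allI impI)
      fix s assume "0 < s \<and> s < T"
      from power_mono[OF le norm_ge_zero, of s 2] this
      show "norm ((norm (weight t n s *\<^sub>R \<xi>))\<^sup>2) \<le> (t ^ n / fact n * norm \<xi>)\<^sup>2"
        by (simp only: real_norm_def abs_power2)
    qed
  qed (rule borel_measurable_power[OF measurable_compose[OF m borel_measurable_norm]])
  then have "integrable (time_measure T) (\<lambda>s. norm (weight t n s *\<^sub>R \<xi>) powr 2)" by simp
  then show "(\<lambda>s. weight t n s *\<^sub>R \<xi>) \<in> Lp_space 2 T (H01 \<Omega>)"
    using m by (simp add: Lp_space_def H01_scale[OF \<xi>])
  fix s assume s: "s \<in> {0..T}"
  have "(LINT r:{0..s}|lborel. weight t n r *\<^sub>R \<xi>) = (LINT r:{0..s}|lborel. weight t n r) *\<^sub>R \<xi>"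
    using integral_scaleR_left[of \<xi> lborel "\<lambda>r. indicator {0..s} r *\<^sub>R weight t n r"]
      borel_integrable_compact[OF compact_Icc weight_continuous, of 0 s t n]
    by (simp add: set_lebesgue_integral_def)
  then show "(- weight t (Suc n) s) *\<^sub>R \<xi> = (- weight t (Suc n) 0) *\<^sub>R \<xi> + (LINT r:{0..s}|lborel. weight t n r *\<^sub>R \<xi>)"
    using s t n by (simp add: weight_primitive algebra_simps)
qed (rule H01_scale[OF \<xi>])

section \<open>The weak equations as identities for iterated primitives\<close>

lemma prim_pow_cong:
  assumes "\<And>s. s < T \<Longrightarrow> u s = v s" "t < T" shows "(prim ^^ n) u t = (prim ^^ n) v t"
  using assms(2) by (induction n arbitrary: t) (auto intro: prim_cong assms(1))

text \<open>A single primitive turns equality almost everywhere into equality at every time before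
  T, hence \<open>0 < n\<close>.\<close>

lemma prim_pow_cong_AE:
  assumes "causal u" "causal v" "AE s in time_measure T. u s = v s" "0 < n" "t < T"
  shows "(prim ^^ n) u t = (prim ^^ n) v t"
proof -
  obtain m where n: "n = Suc m" using assms(4) by (cases n) auto
  have "prim u s = prim v s" if "s < T" for s
  proof (rule prim_cong_AE[OF assms(1,2)])
    show "AE r in lborel. 0 \<le> r \<and> r \<le> s \<longrightarrow> u r = v r"
      using assms(3) AE_lborel_singleton[of 0] unfolding AE_time_measure
      by eventually_elim (use that in auto)
  qed
  then show ?thesis
    unfolding n funpow_Suc_right comp_def using assms(5) by (rule prim_pow_cong)
qed

lemma prim_pow_shift: "(prim ^^ n) (prim u) = (prim ^^ Suc n) u"
  by (simp add: funpow_Suc_right del: funpow.simps)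

lemma prim_pow_sconv:
  "real_kernel \<mu> \<Longrightarrow> causal u \<Longrightarrow> (prim ^^ n) (sconv \<mu> u) = sconv \<mu> ((prim ^^ n) u)"
  by (induction n) (auto simp: prim_sconv causal_prim_pow)

lemma prim_pow_add:
  assumes "causal u" "causal v"
  shows "(prim ^^ n) (\<lambda>s. u s + v s) = (\<lambda>t. (prim ^^ n) u t + (prim ^^ n) v t)"
  by (induction n) (auto simp: prim_add causal_prim_pow assms)

definition unit_step :: "real \<Rightarrow> real" where "unit_step = indicator {0..}"

lemma causal_unit_step: "causal unit_step"
proof -
  have "integrable lborel (\<lambda>x. indicator {..t} x *\<^sub>R indicator {0..} x :: real)" for t :: real
  proof -
    have "(\<lambda>x. indicator {..t} x *\<^sub>R indicator {0..} x :: real) = indicator {0..t}"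
      by (auto simp: indicator_def)
    moreover have "integrable lborel (indicator {0..t} :: real \<Rightarrow> real)"
      using emeasure_bounded_finite[of "{0..t} :: real set"] by (intro integrable_real_indicator) auto
    ultimately show ?thesis by simp
  qed
  then show ?thesis by (auto simp: causal_def unit_step_def set_integrable_def)
qed

lemma weight_zero_eq: "0 \<le> t \<Longrightarrow> 0 < n \<Longrightarrow> weight t (Suc n) 0 = (prim ^^ Suc n) unit_step t"
proof -
  assume t: "0 \<le> t" "0 < n"
  have "(prim ^^ Suc n) unit_step t = (LINT s:{0..t}|lborel. weight t n s * unit_step s)"
    by (rule weight_integral_eq_prim_pow[OF causal_unit_step, symmetric])
  also have "\<dots> = (LINT s:{0..t}|lborel. weight t n s)"
    by (rule set_lebesgue_integral_cong) (auto simp: unit_step_def)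
  finally show ?thesis using t by (simp add: weight_primitive weight_beyond)
qed

lemma weighted_inner_minus:
  fixes Y :: "real \<Rightarrow> 'h::{real_inner,banach,second_countable_topology}"
  assumes "causal Y" "\<And>s. 0 \<le> s \<Longrightarrow> s \<le> t \<Longrightarrow> X s = Y s" "0 < n" "t \<le> T"
  shows "(LINT s:{0..T}|lborel. X s \<bullet> ((- weight t n s) *\<^sub>R x)) = - ((prim ^^ Suc n) Y t \<bullet> x)"
  using weighted_inner[OF assms, of "- x"] by simp

lemma trunc_snd: "trunc T (\<lambda>s. snd (u s)) = (\<lambda>s. snd (trunc T u s))"
  by (auto simp: trunc_def fun_eq_iff)

lemma integrable_fst_snd:
  assumes "integrable M u"
  shows "integrable M (\<lambda>s. fst (u s))" "integrable M (\<lambda>s. snd (u s))"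
  using integrable_bounded_linear[OF bounded_linear_fst assms] integrable_bounded_linear[OF bounded_linear_snd assms] by auto

lemma has_time_deriv_trunc:
  assumes "has_time_deriv T u u\<^sub>0 g"
  shows "AE t in time_measure T. trunc T (\<lambda>s. u s - u\<^sub>0) t = prim (trunc T g) t"
  using conjunct2[OF assms[unfolded has_conv_deriv_def]]
  unfolding AE_time_measure by eventually_elim (auto simp: trunc_def[of T "\<lambda>s. u s - u\<^sub>0"] simp flip: prim_trunc)

lemma has_time_deriv_prim:
  assumes "has_time_deriv T (\<lambda>t. fst (\<psi> t)) (fst \<psi>\<^sub>0) g"
  shows "AE t in time_measure T. prim (trunc T g) t = fst (trunc T (\<lambda>s. \<psi> s - \<psi>\<^sub>0) t)"
  using has_time_deriv_trunc[OF assms]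
  by eventually_elim (auto simp: trunc_def[of T "\<lambda>s. \<psi> s - \<psi>\<^sub>0"] trunc_def[of T "\<lambda>s. fst (\<psi> s) - fst \<psi>\<^sub>0"])

lemma has_conv_deriv_measure_trunc:
  assumes "has_conv_deriv (conv_measure \<mu>) T u u\<^sub>0 g" "real_kernel \<mu>" "integrable (time_measure T) u"
  shows "AE t in time_measure T. sconv \<mu> (trunc T (\<lambda>s. u s - u\<^sub>0)) t = prim (trunc T g) t"
  using conjunct2[OF assms(1)[unfolded has_conv_deriv_def]] unfolding AE_time_measure
proof eventually_elim
  case (elim t)
  have c: "causal (trunc T (\<lambda>s. u s - u\<^sub>0))"
    by (intro causal_trunc Bochner_Integration.integrable_diff assms time_measure_const)
  have "conv_measure \<mu> (\<lambda>s. u s - u\<^sub>0) t = sconv \<mu> (trunc T (\<lambda>s. u s - u\<^sub>0)) t" if "t < T"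
    by (rule conv_measure_eq_sconv[OF assms(2) causal_measurable[OF c]]) (use that in \<open>auto simp: trunc_def\<close>)
  then show ?case using elim by (simp flip: prim_trunc)
qed

text \<open>The bound on \<open>u\<close> makes the convolution with a merely integrable kernel
  converge absolutely at every time, as the splitting of the kernel into positive and negative parts
  requires.\<close>

lemma has_conv_deriv_fun_trunc:
  assumes "has_conv_deriv (conv_fun k) T u u\<^sub>0 g" "integrable (time_measure T) k" "integrable (time_measure T) u"
    and "AE s in time_measure T. norm (u s) \<le> B"
  shows "AE t in time_measure T. sconv (fkernel T k) (trunc T (\<lambda>s. u s - u\<^sub>0)) t = prim (trunc T g) t"
  using conjunct2[OF assms(1)[unfolded has_conv_deriv_def]] unfolding AE_time_measure
proof eventually_elim
  case (elim t)
  have c: "causal (trunc T (\<lambda>s. u s - u\<^sub>0))"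
    by (intro causal_trunc Bochner_Integration.integrable_diff assms time_measure_const)
  have "AE s in time_measure T. norm (u s - u\<^sub>0) \<le> \<bar>B\<bar> + norm u\<^sub>0"
    using assms(4)
  proof eventually_elim
    case (elim s)
    then show ?case using norm_triangle_ineq4[of "u s" u\<^sub>0] by simp
  qed
  then have "AE s in lborel. norm (trunc T (\<lambda>s. u s - u\<^sub>0) s) \<le> \<bar>B\<bar> + norm u\<^sub>0"
    by (rule AE_trunc_lborel) simp
  then have b: "AE s in lborel. s \<le> t \<longrightarrow> norm (trunc T (\<lambda>s. u s - u\<^sub>0) s) \<le> \<bar>B\<bar> + norm u\<^sub>0"
    by (rule eventually_mono) simp
  have "conv_fun k (\<lambda>s. u s - u\<^sub>0) t = sconv (fkernel T k) (trunc T (\<lambda>s. u s - u\<^sub>0)) t" if "t < T"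
    by (rule conv_fun_eq_sconv[OF assms(2) that causal_measurable[OF c] _ b]) (use that in \<open>auto simp: trunc_def\<close>)
  then show ?case using elim by (simp flip: prim_trunc)
qed

text \<open>
  The weak form tested with \<open>- weight t (n + 2) s *\<^sub>R \<xi>\<close>; $(P_0)$ is the case \<open>A = 0\<close>. Here \<open>\<phi>\<close> is the
  solution minus its initial value, and \<open>\<zeta>\<close> is the gradient of the initial value.
\<close>

definition relaxation_residual ::
    "real_measure \<Rightarrow> real_measure \<Rightarrow> real \<Rightarrow> real \<Rightarrow> real \<Rightarrow> real \<Rightarrow> real \<Rightarrow>
      (real \<Rightarrow> ('a::euclidean_space, real) L2) \<Rightarrow> ('a, real) L2 \<Rightarrow> ('a, 'a) L2 \<Rightarrow> (real \<Rightarrow> 'a H1) \<Rightarrow>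
      nat \<Rightarrow> 'a H1 \<Rightarrow> real \<Rightarrow> real"
  where "relaxation_residual \<mu> \<nu> A m \<beta> \<gamma> D f \<psi>\<^sub>2 \<zeta> \<phi> n \<xi> t =
    (A *\<^sub>R sconv \<mu> ((prim ^^ n) (\<lambda>s. fst (\<phi> s))) t + m *\<^sub>R (prim ^^ Suc n) (\<lambda>s. fst (\<phi> s)) t
      + A *\<^sub>R ((prim ^^ (n + 2)) unit_step t *\<^sub>R \<psi>\<^sub>2) - (prim ^^ (n + 3)) f t) \<bullet> fst \<xi>
    + (\<beta> *\<^sub>R ((prim ^^ (n + 3)) (\<lambda>s. snd (\<phi> s)) t + (prim ^^ (n + 3)) unit_step t *\<^sub>R \<zeta>)
      + (A * \<gamma>) *\<^sub>R sconv \<mu> ((prim ^^ (n + 2)) (\<lambda>s. snd (\<phi> s))) t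
      + D *\<^sub>R sconv \<nu> ((prim ^^ Suc n) (\<lambda>s. snd (\<phi> s))) t) \<bullet> snd \<xi>"

text \<open>For \<open>n > 0\<close> every iterated primitive is continuous, so the identity makes
  sense at each \<open>t\<close> and not just almost everywhere. Negative times are included because
  backward quotients reach them.\<close>

definition relaxation_identity ::
    "'a::euclidean_space set \<Rightarrow> real \<Rightarrow> real_measure \<Rightarrow> real_measure \<Rightarrow> real \<Rightarrow> real \<Rightarrow> real \<Rightarrow> real \<Rightarrow> real \<Rightarrow>
      (real \<Rightarrow> ('a, real) L2) \<Rightarrow> ('a, real) L2 \<Rightarrow> ('a, 'a) L2 \<Rightarrow> (real \<Rightarrow> 'a H1) \<Rightarrow> bool"
  where "relaxation_identity \<Omega> T \<mu> \<nu> A m \<beta> \<gamma> D f \<psi>\<^sub>2 \<zeta> \<phi> \<longleftrightarrow>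
    (\<forall>n>0. \<forall>t<T. \<forall>\<xi>\<in>H01 \<Omega>. relaxation_residual \<mu> \<nu> A m \<beta> \<gamma> D f \<psi>\<^sub>2 \<zeta> \<phi> n \<xi> t = 0)"

lemma relaxation_identityI:
  assumes "real_kernel \<mu>" "real_kernel \<nu>" "causal \<phi>" "causal f"
    and "\<And>n t \<xi>. 0 < n \<Longrightarrow> 0 \<le> t \<Longrightarrow> t < T \<Longrightarrow> \<xi> \<in> H01 \<Omega> \<Longrightarrow>
      relaxation_residual \<mu> \<nu> A m \<beta> \<gamma> D f \<psi>\<^sub>2 \<zeta> \<phi> n \<xi> t = 0"
  shows "relaxation_identity \<Omega> T \<mu> \<nu> A m \<beta> \<gamma> D f \<psi>\<^sub>2 \<zeta> \<phi>"
  unfolding relaxation_identity_def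
proof (intro allI impI ballI)
  fix n :: nat and t :: real and \<xi> :: "'a H1" assume n: "0 < n" and t: "t < T" and \<xi>: "\<xi> \<in> H01 \<Omega>"
  have c: "causal (\<lambda>s. fst (\<phi> s))" "causal (\<lambda>s. snd (\<phi> s))"
    using assms(3) by (auto intro: causal_bounded_linear bounded_linear_fst bounded_linear_snd)
  have z: "(prim ^^ k) u t = 0" if "t < 0" "0 < k" "causal u" for k and u :: "real \<Rightarrow> 'z::{banach,second_countable_topology}"
    using ccont_nonpos[OF ccont_prim_pow_causal[OF that(3,2)]] that(1) by simp
  have zs: "sconv \<kappa> ((prim ^^ k) u) t = 0" if "t < 0" "0 < k" "causal u" "real_kernel \<kappa>"
    for k \<kappa> and u :: "real \<Rightarrow> 'z::{banach,second_countable_topology}"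
    using ccont_nonpos[OF ccont_sconv[OF that(4) ccont_prim_pow_causal[OF that(3,2)]]] that(1) by simp
  show "relaxation_residual \<mu> \<nu> A m \<beta> \<gamma> D f \<psi>\<^sub>2 \<zeta> \<phi> n \<xi> t = 0"
  proof (cases "0 \<le> t")
    case True
    show ?thesis by (rule assms(5)[OF n True t \<xi>])
  next
    case False
    then have "t < 0" by simp
    have p: "0 < n + 2" "0 < n + 3" "0 < Suc n" by auto
    note z' = z[OF \<open>t < 0\<close>] and zs' = zs[OF \<open>t < 0\<close>]
    show ?thesis
      unfolding relaxation_residual_def
        zs'[OF n c(1) assms(1)] z'[OF p(3) c(1)] z'[OF p(1) causal_unit_step] z'[OF p(2) assms(4)]
        z'[OF p(2) c(2)] z'[OF p(2) causal_unit_step] zs'[OF p(1) c(2) assms(1)] zs'[OF p(3) c(2) assms(2)]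
      by simp
  qed
qed

lemma prim_pow_trunc_snd:
  fixes \<psi> :: "real \<Rightarrow> 'a::euclidean_space H1"
  assumes \<psi>: "integrable (time_measure T) \<psi>" and "t < T"
  shows "(prim ^^ k) (trunc T (\<lambda>s. snd (\<psi> s))) t =
    (prim ^^ k) (\<lambda>s. snd (trunc T (\<lambda>s. \<psi> s - \<psi>\<^sub>0) s)) t + (prim ^^ k) unit_step t *\<^sub>R snd \<psi>\<^sub>0"
proof -
  have c: "causal (\<lambda>s. snd (trunc T (\<lambda>s. \<psi> s - \<psi>\<^sub>0) s))"
    by (intro causal_bounded_linear[OF bounded_linear_snd] causal_trunc Bochner_Integration.integrable_diff \<psi> time_measure_const)
  have c1: "causal (\<lambda>s. unit_step s *\<^sub>R snd \<psi>\<^sub>0)"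
    by (rule causal_bounded_linear[OF bounded_linear_scaleR_left causal_unit_step])
  have "(prim ^^ k) (trunc T (\<lambda>s. snd (\<psi> s))) t
      = (prim ^^ k) (\<lambda>s. snd (trunc T (\<lambda>s. \<psi> s - \<psi>\<^sub>0) s) + unit_step s *\<^sub>R snd \<psi>\<^sub>0) t"
    using assms(2) by (rule prim_pow_cong[rotated]) (auto simp: trunc_def unit_step_def)
  then show ?thesis
    by (simp add: prim_pow_add[OF c c1] prim_pow_bounded_linear[OF bounded_linear_scaleR_left causal_unit_step])
qed

lemma Lp_space_infinity:
  assumes "u \<in> Lp_space \<infinity> T Z"
  obtains B where "0 \<le> B" "AE t in time_measure T. norm (u t) \<le> B"
    "integrable (time_measure T) u" "AE t in time_measure T. u t \<in> Z"
proof -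
  obtain B where B: "AE t in time_measure T. norm (u t) \<le> B" using assms by (auto simp: Lp_space_def)
  interpret finite_measure "time_measure T"
    using emeasure_bounded_finite[of "{0<..<T} :: real set"]
    by (intro finite_measureI) (simp add: emeasure_restrict_space space_restrict_space)
  have "integrable (time_measure T) u"
    by (rule integrable_const_bound[OF B]) (use assms in \<open>auto simp: Lp_space_def\<close>)
  moreover have "AE t in time_measure T. norm (u t) \<le> max 0 B"
    using B by eventually_elim auto
  ultimately show ?thesis using that[of "max 0 B"] assms by (auto simp: Lp_space_def)
qed

lemma Lp_space_1_integrable: "u \<in> Lp_space 1 T Z \<Longrightarrow> integrable (time_measure T) u"
  by (auto simp: Lp_space_def integrable_iff_bounded)

lemma weighted_velocity:
  fixes \<psi> :: "real \<Rightarrow> 'a::euclidean_space H1"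
  assumes \<psi>: "integrable (time_measure T) \<psi>"
    and d: "has_time_deriv T (\<lambda>t. fst (\<psi> t)) (fst \<psi>\<^sub>0) \<psi>\<^sub>t" and n: "0 < n" and t: "0 \<le> t" "t < T"
  shows "(LINT s:{0..T}|lborel. (k *\<^sub>R \<psi>\<^sub>t s) \<bullet> fst (weight t n s *\<^sub>R \<xi>))
    = k * ((prim ^^ n) (\<lambda>s. fst (trunc T (\<lambda>s. \<psi> s - \<psi>\<^sub>0) s)) t \<bullet> fst \<xi>)"
proof -
  have c: "causal (trunc T \<psi>\<^sub>t)" using d by (intro causal_trunc) (simp add: has_conv_deriv_def)
  have c1: "causal (\<lambda>s. fst (trunc T (\<lambda>s. \<psi> s - \<psi>\<^sub>0) s))"
    by (intro causal_bounded_linear[OF bounded_linear_fst] causal_trunc Bochner_Integration.integrable_diff \<psi> time_measure_const)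
  have "(prim ^^ Suc n) (trunc T \<psi>\<^sub>t) t = (prim ^^ n) (\<lambda>s. fst (trunc T (\<lambda>s. \<psi> s - \<psi>\<^sub>0) s)) t"
    using prim_pow_cong_AE[OF causal_prim[OF c] c1 has_time_deriv_prim[OF d] n t(2)] by (simp only: prim_pow_shift)
  then have "(LINT s:{0..T}|lborel. \<psi>\<^sub>t s \<bullet> fst (weight t n s *\<^sub>R \<xi>))
      = (prim ^^ n) (\<lambda>s. fst (trunc T (\<lambda>s. \<psi> s - \<psi>\<^sub>0) s)) t \<bullet> fst \<xi>"
    using weighted_inner[OF c _ n, of t \<psi>\<^sub>t T "fst \<xi>"] t by (simp add: trunc_def[of T \<psi>\<^sub>t] del: funpow.simps)
  then show ?thesis by (simp only: inner_scaleR_left set_integral_mult_right)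
qed

lemma weighted_gradient:
  fixes \<psi> :: "real \<Rightarrow> 'a::euclidean_space H1"
  assumes \<psi>: "integrable (time_measure T) \<psi>" and n: "0 < n" and t: "0 \<le> t" "t < T"
  shows "(LINT s:{0..T}|lborel. (k *\<^sub>R snd (\<psi> s)) \<bullet> snd ((- weight t n s) *\<^sub>R \<xi>))
    = - k * (((prim ^^ Suc n) (\<lambda>s. snd (trunc T (\<lambda>s. \<psi> s - \<psi>\<^sub>0) s)) t + (prim ^^ Suc n) unit_step t *\<^sub>R snd \<psi>\<^sub>0) \<bullet> snd \<xi>)"
proof -
  have "(LINT s:{0..T}|lborel. snd (\<psi> s) \<bullet> snd ((- weight t n s) *\<^sub>R \<xi>))
      = - ((prim ^^ Suc n) (trunc T (\<lambda>s. snd (\<psi> s))) t \<bullet> snd \<xi>)"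
    using weighted_inner_minus[OF causal_trunc[OF integrable_fst_snd(2)[OF \<psi>]] _ n, of t "\<lambda>s. snd (\<psi> s)" T "snd \<xi>"] t
    by (simp add: trunc_def[of T "\<lambda>s. snd (\<psi> s)"] del: funpow.simps)
  also note prim_pow_trunc_snd[OF \<psi> t(2), where \<psi>\<^sub>0 = \<psi>\<^sub>0]
  finally show ?thesis by (simp only: inner_scaleR_left set_integral_mult_right mult_minus_left mult_minus_right)
qed

lemma collect_P\<^sub>\<tau>_terms:
  fixes x p\<^sub>1 :: "'h::real_inner" and y p\<^sub>3 :: "'g::real_inner"
  assumes "- A * (p\<^sub>1 \<bullet> x) - m * (p\<^sub>2 \<bullet> x) + \<gamma> * (- \<beta> * (p\<^sub>3 \<bullet> y)) + A * \<gamma> * - (p\<^sub>4 \<bullet> y) - D * (p\<^sub>5 \<bullet> y)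
    = - A * (\<psi> \<bullet> (- w) *\<^sub>R x) + - (p\<^sub>6 \<bullet> x)"
  shows "(A *\<^sub>R p\<^sub>1 + m *\<^sub>R p\<^sub>2 + A *\<^sub>R (w *\<^sub>R \<psi>) - p\<^sub>6) \<bullet> x
    + ((\<gamma> * \<beta>) *\<^sub>R p\<^sub>3 + (A * \<gamma>) *\<^sub>R p\<^sub>4 + D *\<^sub>R p\<^sub>5) \<bullet> y = 0"
  using assms by (simp add: inner_add_left inner_diff_left)

lemma collect_P\<^sub>0_terms:
  fixes x p\<^sub>1 :: "'h::real_inner" and y p\<^sub>3 :: "'g::real_inner"
  assumes "- (m * (p\<^sub>2 \<bullet> x)) + \<gamma> * (- \<beta> * (p\<^sub>3 \<bullet> y)) + d * e * - ((p\<^sub>5 + r) \<bullet> y)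
    = - d * e * (r \<bullet> y) + - (p\<^sub>6 \<bullet> x)"
  shows "(0 *\<^sub>R p\<^sub>1 + m *\<^sub>R p\<^sub>2 + 0 *\<^sub>R q - p\<^sub>6) \<bullet> x
    + ((\<gamma> * \<beta>) *\<^sub>R p\<^sub>3 + (0 * \<gamma>) *\<^sub>R p\<^sub>4 + (d * e) *\<^sub>R p\<^sub>5) \<bullet> y = 0"
  using assms by (simp add: inner_add_left inner_diff_left algebra_simps)

text \<open>Weighted test functions turn each integral into an iterated primitive at
  \<open>t\<close>. The relations defining psi_t, K_1 * psi_t, K_1 * psi_tt and K_2 * psi_t each
  spend primitives (two for K_1 * psi_tt), until only \<open>\<phi>\<close> and the data
  remain.\<close>

lemma solves_P\<^sub>\<tau>_identity:
  fixes \<psi> :: "real \<Rightarrow> 'a::euclidean_space H1"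
  assumes sol: "solves_P\<^sub>\<tau> \<Omega> T c \<delta> \<tau>\<^sub>\<theta> a b \<aa> \<bb> \<KK>\<^sub>1 \<KK>\<^sub>2 \<psi>\<^sub>0 \<psi>\<^sub>2 f \<tau> \<psi>"
    and \<mu>: "real_kernel \<KK>\<^sub>1" and k2: "integrable (time_measure T) \<KK>\<^sub>2"
    and f: "integrable (time_measure T) f"
  defines "\<phi> \<equiv> trunc T (\<lambda>s. \<psi> s - \<psi>\<^sub>0)"
  shows "\<psi> \<in> Lp_space \<infinity> T (H01 \<Omega>)"
    and "\<exists>\<psi>\<^sub>t. has_time_deriv T (\<lambda>t. fst (\<psi> t)) (fst \<psi>\<^sub>0) \<psi>\<^sub>t"
    and "relaxation_identity \<Omega> T \<KK>\<^sub>1 (fkernel T \<KK>\<^sub>2) (\<tau> powr a) \<aa> (c\<^sup>2 * \<bb>) (c\<^sup>2) (\<tau>\<^sub>\<theta> powr b * \<delta>)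
      (trunc T f) \<psi>\<^sub>2 (snd \<psi>\<^sub>0) \<phi>"
proof -
  show Lp: "\<psi> \<in> Lp_space \<infinity> T (H01 \<Omega>)"
    using sol unfolding solves_P\<^sub>\<tau>_def solution_space_def X_space_def by simp
  then obtain B where B: "AE t in time_measure T. norm (\<psi> t) \<le> B" and \<psi>: "integrable (time_measure T) \<psi>"
    using Lp_space_infinity by metis
  obtain \<psi>\<^sub>t g\<^sub>1 g\<^sub>2 h where
    d: "has_time_deriv T (\<lambda>t. fst (\<psi> t)) (fst \<psi>\<^sub>0) \<psi>\<^sub>t"
    and d1: "has_conv_deriv (conv_measure \<KK>\<^sub>1) T \<psi> \<psi>\<^sub>0 g\<^sub>1"
    and d2: "has_conv_deriv (conv_measure \<KK>\<^sub>1) T \<psi>\<^sub>t 0 g\<^sub>2"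
    and d3: "has_conv_deriv (conv_fun \<KK>\<^sub>2) T \<psi> \<psi>\<^sub>0 h"
    and weak: "\<forall>v v'. H1_time T (H01 \<Omega>) v v' \<and> v T = 0 \<longrightarrow>
        - (\<tau> powr a) * (LINT s:{0..T}|lborel. g\<^sub>2 s \<bullet> fst (v' s))
        - (LINT s:{0..T}|lborel. (\<aa> *\<^sub>R \<psi>\<^sub>t s) \<bullet> fst (v' s))
        + c\<^sup>2 * (LINT s:{0..T}|lborel. (\<bb> *\<^sub>R snd (\<psi> s)) \<bullet> snd (v s))
        + \<tau> powr a * c\<^sup>2 * (LINT s:{0..T}|lborel. snd (g\<^sub>1 s) \<bullet> snd (v s))
        - \<tau>\<^sub>\<theta> powr b * \<delta> * (LINT s:{0..T}|lborel. snd (h s) \<bullet> snd (v' s))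
        = - (\<tau> powr a) * (\<psi>\<^sub>2 \<bullet> fst (v 0)) + (LINT s:{0..T}|lborel. f s \<bullet> fst (v s))"
    using sol unfolding solves_P\<^sub>\<tau>_def by blast
  show "\<exists>\<psi>\<^sub>t. has_time_deriv T (\<lambda>t. fst (\<psi> t)) (fst \<psi>\<^sub>0) \<psi>\<^sub>t" using d by blast
  define \<nu> where "\<nu> = fkernel T \<KK>\<^sub>2"
  have \<nu>: "real_kernel \<nu>" unfolding \<nu>_def by (rule real_kernel_fkernel[OF k2])
  have int: "integrable (time_measure T) \<psi>\<^sub>t" "integrable (time_measure T) g\<^sub>1"
    "integrable (time_measure T) g\<^sub>2" "integrable (time_measure T) h"
    using d d1 d2 d3 by (auto simp: has_conv_deriv_def)
  note cc = int[THEN causal_trunc] causal_trunc[OF f]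
  have c\<phi>: "causal \<phi>" unfolding \<phi>_def
    by (intro causal_trunc Bochner_Integration.integrable_diff \<psi> time_measure_const)
  have c\<phi>1: "causal (\<lambda>s. fst (\<phi> s))" by (rule causal_bounded_linear[OF bounded_linear_fst c\<phi>])
  have \<phi>1: "AE t in time_measure T. prim (trunc T \<psi>\<^sub>t) t = fst (\<phi> t)"
    unfolding \<phi>_def by (rule has_time_deriv_prim[OF d])
  have e1: "AE t in time_measure T. prim (trunc T g\<^sub>1) t = sconv \<KK>\<^sub>1 \<phi> t"
    using has_conv_deriv_measure_trunc[OF d1 \<mu> \<psi>] unfolding \<phi>_def by eventually_elim simp
  have e2: "AE t in time_measure T. prim (trunc T g\<^sub>2) t = sconv \<KK>\<^sub>1 (trunc T \<psi>\<^sub>t) t"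
    using has_conv_deriv_measure_trunc[OF d2 \<mu> int(1)] by eventually_elim simp
  have e3: "AE t in time_measure T. prim (trunc T h) t = sconv \<nu> \<phi> t"
    using has_conv_deriv_fun_trunc[OF d3 k2 \<psi> B] unfolding \<phi>_def \<nu>_def by eventually_elim simp
  have "relaxation_identity \<Omega> T \<KK>\<^sub>1 \<nu> (\<tau> powr a) \<aa> (c\<^sup>2 * \<bb>) (c\<^sup>2) (\<tau>\<^sub>\<theta> powr b * \<delta>)
      (trunc T f) \<psi>\<^sub>2 (snd \<psi>\<^sub>0) \<phi>"
  proof (rule relaxation_identityI[OF \<mu> \<nu> c\<phi> cc(5)])
    fix n :: nat and t :: real and \<xi> :: "'a H1"
    assume n: "0 < n" and t: "0 \<le> t" "t < T" and \<xi>: "\<xi> \<in> H01 \<Omega>"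
    \<comment> \<open>With weight n + 1 in \<open>?v'\<close>, the term with K_1 * psi_tt becomes a
      primitive of order n + 2. Two orders are spent on removing the time derivatives, leaving order
      n, which is why the weights start two above n.\<close>
    let ?v = "\<lambda>s. (- weight t (n + 2) s) *\<^sub>R \<xi>" and ?v' = "\<lambda>s. weight t (n + 1) s *\<^sub>R \<xi>"
    have H1: "H1_time T (H01 \<Omega>) ?v ?v'"
      using H1_time_weight[OF \<xi> t(1), of "n + 1" T] by simp
    have vT: "?v T = 0" using t by (simp add: weight_beyond)
    have tT: "t \<le> T" and nn: "0 < n + 1" "0 < n + 2" using t by auto
    have eqT: "u s = trunc T u s" if "0 \<le> s" "s \<le> t" for s and u :: "real \<Rightarrow> 'z::zero"
      using that t by (simp add: trunc_def)
    have i1: "(LINT s:{0..T}|lborel. g\<^sub>2 s \<bullet> fst (?v' s)) = sconv \<KK>\<^sub>1 ((prim ^^ n) (\<lambda>s. fst (\<phi> s))) t \<bullet> fst \<xi>"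
    proof -
      have "(prim ^^ Suc (n + 1)) (trunc T g\<^sub>2) t = (prim ^^ Suc n) (sconv \<KK>\<^sub>1 (trunc T \<psi>\<^sub>t)) t"
        using prim_pow_cong_AE[OF causal_prim[OF cc(3)] causal_sconv[OF \<mu> cc(1)] e2, of "Suc n" t] t
        by (simp only: prim_pow_shift) simp
      also have "\<dots> = sconv \<KK>\<^sub>1 ((prim ^^ Suc n) (trunc T \<psi>\<^sub>t)) t"
        by (simp only: prim_pow_sconv[OF \<mu> cc(1)])
      also have "\<dots> = sconv \<KK>\<^sub>1 ((prim ^^ n) (\<lambda>s. fst (\<phi> s))) t"
      proof (rule sconv_cong[OF \<mu> ccont_prim_pow_causal[OF cc(1)] ccont_prim_pow_causal[OF c\<phi>1 n]])
        show "(prim ^^ Suc n) (trunc T \<psi>\<^sub>t) s = (prim ^^ n) (\<lambda>s. fst (\<phi> s)) s" if "s \<le> t" for s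
          using prim_pow_cong_AE[OF causal_prim[OF cc(1)] c\<phi>1 \<phi>1 n, of s] that t
          by (simp only: prim_pow_shift)
      qed simp
      finally show ?thesis
        using weighted_inner[OF cc(3) eqT nn(1) tT, of "fst \<xi>"] by (simp del: funpow.simps)
    qed
    have i2: "(LINT s:{0..T}|lborel. (\<aa> *\<^sub>R \<psi>\<^sub>t s) \<bullet> fst (?v' s)) = \<aa> * ((prim ^^ Suc n) (\<lambda>s. fst (\<phi> s)) t \<bullet> fst \<xi>)"
      using weighted_velocity[OF \<psi> d nn(1) t, of \<aa> \<xi>] unfolding \<phi>_def by (simp del: funpow.simps)
    have i3: "(LINT s:{0..T}|lborel. (\<bb> *\<^sub>R snd (\<psi> s)) \<bullet> snd (?v s))
        = - \<bb> * (((prim ^^ (n + 3)) (\<lambda>s. snd (\<phi> s)) t + (prim ^^ (n + 3)) unit_step t *\<^sub>R snd \<psi>\<^sub>0) \<bullet> snd \<xi>)"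
      using weighted_gradient[OF \<psi> nn(2) t, of \<bb> \<xi> \<psi>\<^sub>0] unfolding \<phi>_def
      by (simp del: funpow.simps add: numeral_eq_Suc)
    have i4: "(LINT s:{0..T}|lborel. snd (g\<^sub>1 s) \<bullet> snd (?v s))
        = - (sconv \<KK>\<^sub>1 ((prim ^^ (n + 2)) (\<lambda>s. snd (\<phi> s))) t \<bullet> snd \<xi>)"
    proof -
      have "(LINT s:{0..T}|lborel. snd (g\<^sub>1 s) \<bullet> snd (?v s)) = - ((prim ^^ (n + 3)) (trunc T (\<lambda>s. snd (g\<^sub>1 s))) t \<bullet> snd \<xi>)"
        using weighted_inner_minus[OF causal_trunc[OF integrable_fst_snd(2)[OF int(2)]] eqT nn(2) tT, of "snd \<xi>"]
        by (simp del: funpow.simps add: numeral_eq_Suc)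
      also have "(prim ^^ (n + 3)) (trunc T (\<lambda>s. snd (g\<^sub>1 s))) t = snd ((prim ^^ Suc (n + 2)) (trunc T g\<^sub>1) t)"
        by (simp only: trunc_snd prim_pow_bounded_linear[OF bounded_linear_snd cc(2)]) (simp add: numeral_eq_Suc del: funpow.simps)
      also have "(prim ^^ Suc (n + 2)) (trunc T g\<^sub>1) t = (prim ^^ (n + 2)) (sconv \<KK>\<^sub>1 \<phi>) t"
        using prim_pow_cong_AE[OF causal_prim[OF cc(2)] causal_sconv[OF \<mu> c\<phi>] e1 nn(2), of t] t
        by (simp only: prim_pow_shift)
      also have "snd \<dots> = sconv \<KK>\<^sub>1 (\<lambda>s. snd ((prim ^^ (n + 2)) \<phi> s)) t"
        unfolding prim_pow_sconv[OF \<mu> c\<phi>]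
        by (rule sconv_bounded_linear[OF bounded_linear_snd \<mu> ccont_prim_pow_causal[OF c\<phi> nn(2)], symmetric])
      finally show ?thesis by (simp only: prim_pow_bounded_linear[OF bounded_linear_snd c\<phi>])
    qed
    have i5: "(LINT s:{0..T}|lborel. snd (h s) \<bullet> snd (?v' s))
        = sconv \<nu> ((prim ^^ Suc n) (\<lambda>s. snd (\<phi> s))) t \<bullet> snd \<xi>"
    proof -
      have "(LINT s:{0..T}|lborel. snd (h s) \<bullet> snd (?v' s)) = (prim ^^ Suc (Suc n)) (trunc T (\<lambda>s. snd (h s))) t \<bullet> snd \<xi>"
        using weighted_inner[OF causal_trunc[OF integrable_fst_snd(2)[OF int(4)]] eqT nn(1) tT, of "snd \<xi>"]
        by (simp del: funpow.simps)
      also have "(prim ^^ Suc (Suc n)) (trunc T (\<lambda>s. snd (h s))) t = snd ((prim ^^ Suc (Suc n)) (trunc T h) t)"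
        by (simp only: trunc_snd prim_pow_bounded_linear[OF bounded_linear_snd cc(4)])
      also have "(prim ^^ Suc (Suc n)) (trunc T h) t = (prim ^^ Suc n) (sconv \<nu> \<phi>) t"
        using prim_pow_cong_AE[OF causal_prim[OF cc(4)] causal_sconv[OF \<nu> c\<phi>] e3, of "Suc n" t] t
        by (simp only: prim_pow_shift)
      also have "snd \<dots> = sconv \<nu> (\<lambda>s. snd ((prim ^^ Suc n) \<phi> s)) t"
        unfolding prim_pow_sconv[OF \<nu> c\<phi>]
        by (rule sconv_bounded_linear[OF bounded_linear_snd \<nu> ccont_prim_pow_causal[OF c\<phi>], symmetric]) simp
      finally show ?thesis by (simp only: prim_pow_bounded_linear[OF bounded_linear_snd c\<phi>])
    qed
    have i6: "(LINT s:{0..T}|lborel. f s \<bullet> fst (?v s)) = - ((prim ^^ (n + 3)) (trunc T f) t \<bullet> fst \<xi>)"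
      using weighted_inner_minus[OF cc(5) eqT nn(2) tT, of "fst \<xi>"]
      by (simp del: funpow.simps add: numeral_eq_Suc)
    have v0: "fst (?v 0) = - (prim ^^ (n + 2)) unit_step t *\<^sub>R fst \<xi>"
      using weight_zero_eq[OF t(1) nn(1)] by (simp del: funpow.simps)
    show "relaxation_residual \<KK>\<^sub>1 \<nu> (\<tau> powr a) \<aa> (c\<^sup>2 * \<bb>) (c\<^sup>2) (\<tau>\<^sub>\<theta> powr b * \<delta>)
        (trunc T f) \<psi>\<^sub>2 (snd \<psi>\<^sub>0) \<phi> n \<xi> t = 0"
      unfolding relaxation_residual_def
      by (rule collect_P\<^sub>\<tau>_terms[OF weak[rule_format, OF conjI[OF H1 vT], unfolded i1 i2 i3 i4 i5 i6 v0]])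
  qed
  then show "relaxation_identity \<Omega> T \<KK>\<^sub>1 (fkernel T \<KK>\<^sub>2) (\<tau> powr a) \<aa> (c\<^sup>2 * \<bb>) (c\<^sup>2) (\<tau>\<^sub>\<theta> powr b * \<delta>)
      (trunc T f) \<psi>\<^sub>2 (snd \<psi>\<^sub>0) \<phi>" unfolding \<nu>_def .
qed

text \<open>The identity is stated with \<open>\<KK>\<^sub>1\<close> and
  \<open>\<psi>\<^sub>2\<close> under the coefficient 0, in a form that can be subtracted from that
  of the \<tau>-problem. The right-hand side term with the initial gradient cancels against the part
  of the convolution that comes from the initial value.\<close>

lemma solves_P\<^sub>0_identity:
  fixes \<psi> :: "real \<Rightarrow> 'a::euclidean_space H1"
  assumes sol: "solves_P\<^sub>0 \<Omega> T c \<delta> \<tau>\<^sub>\<theta> b \<aa> \<bb> \<KK>\<^sub>2 \<psi>\<^sub>0 f \<psi>"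
    and \<mu>: "real_kernel \<KK>\<^sub>1" and k2: "integrable (time_measure T) \<KK>\<^sub>2"
    and f: "integrable (time_measure T) f"
  defines "\<phi> \<equiv> trunc T (\<lambda>s. \<psi> s - \<psi>\<^sub>0)"
  shows "\<psi> \<in> Lp_space \<infinity> T (H01 \<Omega>)"
    and "\<exists>\<psi>\<^sub>t\<in>Lp_space \<infinity> T (L2_on \<Omega>). has_time_deriv T (\<lambda>t. fst (\<psi> t)) (fst \<psi>\<^sub>0) \<psi>\<^sub>t"
    and "relaxation_identity \<Omega> T \<KK>\<^sub>1 (fkernel T \<KK>\<^sub>2) 0 \<aa> (c\<^sup>2 * \<bb>) (c\<^sup>2) (\<tau>\<^sub>\<theta> powr b * \<delta>)
      (trunc T f) \<psi>\<^sub>2 (snd \<psi>\<^sub>0) \<phi>"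
proof -
  show Lp: "\<psi> \<in> Lp_space \<infinity> T (H01 \<Omega>)"
    using sol unfolding solves_P\<^sub>0_def by simp
  then obtain B where B: "0 \<le> B" "AE t in time_measure T. norm (\<psi> t) \<le> B" and \<psi>: "integrable (time_measure T) \<psi>"
    using Lp_space_infinity by metis
  obtain \<psi>\<^sub>t where Lpt: "\<psi>\<^sub>t\<in>Lp_space \<infinity> T (L2_on \<Omega>)" and
    d: "has_time_deriv T (\<lambda>t. fst (\<psi> t)) (fst \<psi>\<^sub>0) \<psi>\<^sub>t"
    and weak: "\<forall>v v' v''. H1_time T (H01 \<Omega>) v v' \<and> H1_time T (H01 \<Omega>) v' v'' \<and> v T = 0 \<and> v' T = 0 \<longrightarrow>
        - (LINT s:{0..T}|lborel. (\<aa> *\<^sub>R \<psi>\<^sub>t s) \<bullet> fst (v' s))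
        + c\<^sup>2 * (LINT s:{0..T}|lborel. (\<bb> *\<^sub>R snd (\<psi> s)) \<bullet> snd (v s))
        + \<tau>\<^sub>\<theta> powr b * \<delta> * (LINT s:{0..T}|lborel. conv_fun \<KK>\<^sub>2 (\<lambda>t. snd (\<psi> t)) s \<bullet> snd (v'' s))
        = - (\<tau>\<^sub>\<theta> powr b) * \<delta> * (LINT s:{0..T}|lborel. (\<KK>\<^sub>2 s *\<^sub>R snd \<psi>\<^sub>0) \<bullet> snd (v' s))
        + (LINT s:{0..T}|lborel. f s \<bullet> fst (v s))"
    using sol unfolding solves_P\<^sub>0_def by (elim conjE bexE)
  show "\<exists>\<psi>\<^sub>t\<in>Lp_space \<infinity> T (L2_on \<Omega>). has_time_deriv T (\<lambda>t. fst (\<psi> t)) (fst \<psi>\<^sub>0) \<psi>\<^sub>t"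
    using d Lpt by blast
  define \<nu> where "\<nu> = fkernel T \<KK>\<^sub>2"
  have \<nu>: "real_kernel \<nu>" unfolding \<nu>_def by (rule real_kernel_fkernel[OF k2])
  have int: "integrable (time_measure T) \<psi>\<^sub>t" using d by (auto simp: has_conv_deriv_def)
  have int2: "integrable (time_measure T) (\<lambda>s. snd (\<psi> s))" by (rule integrable_fst_snd(2)[OF \<psi>])
  note cc = causal_trunc[OF int] causal_trunc[OF f] causal_trunc[OF int2] causal_trunc[OF k2]
  have c\<phi>: "causal \<phi>" unfolding \<phi>_def
    by (intro causal_trunc Bochner_Integration.integrable_diff \<psi> time_measure_const)
  have c\<phi>1: "causal (\<lambda>s. fst (\<phi> s))" by (rule causal_bounded_linear[OF bounded_linear_fst c\<phi>])
  have c\<phi>2: "causal (\<lambda>s. snd (\<phi> s))" by (rule causal_bounded_linear[OF bounded_linear_snd c\<phi>])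
  have \<phi>1: "AE t in time_measure T. prim (trunc T \<psi>\<^sub>t) t = fst (\<phi> t)"
    unfolding \<phi>_def by (rule has_time_deriv_prim[OF d])
  have "AE s in time_measure T. norm (snd (\<psi> s)) \<le> B"
    using B(2)
  proof eventually_elim
    case (elim s)
    then show ?case using norm_snd_le[of "snd (\<psi> s)" "fst (\<psi> s)"] by simp
  qed
  then have "AE s in lborel. norm (trunc T (\<lambda>s. snd (\<psi> s)) s) \<le> B"
    by (rule AE_trunc_lborel) (use B in simp)
  then have b: "AE s in lborel. s \<le> t \<longrightarrow> norm (trunc T (\<lambda>s. snd (\<psi> s)) s) \<le> B" for t
    by (rule eventually_mono) simp
  have "relaxation_identity \<Omega> T \<KK>\<^sub>1 \<nu> 0 \<aa> (c\<^sup>2 * \<bb>) (c\<^sup>2) (\<tau>\<^sub>\<theta> powr b * \<delta>)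
      (trunc T f) \<psi>\<^sub>2 (snd \<psi>\<^sub>0) \<phi>"
  proof (rule relaxation_identityI[OF \<mu> \<nu> c\<phi> cc(2)])
    fix n :: nat and t :: real and \<xi> :: "'a H1"
    assume n: "0 < n" and t: "0 \<le> t" "t < T" and \<xi>: "\<xi> \<in> H01 \<Omega>"
    let ?v = "\<lambda>s. (- weight t (n + 2) s) *\<^sub>R \<xi>" and ?v' = "\<lambda>s. weight t (n + 1) s *\<^sub>R \<xi>"
      and ?v'' = "\<lambda>s. (- weight t n s) *\<^sub>R \<xi>"
    have H1: "H1_time T (H01 \<Omega>) ?v ?v'"
      using H1_time_weight[OF \<xi> t(1), of "n + 1" T] by simp
    have "- \<xi> \<in> H01 \<Omega>" using H01_scale[OF \<xi>, of "- 1"] by simp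
    then have H2: "H1_time T (H01 \<Omega>) ?v' ?v''"
      using H1_time_weight[of "- \<xi>" \<Omega> t n T] t(1) n by simp
    have vT: "?v T = 0" "?v' T = 0" using t by (simp_all add: weight_beyond)
    have tT: "t \<le> T" and nn: "0 < n + 1" "0 < n + 2" using t by auto
    have eqT: "u s = trunc T u s" if "0 \<le> s" "s \<le> t" for s and u :: "real \<Rightarrow> 'z::zero"
      using that t by (simp add: trunc_def)
    have i2: "(LINT s:{0..T}|lborel. (\<aa> *\<^sub>R \<psi>\<^sub>t s) \<bullet> fst (?v' s)) = \<aa> * ((prim ^^ Suc n) (\<lambda>s. fst (\<phi> s)) t \<bullet> fst \<xi>)"
      using weighted_velocity[OF \<psi> d nn(1) t, of \<aa> \<xi>] unfolding \<phi>_def by (simp del: funpow.simps)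
    have i3: "(LINT s:{0..T}|lborel. (\<bb> *\<^sub>R snd (\<psi> s)) \<bullet> snd (?v s))
        = - \<bb> * (((prim ^^ (n + 3)) (\<lambda>s. snd (\<phi> s)) t + (prim ^^ (n + 3)) unit_step t *\<^sub>R snd \<psi>\<^sub>0) \<bullet> snd \<xi>)"
      using weighted_gradient[OF \<psi> nn(2) t, of \<bb> \<xi> \<psi>\<^sub>0] unfolding \<phi>_def
      by (simp del: funpow.simps add: numeral_eq_Suc)
    have i4: "(LINT s:{0..T}|lborel. (\<KK>\<^sub>2 s *\<^sub>R snd \<psi>\<^sub>0) \<bullet> snd (?v' s)) = ((prim ^^ Suc (Suc n)) (trunc T \<KK>\<^sub>2) t *\<^sub>R snd \<psi>\<^sub>0) \<bullet> snd \<xi>"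
    proof -
      have "(LINT s:{0..T}|lborel. (\<KK>\<^sub>2 s *\<^sub>R snd \<psi>\<^sub>0) \<bullet> snd (?v' s))
          = (prim ^^ Suc (Suc n)) (\<lambda>s. trunc T \<KK>\<^sub>2 s *\<^sub>R snd \<psi>\<^sub>0) t \<bullet> snd \<xi>"
        using weighted_inner[OF causal_bounded_linear[OF bounded_linear_scaleR_left cc(4)] _ nn(1) tT,
            where x = "snd \<xi>", OF arg_cong[OF eqT, of _ "\<lambda>r. r *\<^sub>R snd \<psi>\<^sub>0"]]
        by (simp del: funpow.simps)
      then show ?thesis by (simp only: prim_pow_bounded_linear[OF bounded_linear_scaleR_left cc(4)])
    qed
    have i5: "(LINT s:{0..T}|lborel. conv_fun \<KK>\<^sub>2 (\<lambda>t. snd (\<psi> t)) s \<bullet> snd (?v'' s))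
        = - ((sconv \<nu> ((prim ^^ Suc n) (\<lambda>s. snd (\<phi> s))) t + (prim ^^ Suc (Suc n)) (trunc T \<KK>\<^sub>2) t *\<^sub>R snd \<psi>\<^sub>0) \<bullet> snd \<xi>)"
    proof -
      have "conv_fun \<KK>\<^sub>2 (\<lambda>t. snd (\<psi> t)) s = sconv \<nu> (trunc T (\<lambda>s. snd (\<psi> s))) s" if "0 \<le> s" "s \<le> t" for s
        unfolding \<nu>_def using that t
        by (intro conv_fun_eq_sconv[OF k2 _ causal_measurable[OF cc(3)] _ b]) (auto simp: trunc_def)
      then have "(LINT s:{0..T}|lborel. conv_fun \<KK>\<^sub>2 (\<lambda>t. snd (\<psi> t)) s \<bullet> snd (?v'' s))
        = - ((prim ^^ Suc n) (sconv \<nu> (trunc T (\<lambda>s. snd (\<psi> s)))) t \<bullet> snd \<xi>)"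
        using weighted_inner_minus[OF causal_sconv[OF \<nu> cc(3)] _ n tT,
            of "conv_fun \<KK>\<^sub>2 (\<lambda>t. snd (\<psi> t))" "snd \<xi>"]
        by (simp del: funpow.simps)
      also have "(prim ^^ Suc n) (sconv \<nu> (trunc T (\<lambda>s. snd (\<psi> s)))) t
          = sconv \<nu> ((prim ^^ Suc n) (trunc T (\<lambda>s. snd (\<psi> s)))) t"
        by (simp only: prim_pow_sconv[OF \<nu> cc(3)])
      \<comment> \<open>The gradient is split into that of \<open>\<phi>\<close> and the constant
        initial gradient. The convolution of K_2 with a unit step is the primitive of K_2, which
        matches the term computed in \<open>i4\<close>.\<close>
      also have "\<dots> = sconv \<nu> (\<lambda>t. (prim ^^ Suc n) (\<lambda>s. snd (\<phi> s)) t + (prim ^^ Suc n) unit_step t *\<^sub>R snd \<psi>\<^sub>0) t"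
      proof (rule sconv_cong[OF \<nu>])
        show "(prim ^^ Suc n) (trunc T (\<lambda>s. snd (\<psi> s))) s
          = (prim ^^ Suc n) (\<lambda>s. snd (\<phi> s)) s + (prim ^^ Suc n) unit_step s *\<^sub>R snd \<psi>\<^sub>0" if "s \<le> t" for s
          unfolding \<phi>_def using that t by (intro prim_pow_trunc_snd[OF \<psi>]) simp
      qed (intro ccont_add ccont_prim_pow_causal ccont_bounded_linear[OF bounded_linear_scaleR_left] cc c\<phi>2
          causal_unit_step zero_less_Suc)+
      also have "\<dots> = sconv \<nu> ((prim ^^ Suc n) (\<lambda>s. snd (\<phi> s))) t
          + sconv \<nu> (\<lambda>t. (prim ^^ Suc n) unit_step t *\<^sub>R snd \<psi>\<^sub>0) t"
        by (intro sconv_add[OF \<nu>] ccont_prim_pow_causal ccont_bounded_linear[OF bounded_linear_scaleR_left] c\<phi>2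
          causal_unit_step zero_less_Suc)
      also have "sconv \<nu> (\<lambda>t. (prim ^^ Suc n) unit_step t *\<^sub>R snd \<psi>\<^sub>0) t
          = sconv \<nu> ((prim ^^ Suc n) unit_step) t *\<^sub>R snd \<psi>\<^sub>0"
        by (intro sconv_bounded_linear[OF bounded_linear_scaleR_left \<nu>] ccont_prim_pow_causal causal_unit_step zero_less_Suc)
      also have "sconv \<nu> ((prim ^^ Suc n) unit_step) t = (prim ^^ Suc n) (sconv \<nu> unit_step) t"
        by (simp only: prim_pow_sconv[OF \<nu> causal_unit_step])
      also have "\<dots> = (prim ^^ Suc n) (prim (trunc T \<KK>\<^sub>2)) t"
      proof (rule prim_pow_cong[OF _ t(2)])
        fix s assume "s < T"
        have "conv_fun \<KK>\<^sub>2 (\<lambda>_. 1) s = sconv \<nu> unit_step s"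
          unfolding \<nu>_def
          by (rule conv_fun_eq_sconv[OF k2 \<open>s < T\<close> causal_measurable[OF causal_unit_step], of 1])
            (auto simp: unit_step_def indicator_def)
        then show "sconv \<nu> unit_step s = prim (trunc T \<KK>\<^sub>2) s"
          using \<open>s < T\<close> by (simp add: conv_fun_def prim_trunc)
      qed
      finally show ?thesis by (simp only: prim_pow_shift)
    qed
    have i6: "(LINT s:{0..T}|lborel. f s \<bullet> fst (?v s)) = - ((prim ^^ (n + 3)) (trunc T f) t \<bullet> fst \<xi>)"
      using weighted_inner_minus[OF cc(2) eqT nn(2) tT, of "fst \<xi>"]
      by (simp del: funpow.simps add: numeral_eq_Suc)
    show "relaxation_residual \<KK>\<^sub>1 \<nu> 0 \<aa> (c\<^sup>2 * \<bb>) (c\<^sup>2) (\<tau>\<^sub>\<theta> powr b * \<delta>)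
        (trunc T f) \<psi>\<^sub>2 (snd \<psi>\<^sub>0) \<phi> n \<xi> t = 0"
      unfolding relaxation_residual_def
      by (rule collect_P\<^sub>0_terms[OF weak[rule_format, OF conjI[OF H1 conjI[OF H2 conjI[OF vT]]], unfolded i2 i3 i4 i5 i6]])
  qed
  then show "relaxation_identity \<Omega> T \<KK>\<^sub>1 (fkernel T \<KK>\<^sub>2) 0 \<aa> (c\<^sup>2 * \<bb>) (c\<^sup>2) (\<tau>\<^sub>\<theta> powr b * \<delta>)
      (trunc T f) \<psi>\<^sub>2 (snd \<psi>\<^sub>0) \<phi>" unfolding \<nu>_def .
qed

section \<open>Uniform bounds and convergence\<close>

text \<open>
  \<open>mol h k u\<close> is the \<open>k\<close>-fold primitive of the fourfold difference quotient, that is, the derivative of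
  order \<open>4 - k\<close> of the fourfold Steklov average of \<open>u\<close>.
\<close>

definition mol :: "real \<Rightarrow> nat \<Rightarrow> (real \<Rightarrow> 'b::{banach,second_countable_topology}) \<Rightarrow> real \<Rightarrow> 'b"
  where "mol h k u = (dq h ^^ 4) ((prim ^^ k) u)"

lemma ccont_mol: "causal u \<Longrightarrow> 0 < h \<Longrightarrow> 0 < k \<Longrightarrow> ccont (mol h k u)"
  unfolding mol_def by (intro ccont_dq_pow ccont_prim_pow_causal)

lemma prim_mol: "causal u \<Longrightarrow> 0 < h \<Longrightarrow> 0 < k \<Longrightarrow> prim (mol h k u) = mol h (Suc k) u"
  unfolding mol_def by (simp add: prim_dq_pow ccont_prim_pow_causal)

lemma sconv_mol:
  "real_kernel \<mu> \<Longrightarrow> causal u \<Longrightarrow> 0 < h \<Longrightarrow> 0 < k \<Longrightarrow>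
    sconv \<mu> (mol h k u) = (dq h ^^ 4) (sconv \<mu> ((prim ^^ k) u))"
  unfolding mol_def by (intro sconv_dq_pow ccont_prim_pow_causal)

lemma mol_eq_steklov: "causal u \<Longrightarrow> 0 < h \<Longrightarrow> mol h 4 u = (steklov h ^^ 4) u"
  by (simp only: mol_def steklov_pow)

lemma mol_bounded_linear:
  "bounded_linear L \<Longrightarrow> causal u \<Longrightarrow> mol h k (\<lambda>s. L (u s)) t = L (mol h k u t)"
  unfolding mol_def by (simp only: prim_pow_bounded_linear dq_pow_linear bounded_linear.linear)

lemma prim_pow_diff:
  assumes "causal u" "causal v"
  shows "(prim ^^ n) (\<lambda>s. u s - v s) = (\<lambda>t. (prim ^^ n) u t - (prim ^^ n) v t)"
  by (induction n) (auto simp: prim_diff causal_prim_pow assms)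

lemma mol_diff:
  "causal u \<Longrightarrow> causal v \<Longrightarrow> mol h k (\<lambda>s. u s - v s) t = mol h k u t - mol h k v t"
  unfolding mol_def by (simp only: prim_pow_diff dq_pow_diff)

lemma dq_pow_cong:
  assumes "0 < h" "\<And>s. s < T \<Longrightarrow> u s = v s" "t < T" shows "(dq h ^^ n) u t = (dq h ^^ n) v t"
  using dq_pow_zero[of h T "\<lambda>s. u s - v s" t n] assms by (simp add: dq_pow_diff)

lemma mol_cong_AE:
  assumes "causal u" "causal v" "AE s in time_measure T. u s = v s" "0 < h" "0 < k" "t < T"
  shows "mol h k u t = mol h k v t"
  unfolding mol_def by (intro dq_pow_cong[OF assms(4) _ assms(6)] prim_pow_cong_AE[OF assms(1-3,5)])

lemma norm_mol_4_le:
  assumes "causal u" "0 < h" "AE s in lborel. norm (u s) \<le> B"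
  shows "norm (mol h 4 u t) \<le> B"
  unfolding mol_eq_steklov[OF assms(1,2)]
  by (rule norm_steklov_pow_le[OF assms(1,2) _ _ order_refl]) (use assms(3) in \<open>auto elim: eventually_mono\<close>)

text \<open>\<open>mol h 3 unit_step\<close> is the difference quotient of a threefold average of a
  nondecreasing function, hence nonnegative. Its primitive is a fourfold average of values in the
  unit interval, so its mass is at most 1 whatever \<open>h\<close> is.\<close>

lemma mol_unit_step:
  assumes "0 < h"
  shows "0 \<le> mol h 3 unit_step t" and "0 \<le> mol h 4 unit_step t" and "mol h 4 unit_step t \<le> 1"
proof -
  have mono: "unit_step s \<le> unit_step r" if "s \<le> r" for s r
    using that by (auto simp: unit_step_def indicator_def)
  have "mol h 3 unit_step = dq h ((steklov h ^^ 3) unit_step)"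
    unfolding mol_def steklov_pow[OF causal_unit_step assms] by (simp add: numeral_eq_Suc)
  moreover have "(steklov h ^^ 3) unit_step (t - h) \<le> (steklov h ^^ 3) unit_step t"
    by (rule steklov_mono_mono[OF causal_unit_step assms mono]) (use assms in auto)
  ultimately show "0 \<le> mol h 3 unit_step t" using assms by (simp add: dq_def)
  show "0 \<le> mol h 4 unit_step t"
    unfolding mol_eq_steklov[OF causal_unit_step assms]
    by (rule steklov_nonneg[OF causal_unit_step assms]) (simp add: unit_step_def)
  have "norm (mol h 4 unit_step t) \<le> 1"
    by (rule norm_mol_4_le[OF causal_unit_step assms]) (auto simp: unit_step_def indicator_def)
  then show "mol h 4 unit_step t \<le> 1" by simp
qed

text \<open>Difference quotients pass through sums, convolutions and pairings with fixed vectors,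
  and backward quotients of a function that vanishes before T vanish before T.\<close>

lemma mollified_identity:
  assumes id: "relaxation_identity \<Omega> T \<mu> \<nu> A m \<beta> \<gamma> D f \<psi>\<^sub>2 \<zeta> \<phi>"
    and \<mu>: "real_kernel \<mu>" and \<nu>: "real_kernel \<nu>" and \<phi>: "causal \<phi>" and h: "0 < h"
    and n: "0 < n" and t: "t < T" and \<xi>: "\<xi> \<in> H01 \<Omega>"
  shows "(A *\<^sub>R sconv \<mu> (mol h n (\<lambda>s. fst (\<phi> s))) t + m *\<^sub>R mol h (Suc n) (\<lambda>s. fst (\<phi> s)) t
      + A *\<^sub>R (mol h (n + 2) unit_step t *\<^sub>R \<psi>\<^sub>2) - mol h (n + 3) f t) \<bullet> fst \<xi>
    + (\<beta> *\<^sub>R (mol h (n + 3) (\<lambda>s. snd (\<phi> s)) t + mol h (n + 3) unit_step t *\<^sub>R \<zeta>)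
      + (A * \<gamma>) *\<^sub>R sconv \<mu> (mol h (n + 2) (\<lambda>s. snd (\<phi> s))) t
      + D *\<^sub>R sconv \<nu> (mol h (Suc n) (\<lambda>s. snd (\<phi> s))) t) \<bullet> snd \<xi> = 0"
proof -
  have c: "causal (\<lambda>s. fst (\<phi> s))" "causal (\<lambda>s. snd (\<phi> s))"
    using \<phi> by (auto intro: causal_bounded_linear bounded_linear_fst bounded_linear_snd)
  have p: "0 < n + 2" "0 < Suc n" by auto
  note lin = dq_pow_linear[OF bounded_linear.linear[OF bounded_linear_scaleR_right]]
    dq_pow_linear[OF bounded_linear.linear[OF bounded_linear_scaleR_left]]
    dq_pow_linear[OF bounded_linear.linear[OF bounded_linear_inner_left]] dq_pow_add dq_pow_diff
  have "(dq h ^^ 4) (relaxation_residual \<mu> \<nu> A m \<beta> \<gamma> D f \<psi>\<^sub>2 \<zeta> \<phi> n \<xi>) t = 0"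
    by (rule dq_pow_zero[OF h _ t]) (use id n \<xi> in \<open>unfold relaxation_identity_def, blast\<close>)
  then show ?thesis
    unfolding relaxation_residual_def[abs_def] sconv_mol[OF \<mu> c(1) h n] sconv_mol[OF \<mu> c(2) h p(1)] sconv_mol[OF \<nu> c(2) h p(2)]
    unfolding mol_def by (simp only: lin)
qed

section \<open>Testing with averages through orthogonality\<close>

lemma prim_pow_AE_zero:
  assumes "causal u" "AE s in lborel. u s = 0" "0 < n" shows "(prim ^^ n) u t = 0"
proof -
  have "prim u s = prim (\<lambda>_. 0) s" for s
    by (rule prim_cong_AE[OF assms(1) causal_0]) (use assms(2) in \<open>auto elim: eventually_mono\<close>)
  then have *: "prim u s = 0" for s by (simp add: prim_def set_lebesgue_integral_def)
  have "(prim ^^ k) u t = 0" if "0 < k" for k t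
    using that
  proof (induction k arbitrary: t)
    case (Suc k)
    show ?case
    proof (cases "k = 0")
      case False
      then have "(prim ^^ k) u = (\<lambda>_. 0)" using Suc by auto
      then have "(prim ^^ Suc k) u t = prim (\<lambda>_. 0) t" by simp
      then show ?thesis by (simp add: prim_def[of "\<lambda>_. 0"] set_lebesgue_integral_def)
    qed (simp add: *)
  qed simp
  then show ?thesis using assms(3) .
qed

text \<open>The component of \<phi> along the fixed vector \<open>x\<close> is null, and primitives,
  quotients and convolutions act on it as on a scalar function. With \<open>x\<close> a residual
  orthogonal to H_0^1, this justifies testing with averages of the solution.\<close>

lemma mol_orthogonal:
  fixes \<phi> :: "real \<Rightarrow> 'h::{real_inner,banach,second_countable_topology}"
  assumes \<phi>: "causal \<phi>" and orth: "AE s in lborel. \<phi> s \<bullet> x = 0" and h: "0 < h" and k: "0 < k"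
  shows "mol h k \<phi> t \<bullet> x = 0"
    and "real_kernel \<mu> \<Longrightarrow> sconv \<mu> (mol h k \<phi>) t \<bullet> x = 0"
proof -
  note c = causal_bounded_linear[OF bounded_linear_inner_left \<phi>, of x]
  have "(dq h ^^ 4) ((prim ^^ k) (\<lambda>s. \<phi> s \<bullet> x)) t = 0" for t
    by (rule dq_pow_zero[OF h, of "t + 1"]) (simp_all add: prim_pow_AE_zero[OF c orth k])
  then show *: "mol h k \<phi> t \<bullet> x = 0" for t
    using mol_bounded_linear[OF bounded_linear_inner_left \<phi>, of h k x t] by (simp add: mol_def)
  show "sconv \<mu> (mol h k \<phi>) t \<bullet> x = 0" if \<mu>: "real_kernel \<mu>"
    using sconv_bounded_linear[OF bounded_linear_inner_left \<mu> ccont_mol[OF \<phi> h k], of x t]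
    by (simp add: * sconv_def mconv_def)
qed

text \<open>The dissipation hypothesis of \<open>energy_bound\<close> in isolation. In the
  application \<open>e\<close> is c^2 - c^2 \<bb> / \<alpha>, the coefficient left over once a
  multiple of \<open>q\<close> is split off, and \<kappa> has to be independent of \<open>A\<close>
  for uniform bounds.\<close>

definition dissipative :: "real \<Rightarrow> real_measure \<Rightarrow> real_measure \<Rightarrow> real \<Rightarrow> real \<Rightarrow> real \<Rightarrow> real \<Rightarrow> real \<Rightarrow>
    'g::{real_inner,banach,second_countable_topology} itself \<Rightarrow> bool"
  where "dissipative T \<mu> \<nu> A \<alpha> \<kappa> e D TYPE('g) \<longleftrightarrow>
    (\<forall>w :: real \<Rightarrow> 'g. \<forall>t. ccont w \<longrightarrow> 0 \<le> t \<longrightarrow> t < T \<longrightarrow>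
      \<kappa> / 2 * (norm (A *\<^sub>R sconv \<mu> (prim w) t))\<^sup>2
      \<le> prim (\<lambda>s. ((A * e) *\<^sub>R sconv \<mu> (prim w) s + D *\<^sub>R sconv \<nu> w s) \<bullet> (\<alpha> *\<^sub>R prim w s + A *\<^sub>R sconv \<mu> w s)) t)"

text \<open>\<open>energy_bound\<close> applied to the first three derivatives of the averages. The
  constants contain neither \<open>h\<close> nor \<open>A\<close>; the condition
  \<open>A \<le> 1\<close> absorbs the factor in front of \<open>\<psi>\<^sub>2\<close>.\<close>

lemma uniform_bound:
  fixes \<phi> :: "real \<Rightarrow> 'a::euclidean_space H1"
  defines "N \<equiv> \<lambda>Fb \<psi>\<^sub>2 \<zeta> \<alpha> \<beta>. sqrt 2 * (Fb + norm (\<psi>\<^sub>2 :: ('a, real) L2)) + 2 * norm (\<beta> *\<^sub>R (\<zeta> :: ('a, 'a) L2)) * sqrt (2 * \<alpha> / \<beta>)"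
  assumes id: "relaxation_identity \<Omega> T \<mu> \<nu> A m \<beta> \<gamma> D f \<psi>\<^sub>2 \<zeta> \<phi>"
    and \<mu>: "real_kernel \<mu>" "conv_pos \<mu> T" and \<nu>: "real_kernel \<nu>"
    and \<phi>: "causal \<phi>" and f: "causal f" and h: "0 < h"
    and orth: "\<And>x. (\<And>\<xi>. \<xi> \<in> H01 \<Omega> \<Longrightarrow> \<xi> \<bullet> x = 0) \<Longrightarrow> AE s in lborel. \<phi> s \<bullet> x = 0"
    and const: "0 \<le> A" "A \<le> 1" "0 < \<alpha>" "\<alpha> < m" "0 < \<beta>" "0 \<le> Fb" "0 < \<kappa>"
    and Fb: "\<And>t. t < T \<Longrightarrow> prim (\<lambda>s. norm (f s)) t \<le> Fb"
    and dissip: "dissipative T \<mu> \<nu> A \<alpha> \<kappa> (\<gamma> - \<beta> / \<alpha>) D TYPE(('a, 'a) L2)"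
    and t: "t < T"
  shows "norm (mol h 3 (\<lambda>s. fst (\<phi> s)) t) \<le> N Fb \<psi>\<^sub>2 \<zeta> \<alpha> \<beta> * sqrt (2 / ((m - \<alpha>) * \<alpha>))"
    and "norm (mol h 4 (\<lambda>s. snd (\<phi> s)) t) \<le> N Fb \<psi>\<^sub>2 \<zeta> \<alpha> \<beta> * (sqrt (2 * \<alpha> / \<beta>) + sqrt (2 / \<kappa>)) / \<alpha>"
proof -
  define Q where "Q = N Fb \<psi>\<^sub>2 \<zeta> \<alpha> \<beta>"
  have Q0: "0 \<le> Q" unfolding Q_def N_def using const by simp
  define y where "y = mol h 1 (\<lambda>s. fst (\<phi> s))"
  define z where "z = mol h 1 (\<lambda>s. snd (\<phi> s))"
  define \<eta> where "\<eta> = mol h 3 unit_step"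
  define F where "F t = mol h 4 f t - A *\<^sub>R (\<eta> t *\<^sub>R \<psi>\<^sub>2)" for t
  define X where "X t = (A * (\<gamma> - \<beta> / \<alpha>)) *\<^sub>R sconv \<mu> (prim (prim z)) t + D *\<^sub>R sconv \<nu> (prim z) t" for t
  have c: "causal (\<lambda>s. fst (\<phi> s))" "causal (\<lambda>s. snd (\<phi> s))"
    using \<phi> by (auto intro: causal_bounded_linear bounded_linear_fst bounded_linear_snd)
  have cy: "ccont y" and cz: "ccont z" and c\<eta>: "ccont \<eta>"
    unfolding y_def z_def \<eta>_def by (auto intro!: ccont_mol c h causal_unit_step)
  have py: "prim y = mol h 2 (\<lambda>s. fst (\<phi> s))" "prim (prim y) = mol h 3 (\<lambda>s. fst (\<phi> s))"
    and pz: "prim z = mol h 2 (\<lambda>s. snd (\<phi> s))" "prim (prim z) = mol h 3 (\<lambda>s. snd (\<phi> s))"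
      "prim (prim (prim z)) = mol h 4 (\<lambda>s. snd (\<phi> s))"
    and p\<eta>: "prim \<eta> = mol h 4 unit_step"
    unfolding y_def z_def \<eta>_def by (simp_all add: prim_mol c h causal_unit_step numeral_eq_Suc)
  have cf: "ccont (mol h 4 f)" by (intro ccont_mol f h) simp
  have cF: "ccont F"
    unfolding F_def[abs_def]
    by (intro ccont_diff cf ccont_scaleR ccont_bounded_linear[OF bounded_linear_scaleR_left] c\<eta>)
  have cpz: "ccont (prim z)" "ccont (prim (prim z))" using cz by (auto intro: ccont_prim ccont_causal)
  have cX: "ccont X" unfolding X_def[abs_def] by (intro ccont_add ccont_scaleR ccont_sconv \<mu> \<nu> cpz)
  have F_le: "prim (\<lambda>s. norm (F s)) s \<le> Fb + norm \<psi>\<^sub>2" if "s < T" for s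
  proof -
    note cn = causal_norm[OF f]
    have st: "causal ((steklov h ^^ 4) (\<lambda>s. norm (f s)))" by (rule causal_steklov_pow[OF cn h])
    have c\<psi>: "causal (\<lambda>r. norm \<psi>\<^sub>2 * \<eta> r)" by (intro ccont_causal ccont_cmult c\<eta>)
    have "prim (\<lambda>s. norm (F s)) s \<le> prim (\<lambda>r. (steklov h ^^ 4) (\<lambda>s. norm (f s)) r + norm \<psi>\<^sub>2 * \<eta> r) s"
    proof (rule prim_mono)
      fix r
      have "norm (F r) \<le> norm (mol h 4 f r) + norm (A *\<^sub>R (\<eta> r *\<^sub>R \<psi>\<^sub>2))"
        unfolding F_def by (rule norm_triangle_ineq4)
      moreover have "norm (mol h 4 f r) \<le> (steklov h ^^ 4) (\<lambda>s. norm (f s)) r"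
        unfolding mol_eq_steklov[OF f h] by (rule norm_steklov_pow[OF f h])
      moreover have "norm (A *\<^sub>R (\<eta> r *\<^sub>R \<psi>\<^sub>2)) \<le> 1 * (norm \<psi>\<^sub>2 * \<eta> r)"
        using const mol_unit_step(1)[OF h, of r] mult_right_mono[of A 1 "norm \<psi>\<^sub>2 * \<eta> r"]
        by (simp add: \<eta>_def ac_simps)
      ultimately show "norm (F r) \<le> (steklov h ^^ 4) (\<lambda>s. norm (f s)) r + norm \<psi>\<^sub>2 * \<eta> r" by linarith
    qed (intro causal_norm[OF ccont_causal[OF cF]] causal_add st c\<psi>)+
    also have "\<dots> = prim ((steklov h ^^ 4) (\<lambda>s. norm (f s))) s + norm \<psi>\<^sub>2 * prim \<eta> s"
      by (simp add: prim_add[OF st c\<psi>] prim_cmult)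
    also have "prim ((steklov h ^^ 4) (\<lambda>s. norm (f s))) s \<le> prim (\<lambda>s. norm (f s)) s"
      by (rule prim_steklov_pow_le[OF cn h]) simp
    also have "\<dots> \<le> Fb" by (rule Fb[OF that])
    also have "norm \<psi>\<^sub>2 * prim \<eta> s \<le> norm \<psi>\<^sub>2 * 1"
      unfolding p\<eta> by (intro mult_left_mono mol_unit_step h) auto
    finally show ?thesis by simp
  qed
  have eq: "(A *\<^sub>R sconv \<mu> y s + m *\<^sub>R prim y s - F s) \<bullet> (\<alpha> *\<^sub>R prim (prim y) s + A *\<^sub>R sconv \<mu> (prim y) s)
      + ((\<beta> / \<alpha>) *\<^sub>R (\<alpha> *\<^sub>R prim (prim (prim z)) s + A *\<^sub>R sconv \<mu> (prim (prim z)) s) + X s + prim \<eta> s *\<^sub>R (\<beta> *\<^sub>R \<zeta>))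
        \<bullet> (\<alpha> *\<^sub>R prim (prim z) s + A *\<^sub>R sconv \<mu> (prim z) s) = 0" (is "?g1 \<bullet> ?p + ?g2 \<bullet> ?q = 0")
    if s: "s < T" for s
  proof -
    have one: "(0::nat) < 1" by simp
    \<comment> \<open>The multiple \<beta> / \<alpha> of \<open>q\<close> brings in a convolution
      with coefficient \<open>A * \<beta> / \<alpha>\<close>; the coefficient
      \<open>\<gamma> - \<beta> / \<alpha>\<close> in \<open>X\<close> restores the original
      \<open>A * \<gamma>\<close>.\<close>
    have g2: "?g2 = \<beta> *\<^sub>R (mol h 4 (\<lambda>s. snd (\<phi> s)) s + mol h 4 unit_step s *\<^sub>R \<zeta>)
      + (A * \<gamma>) *\<^sub>R sconv \<mu> (mol h 3 (\<lambda>s. snd (\<phi> s))) s + D *\<^sub>R sconv \<nu> (mol h 2 (\<lambda>s. snd (\<phi> s))) s"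
      unfolding X_def pz(3) p\<eta> unfolding pz(2) unfolding pz(1) using const(3) by (simp add: algebra_simps)
    have g1: "?g1 = A *\<^sub>R sconv \<mu> (mol h 1 (\<lambda>s. fst (\<phi> s))) s + m *\<^sub>R mol h 2 (\<lambda>s. fst (\<phi> s)) s
      + A *\<^sub>R (mol h 3 unit_step s *\<^sub>R \<psi>\<^sub>2) - mol h 4 f s"
      unfolding F_def py \<eta>_def y_def[symmetric] by (simp add: algebra_simps)
    \<comment> \<open>With the time \<open>s\<close> frozen, the identity for n = 1 says that the
      residual pair is a vector orthogonal to H_0^1.\<close>
    have "\<xi> \<bullet> (?g1, ?g2) = 0" if "\<xi> \<in> H01 \<Omega>" for \<xi>
      using mollified_identity[OF id \<mu>(1) \<nu> \<phi> h one s that]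
      unfolding g1 g2 by (simp add: inner_prod_def inner_commute numeral_eq_Suc)
    note o = mol_orthogonal[OF \<phi> orth[OF this] h]
    have "mol h 3 \<phi> s \<bullet> (?g1, ?g2) = 0" by (rule o(1)) simp_all
    moreover have "sconv \<mu> (mol h 2 \<phi>) s \<bullet> (?g1, ?g2) = 0" by (rule o(2)) (simp_all add: \<mu>(1))
    ultimately have "(\<alpha> *\<^sub>R mol h 3 \<phi> s + A *\<^sub>R sconv \<mu> (mol h 2 \<phi>) s) \<bullet> (?g1, ?g2) = 0"
      by (simp only: inner_add_left inner_scaleR_left mult_zero_right add_0)
    moreover have "\<alpha> *\<^sub>R mol h 3 \<phi> s + A *\<^sub>R sconv \<mu> (mol h 2 \<phi>) s = (?p, ?q)"
    proof (rule prod_eqI)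
      have cm: "ccont (mol h 2 \<phi>)" by (intro ccont_mol \<phi> h) simp
      show "fst (\<alpha> *\<^sub>R mol h 3 \<phi> s + A *\<^sub>R sconv \<mu> (mol h 2 \<phi>) s) = fst (?p, ?q)"
        unfolding py(2) unfolding py(1)
        by (simp add: mol_bounded_linear[OF bounded_linear_fst \<phi>, abs_def]
            sconv_bounded_linear[OF bounded_linear_fst \<mu>(1) cm])
      show "snd (\<alpha> *\<^sub>R mol h 3 \<phi> s + A *\<^sub>R sconv \<mu> (mol h 2 \<phi>) s) = snd (?p, ?q)"
        unfolding pz(2) unfolding pz(1)
        by (simp add: mol_bounded_linear[OF bounded_linear_snd \<phi>, abs_def]
            sconv_bounded_linear[OF bounded_linear_snd \<mu>(1) cm])
    qed
    ultimately show ?thesis by (simp add: inner_prod_def inner_commute)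
  qed
  have bound: "(m - \<alpha>) * \<alpha> / 2 * (norm (prim (prim y) t))\<^sup>2
      + \<beta> / (2 * \<alpha>) * (norm (\<alpha> *\<^sub>R prim (prim (prim z)) t + A *\<^sub>R sconv \<mu> (prim (prim z)) t))\<^sup>2
      + \<kappa> / 2 * (norm (A *\<^sub>R sconv \<mu> (prim (prim z)) t))\<^sup>2 \<le> Q\<^sup>2" if "0 \<le> t"
    unfolding Q_def N_def
  proof (rule energy_bound[OF \<mu> cy cz cF cX c\<eta> const(1,3,4,5) _ _ F_le _ _ _ eq that t])
    show "0 \<le> Fb + norm \<psi>\<^sub>2" "0 \<le> \<kappa>" using const by auto
    show "0 \<le> \<eta> s" for s unfolding \<eta>_def by (rule mol_unit_step(1)[OF h])
    show "prim \<eta> s \<le> 1" for s unfolding p\<eta> by (rule mol_unit_step(3)[OF h])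
    show "\<kappa> / 2 * (norm (A *\<^sub>R sconv \<mu> (prim (prim z)) s))\<^sup>2
      \<le> prim (\<lambda>s. X s \<bullet> (\<alpha> *\<^sub>R prim (prim z) s + A *\<^sub>R sconv \<mu> (prim z) s)) s" if "0 \<le> s" "s < T" for s
      using dissip cpz(1) that unfolding dissipative_def X_def by blast
  qed
  have sq: "norm x \<le> Q * sqrt (1 / k)" if "k * (norm x)\<^sup>2 \<le> Q\<^sup>2" "0 < k" for x :: "'v::real_normed_vector" and k
  proof -
    have "(norm x)\<^sup>2 \<le> Q\<^sup>2 * (1 / k)" using that by (simp add: field_simps)
    then have "norm x \<le> sqrt (Q\<^sup>2 * (1 / k))" by (rule real_le_rsqrt)
    then show ?thesis using Q0 by (simp only: real_sqrt_mult real_sqrt_abs abs_of_nonneg)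
  qed
  have "norm (prim (prim y) t) \<le> Q * sqrt (2 / ((m - \<alpha>) * \<alpha>))
    \<and> norm (prim (prim (prim z)) t) \<le> Q * (sqrt (2 * \<alpha> / \<beta>) + sqrt (2 / \<kappa>)) / \<alpha>"
  proof (cases "0 \<le> t")
    case True
    note b = bound[OF True]
    let ?q = "\<alpha> *\<^sub>R prim (prim (prim z)) t + A *\<^sub>R sconv \<mu> (prim (prim z)) t"
    let ?r = "A *\<^sub>R sconv \<mu> (prim (prim z)) t"
    have nn: "0 \<le> (m - \<alpha>) * \<alpha> / 2 * (norm (prim (prim y) t))\<^sup>2" "0 \<le> \<beta> / (2 * \<alpha>) * (norm ?q)\<^sup>2"
      "0 \<le> \<kappa> / 2 * (norm ?r)\<^sup>2" using const by auto
    have k: "0 < (m - \<alpha>) * \<alpha> / 2" "0 < \<beta> / (2 * \<alpha>)" "0 < \<kappa> / 2" using const by auto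
    have "norm (prim (prim y) t) \<le> Q * sqrt (1 / ((m - \<alpha>) * \<alpha> / 2))"
      by (rule sq[OF _ k(1)]) (use b nn in linarith)
    moreover have q: "norm ?q \<le> Q * sqrt (1 / (\<beta> / (2 * \<alpha>)))"
      by (rule sq[OF _ k(2)]) (use b nn in linarith)
    moreover have r: "norm ?r \<le> Q * sqrt (1 / (\<kappa> / 2))"
      by (rule sq[OF _ k(3)]) (use b nn in linarith)
    \<comment> \<open>The gradient is recovered as the difference of \<open>q\<close>, bounded by
      the energy, and the convolution, bounded by the dissipation.\<close>
    moreover have "\<alpha> * norm (prim (prim (prim z)) t) \<le> norm ?q + norm ?r"
    proof -
      have "\<alpha> * norm (prim (prim (prim z)) t) = norm (\<alpha> *\<^sub>R prim (prim (prim z)) t)" using const by simp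
      also have "\<dots> = norm (?q - ?r)" by simp
      also have "\<dots> \<le> norm ?q + norm ?r" by (rule norm_triangle_ineq4)
      finally show ?thesis .
    qed
    ultimately show ?thesis using const(3)
      by (simp add: le_divide_eq mult.commute distrib_left)
  next
    case False
    then show ?thesis
      using Q0 const by (simp add: prim_neg)
  qed
  then show "norm (mol h 3 (\<lambda>s. fst (\<phi> s)) t) \<le> N Fb \<psi>\<^sub>2 \<zeta> \<alpha> \<beta> * sqrt (2 / ((m - \<alpha>) * \<alpha>))"
    and "norm (mol h 4 (\<lambda>s. snd (\<phi> s)) t) \<le> N Fb \<psi>\<^sub>2 \<zeta> \<alpha> \<beta> * (sqrt (2 * \<alpha> / \<beta>) + sqrt (2 / \<kappa>)) / \<alpha>"
    unfolding py(2)[symmetric] pz(3)[symmetric] Q_def[symmetric] by simp_all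
qed

text \<open>The identities are used with n = 2, one primitive more than for the uniform bounds, so
  that the test function is the averaged difference itself. Subtraction removes the source and the
  initial gradient; the terms with \<open>A\<close> keep the \<tau>-solution alone.\<close>

lemma mollified_difference_bound:
  fixes \<phi> \<phi>\<^sub>0 :: "real \<Rightarrow> 'a::euclidean_space H1"
  assumes id: "relaxation_identity \<Omega> T \<mu> \<nu> A m \<beta> \<gamma> D f \<psi>\<^sub>2 \<zeta> \<phi>"
    and id0: "relaxation_identity \<Omega> T \<mu> \<nu> 0 m \<beta> \<gamma> D f \<psi>\<^sub>2 \<zeta> \<phi>\<^sub>0"
    and \<mu>: "real_kernel \<mu>" and \<nu>: "real_kernel \<nu>" "conv_deriv_pos \<nu> T"
    and \<phi>: "causal \<phi>" and \<phi>\<^sub>0: "causal \<phi>\<^sub>0" and h: "0 < h"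
    and orth: "\<And>x. (\<And>\<xi>. \<xi> \<in> H01 \<Omega> \<Longrightarrow> \<xi> \<bullet> x = 0) \<Longrightarrow> AE s in lborel. (\<phi> s - \<phi>\<^sub>0 s) \<bullet> x = 0"
    and const: "0 \<le> A" "0 < m" "0 \<le> \<beta>" "0 \<le> \<gamma>" "0 \<le> D" "0 \<le> C" "0 \<le> C\<^sub>0"
    and bounds: "\<And>t. t < T \<Longrightarrow> norm (mol h 3 (\<lambda>s. fst (\<phi> s)) t) \<le> C"
      "\<And>t. t < T \<Longrightarrow> norm (mol h 4 (\<lambda>s. snd (\<phi> s)) t) \<le> C"
      "\<And>t. t < T \<Longrightarrow> norm (mol h 3 (\<lambda>s. fst (\<phi>\<^sub>0 s)) t) \<le> C\<^sub>0"
      "\<And>t. t < T \<Longrightarrow> norm (mol h 4 (\<lambda>s. snd (\<phi>\<^sub>0 s)) t) \<le> C\<^sub>0"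
    and t: "0 \<le> t" "t < T"
  shows "m / 2 * (norm (mol h 4 (\<lambda>s. fst (\<phi> s) - fst (\<phi>\<^sub>0 s)) t))\<^sup>2
    \<le> A * (T * (norm \<psi>\<^sub>2 * (T * (C + C\<^sub>0)) + (\<gamma> + 2) * (total_mass \<mu> * (C + C\<^sub>0) * (C + C\<^sub>0))))"
proof -
  define \<rho> where "\<rho> s = \<phi> s - \<phi>\<^sub>0 s" for s
  have c\<rho>: "causal \<rho>" unfolding \<rho>_def[abs_def] by (intro causal_diff \<phi> \<phi>\<^sub>0)
  have c: "causal (\<lambda>s. fst (\<phi> s))" "causal (\<lambda>s. snd (\<phi> s))" "causal (\<lambda>s. fst (\<phi>\<^sub>0 s))" "causal (\<lambda>s. snd (\<phi>\<^sub>0 s))"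
    "causal (\<lambda>s. fst (\<rho> s))" "causal (\<lambda>s. snd (\<rho> s))"
    using \<phi> \<phi>\<^sub>0 c\<rho> by (auto intro: causal_bounded_linear bounded_linear_fst bounded_linear_snd)
  have m1: "mol h k (\<lambda>s. fst (\<rho> s)) s = mol h k (\<lambda>s. fst (\<phi> s)) s - mol h k (\<lambda>s. fst (\<phi>\<^sub>0 s)) s"
    and m2: "mol h k (\<lambda>s. snd (\<rho> s)) s = mol h k (\<lambda>s. snd (\<phi> s)) s - mol h k (\<lambda>s. snd (\<phi>\<^sub>0 s)) s" for k s
    using mol_diff[OF c(1,3), of h k s] mol_diff[OF c(2,4), of h k s] by (simp_all add: \<rho>_def)
  have pm: "prim (mol h 2 u) = mol h 3 u" "prim (mol h 3 u) = mol h 4 u" "prim (mol h 4 u) = mol h 5 u"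
    if "causal u" for u :: "real \<Rightarrow> 'z::{banach,second_countable_topology}"
    by (simp_all add: prim_mol[OF that h] numeral_eq_Suc)
  have cm: "ccont (mol h k u)" if "causal u" "0 < k" for u :: "real \<Rightarrow> 'z::{banach,second_countable_topology}" and k
    by (rule ccont_mol[OF that(1) h that(2)])
  have C': "x \<le> C \<Longrightarrow> x \<le> C + C\<^sub>0" for x using const by simp
  have eq: "(m *\<^sub>R mol h 3 (\<lambda>s. fst (\<rho> s)) s + A *\<^sub>R sconv \<mu> (mol h 2 (\<lambda>s. fst (\<phi> s))) s
        + (A * mol h 4 unit_step s) *\<^sub>R \<psi>\<^sub>2) \<bullet> prim (mol h 3 (\<lambda>s. fst (\<rho> s))) s
      + (\<beta> *\<^sub>R prim (prim (mol h 3 (\<lambda>s. snd (\<rho> s)))) s + (A * \<gamma>) *\<^sub>R sconv \<mu> (mol h 4 (\<lambda>s. snd (\<phi> s))) s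
        + D *\<^sub>R sconv \<nu> (mol h 3 (\<lambda>s. snd (\<rho> s))) s) \<bullet> prim (mol h 3 (\<lambda>s. snd (\<rho> s))) s = 0"
    (is "?g1 \<bullet> ?p + ?g2 \<bullet> ?q = 0") if s: "s < T" for s
  proof -
    have two: "(0::nat) < 2" by simp
    have sd: "sconv \<nu> (mol h 3 (\<lambda>s. snd (\<rho> s))) s = sconv \<nu> (mol h 3 (\<lambda>s. snd (\<phi> s))) s - sconv \<nu> (mol h 3 (\<lambda>s. snd (\<phi>\<^sub>0 s))) s"
      using sconv_diff[OF \<nu>(1) cm[OF c(2)] cm[OF c(4)], of 3 3 s] by (simp add: m2[abs_def])
    have "\<xi> \<bullet> (?g1, ?g2) = 0" if "\<xi> \<in> H01 \<Omega>" for \<xi>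
    proof -
      note i1 = mollified_identity[OF id \<mu> \<nu>(1) \<phi> h two s that]
      note i0 = mollified_identity[OF id0 \<mu> \<nu>(1) \<phi>\<^sub>0 h two s that]
      have "?g1 \<bullet> fst \<xi> + ?g2 \<bullet> snd \<xi> = 0"
        using i1 i0 unfolding sd pm[OF c(6)] m1 m2
        by (simp add: inner_add_left inner_diff_left algebra_simps eval_nat_numeral)
      then show ?thesis by (simp add: inner_prod_def inner_commute)
    qed
    note o = mol_orthogonal(1)[OF c\<rho> orth[OF this, folded \<rho>_def] h]
    have "mol h 4 \<rho> s \<bullet> (?g1, ?g2) = 0" by (rule o) simp_all
    moreover have "mol h 4 \<rho> s = (?p, ?q)"
      by (rule prod_eqI)
        (simp_all add: pm c mol_bounded_linear[OF bounded_linear_fst c\<rho>] mol_bounded_linear[OF bounded_linear_snd c\<rho>])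
    ultimately show ?thesis by (simp add: inner_prod_def inner_commute)
  qed
  have "m / 2 * (norm (prim (mol h 3 (\<lambda>s. fst (\<rho> s))) t))\<^sup>2
    \<le> A * (T * (norm \<psi>\<^sub>2 * (T * (C + C\<^sub>0)) + (\<gamma> + 2) * (total_mass \<mu> * (C + C\<^sub>0) * (C + C\<^sub>0))))"
  proof (rule difference_bound[OF \<mu> \<nu> cm[OF c(1)] cm[OF c(2)] cm[OF c(5)] cm[OF c(6)] cm[OF causal_unit_step] const(1-5) _ _ _ _ _ _ eq t])
    show "\<bar>mol h 4 unit_step s\<bar> \<le> 1" for s using mol_unit_step(2,3)[OF h, of s] by simp
    show "norm (mol h 3 (\<lambda>s. fst (\<rho> s)) s) \<le> C + C\<^sub>0" if "s < T" for s
      unfolding m1 using norm_triangle_ineq4 bounds(1)[OF that] bounds(3)[OF that] by (meson add_mono order_trans)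
    show "norm (prim (mol h 3 (\<lambda>s. snd (\<rho> s))) s) \<le> C + C\<^sub>0" if "s < T" for s
      unfolding pm[OF c(6)] m2 using norm_triangle_ineq4 bounds(2)[OF that] bounds(4)[OF that] by (meson add_mono order_trans)
  qed (use const bounds in \<open>auto simp: pm c intro!: C'\<close>)
  then show ?thesis unfolding pm(2)[OF c(5)] by (simp add: \<rho>_def)
qed

lemma Linf_norm_le:
  assumes "0 < T" "AE t in time_measure T. norm (u t) \<le> B" "0 \<le> B"
  shows "\<bar>Linf_norm T u\<bar> \<le> B"
proof (cases "(\<lambda>t. ereal (norm (u t))) \<in> borel_measurable (time_measure T)")
  case True
  have "esssup (time_measure T) (\<lambda>t. ereal (norm (u t))) \<le> ereal B"
    by (rule esssup_I[OF True]) (use assms(2) in simp)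
  moreover have "emeasure (time_measure T) (space (time_measure T)) \<noteq> 0"
    using assms(1) by (simp add: emeasure_restrict_space space_restrict_space)
  then have "esssup (time_measure T) (\<lambda>_. 0 :: ereal) = 0" by (rule esssup_const)
  then have "0 \<le> esssup (time_measure T) (\<lambda>t. ereal (norm (u t)))"
    using esssup_mono[of "\<lambda>_. 0 :: ereal" "time_measure T" "\<lambda>t. ereal (norm (u t))"] by auto
  ultimately show ?thesis
    unfolding Linf_norm_def
    by (cases "esssup (time_measure T) (\<lambda>t. ereal (norm (u t)))") auto
next
  case False
  \<comment> \<open>Without measurability the essential supremum is infinite and its real value is
    0.\<close>
  then show ?thesis using assms(3) by (simp add: Linf_norm_def esssup_non_measurable top_ereal_def)
qed

section \<open>Dissipation and the choice of parameters in the two cases\<close>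

text \<open>Convolutions commute, so k * w = r * (\<mu> * w), and testing with \<mu> * w is
  nonnegative by positivity of \<open>r\<close>. Testing with \<open>prim w\<close> is covered by
  \<open>conv_deriv_pos\<close>. The dissipation stems from the summand with \<open>e\<close>, which
  is nonnegative here, so that \<kappa> = \<open>e\<close>.\<close>

lemma dissipative_factor:
  assumes \<mu>: "real_kernel \<mu>" "conv_pos \<mu> T" and r: "integrable (time_measure T) r" "conv_pos (fkernel T r) T"
    and k: "integrable (time_measure T) k" "conv_deriv_pos (fkernel T k) T"
    and eq: "AE t in time_measure T. k t = conv_measure \<mu> r t"
    and const: "0 \<le> A" "0 \<le> \<alpha>" "0 \<le> e" "0 \<le> D"
  shows "dissipative T \<mu> (fkernel T k) A \<alpha> e e D TYPE('g::{real_inner,banach,second_countable_topology})"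
  unfolding dissipative_def
proof (intro allI impI)
  fix w :: "real \<Rightarrow> 'g" and t assume w: "ccont w" and t: "0 \<le> t" "t < T"
  note \<kappa> = real_kernel_fkernel[OF k(1)] and \<rho> = real_kernel_fkernel[OF r(1)]
  have c: "ccont (prim w)" "ccont (sconv \<mu> w)" "ccont (sconv \<mu> (prim w))" "ccont (sconv (fkernel T k) w)"
    using \<mu> w \<kappa> by (auto intro!: ccont_sconv ccont_prim ccont_causal)
  let ?q = "\<lambda>s. \<alpha> *\<^sub>R prim w s + A *\<^sub>R sconv \<mu> w s"
  have "prim (\<lambda>s. ((A * e) *\<^sub>R sconv \<mu> (prim w) s + D *\<^sub>R sconv (fkernel T k) w s) \<bullet> ?q s) t
    = prim (\<lambda>s. (A * e) * (sconv \<mu> (prim w) s \<bullet> ?q s) +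
        (D * (\<alpha> * (sconv (fkernel T k) w s \<bullet> prim w s)) + D * (A * (sconv (fkernel T k) w s \<bullet> sconv \<mu> w s)))) t"
    by (rule prim_cong) (simp add: inner_add_left inner_add_right algebra_simps)
  also have "\<dots> = (A * e) * prim (\<lambda>s. sconv \<mu> (prim w) s \<bullet> ?q s) t +
        (D * (\<alpha> * prim (\<lambda>s. sconv (fkernel T k) w s \<bullet> prim w s) t) + D * (A * prim (\<lambda>s. sconv (fkernel T k) w s \<bullet> sconv \<mu> w s) t))"
    by (subst prim_add prim_add; (intro ccont_causal ccont_add ccont_cmult ccont_mult_inner ccont_scaleR c)?)+
      (simp only: prim_cmult)
  also have "\<dots> \<ge> (A * e) * (A / 2 * (norm (sconv \<mu> (prim w) t))\<^sup>2) + (0 + 0)"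
  proof (intro add_mono mult_left_mono)
    show "A / 2 * (norm (sconv \<mu> (prim w) t))\<^sup>2 \<le> prim (\<lambda>s. sconv \<mu> (prim w) s \<bullet> ?q s) t"
      by (rule relaxation_dissipation[OF \<mu> w t const(2)])
    show "0 \<le> D * (\<alpha> * prim (\<lambda>s. sconv (fkernel T k) w s \<bullet> prim w s) t)"
      by (intro mult_nonneg_nonneg const conv_deriv_pos_inner[OF \<kappa> k(2) t(2) w])
    have "prim (\<lambda>s. sconv (fkernel T k) w s \<bullet> sconv \<mu> w s) t = prim (\<lambda>s. sconv (fkernel T r) (sconv \<mu> w) s \<bullet> sconv \<mu> w s) t"
    proof (rule prim_cong)
      fix s assume "0 \<le> s" "s \<le> t"
      then have "sconv (fkernel T k) w s = sconv \<mu> (sconv (fkernel T r) w) s"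
        using t by (intro sconv_factor[OF \<mu>(1) k(1) r(1) eq w]) simp
      then show "sconv (fkernel T k) w s \<bullet> sconv \<mu> w s = sconv (fkernel T r) (sconv \<mu> w) s \<bullet> sconv \<mu> w s"
        using sconv_commute[OF \<mu>(1) \<rho> w, of s] by simp
    qed
    then show "0 \<le> D * (A * prim (\<lambda>s. sconv (fkernel T k) w s \<bullet> sconv \<mu> w s) t)"
      using conv_pos_inner[OF \<rho> r(2) t(2) c(2)] const by simp
  qed (use const in auto)
  finally have "(A * e) * (A / 2 * (norm (sconv \<mu> (prim w) t))\<^sup>2) + (0 + 0)
    \<le> prim (\<lambda>s. ((A * e) *\<^sub>R sconv \<mu> (prim w) s + D *\<^sub>R sconv (fkernel T k) w s) \<bullet> ?q s) t" .
  moreover have "e / 2 * (norm (A *\<^sub>R sconv \<mu> (prim w) t))\<^sup>2 = (A * e) * (A / 2 * (norm (sconv \<mu> (prim w) t))\<^sup>2) + (0 + 0)"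
    by (simp add: power_mult_distrib power2_eq_square)
  ultimately show "e / 2 * (norm (A *\<^sub>R sconv \<mu> (prim w) t))\<^sup>2
    \<le> prim (\<lambda>s. ((A * e) *\<^sub>R sconv \<mu> (prim w) s + D *\<^sub>R sconv (fkernel T k) w s) \<bullet> ?q s) t"
    by (simp only:)
qed

text \<open>Now k * w = \<mu> * (prim w): both summands are multiples of one convolution and only
  the coefficient \<open>A * e + D\<close> counts. Thus \<open>e\<close> may be negative.\<close>

lemma dissipative_integral:
  assumes \<mu>: "real_kernel \<mu>" "conv_pos \<mu> T" and k: "integrable (time_measure T) k"
    and eq: "AE t in time_measure T. k t = conv_measure \<mu> (\<lambda>_. 1) t"
    and const: "0 \<le> A" "0 \<le> \<alpha>" "\<kappa> * A \<le> A * e + D" "0 \<le> A * e + D"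
  shows "dissipative T \<mu> (fkernel T k) A \<alpha> \<kappa> e D TYPE('g::{real_inner,banach,second_countable_topology})"
  unfolding dissipative_def
proof (intro allI impI)
  fix w :: "real \<Rightarrow> 'g" and t assume w: "ccont w" and t: "0 \<le> t" "t < T"
  let ?q = "\<lambda>s. \<alpha> *\<^sub>R prim w s + A *\<^sub>R sconv \<mu> w s"
  have "\<kappa> / 2 * (norm (A *\<^sub>R sconv \<mu> (prim w) t))\<^sup>2 = (\<kappa> * A) * (A / 2 * (norm (sconv \<mu> (prim w) t))\<^sup>2)"
    by (simp add: power_mult_distrib power2_eq_square)
  also have "\<dots> \<le> (A * e + D) * (A / 2 * (norm (sconv \<mu> (prim w) t))\<^sup>2)"
    using const by (intro mult_right_mono) auto
  also have "\<dots> \<le> (A * e + D) * prim (\<lambda>s. sconv \<mu> (prim w) s \<bullet> ?q s) t"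
    by (intro mult_left_mono relaxation_dissipation[OF \<mu> w t const(2)] const)
  also have "\<dots> = prim (\<lambda>s. (A * e + D) * (sconv \<mu> (prim w) s \<bullet> ?q s)) t" by (simp only: prim_cmult)
  also have "\<dots> = prim (\<lambda>s. ((A * e) *\<^sub>R sconv \<mu> (prim w) s + D *\<^sub>R sconv (fkernel T k) w s) \<bullet> ?q s) t"
  proof (rule prim_cong)
    fix s assume "0 \<le> s" "s \<le> t"
    then have "sconv (fkernel T k) w s = sconv \<mu> (prim w) s"
      using t by (intro sconv_factor_const[OF \<mu>(1) k eq w]) simp
    then show "(A * e + D) * (sconv \<mu> (prim w) s \<bullet> ?q s)
      = ((A * e) *\<^sub>R sconv \<mu> (prim w) s + D *\<^sub>R sconv (fkernel T k) w s) \<bullet> ?q s"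
      by (simp only: inner_add_left[of _ _ "?q s"] inner_scaleR_left distrib_right)
  qed
  finally show "\<kappa> / 2 * (norm (A *\<^sub>R sconv \<mu> (prim w) t))\<^sup>2
    \<le> prim (\<lambda>s. ((A * e) *\<^sub>R sconv \<mu> (prim w) s + D *\<^sub>R sconv (fkernel T k) w s) \<bullet> ?q s) t" .
qed

text \<open>\<sigma> is a continuous representative of the difference. Averages depend only on the
  class of the function, while those of \<sigma> converge at every time as the width tends to
  0.\<close>

lemma relaxation_error:
  fixes \<phi> \<phi>\<^sub>0 :: "real \<Rightarrow> 'a::euclidean_space H1" and \<sigma> :: "real \<Rightarrow> ('a, real) L2"
  assumes \<phi>: "causal \<phi>" and \<phi>\<^sub>0: "causal \<phi>\<^sub>0"
    and \<sigma>: "ccont \<sigma>" "AE s in time_measure T. fst (\<phi> s) - fst (\<phi>\<^sub>0 s) = \<sigma> s"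
    and bound: "\<And>h. 0 < h \<Longrightarrow> m / 2 * (norm (mol h 4 (\<lambda>s. fst (\<phi> s) - fst (\<phi>\<^sub>0 s)) t))\<^sup>2 \<le> K"
    and t: "t < T"
  shows "m / 2 * (norm (\<sigma> t))\<^sup>2 \<le> K"
proof (rule tendsto_upperbound)
  have c: "causal (\<lambda>s. fst (\<phi> s) - fst (\<phi>\<^sub>0 s))"
    by (intro causal_diff causal_bounded_linear[OF bounded_linear_fst] \<phi> \<phi>\<^sub>0)
  show "((\<lambda>h. m / 2 * (norm ((steklov h ^^ 4) \<sigma> t))\<^sup>2) \<longlongrightarrow> m / 2 * (norm (\<sigma> t))\<^sup>2) (at_right 0)"
    by (intro tendsto_intros steklov_pow_tendsto \<sigma>(1))
  show "\<forall>\<^sub>F h in at_right 0. m / 2 * (norm ((steklov h ^^ 4) \<sigma> t))\<^sup>2 \<le> K"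
    unfolding eventually_at_right_field
  proof (intro exI[of _ 1] conjI allI impI)
    fix h :: real assume h: "0 < h"
    have "mol h 4 (\<lambda>s. fst (\<phi> s) - fst (\<phi>\<^sub>0 s)) t = mol h 4 \<sigma> t"
      by (rule mol_cong_AE[OF c ccont_causal[OF \<sigma>(1)] \<sigma>(2) h _ t]) simp
    then show "m / 2 * (norm ((steklov h ^^ 4) \<sigma> t))\<^sup>2 \<le> K"
      using bound[OF h] by (simp only: mol_eq_steklov[OF ccont_causal[OF \<sigma>(1)] h])
  qed simp
qed simp

lemma trunc_difference_orthogonal:
  fixes \<psi> :: "real \<Rightarrow> 'a::euclidean_space H1"
  assumes "AE t in time_measure T. \<psi> t \<in> H01 \<Omega>" "\<psi>\<^sub>0 \<in> H01 \<Omega>" "\<And>\<xi>. \<xi> \<in> H01 \<Omega> \<Longrightarrow> \<xi> \<bullet> x = 0"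
  shows "AE s in lborel. trunc T (\<lambda>s. \<psi> s - \<psi>\<^sub>0) s \<bullet> x = 0"
proof (rule AE_trunc_lborel)
  show "AE t in time_measure T. (\<psi> t - \<psi>\<^sub>0) \<bullet> x = 0"
    using assms(1) by eventually_elim (simp add: inner_diff_left assms(2,3))
qed simp

text \<open>The subsequent proof of the rate needs the kernel assumptions only in this form. A
  single \<kappa> serves all \<open>A\<close> up to \<open>A\<^sub>0\<close>, as needed when
  \<open>A\<close> = \<tau>^a tends to 0.\<close>

lemma dissipative_parameters:
  fixes \<aa> \<bb> c D T :: real
  assumes c: "0 < c" and D: "0 < D"
    and cases: "(\<aa> > \<bb> \<and> \<bb> > 0 \<and>
          finite_real_measure T \<KK>\<^sub>1 \<and>
          (\<exists>\<rr>. kernel_factorization T \<rr> \<KK>\<^sub>1 \<KK>\<^sub>2 \<and> conv_nonneg (conv_fun \<rr>) T) \<and>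
          conv_nonneg (conv_measure \<KK>\<^sub>1) T \<and>
          (conv_deriv_bounded_below \<KK>\<^sub>2 T \<or> W11_deriv_nonneg \<KK>\<^sub>2 T))
       \<or> (\<aa> > 0 \<and> \<bb> > 0 \<and> kernel_factorization T (\<lambda>_. 1) \<KK>\<^sub>1 \<KK>\<^sub>2 \<and>
          finite_real_measure T \<KK>\<^sub>1 \<and> conv_nonneg (conv_measure \<KK>\<^sub>1) T)"
  obtains \<alpha> \<kappa> A\<^sub>0 where "real_kernel \<KK>\<^sub>1" "conv_pos \<KK>\<^sub>1 T" "integrable (time_measure T) \<KK>\<^sub>2"
    "conv_deriv_pos (fkernel T \<KK>\<^sub>2) T" "0 < \<bb>" "0 < \<alpha>" "\<alpha> < \<aa>" "0 < \<kappa>" "0 < A\<^sub>0" "A\<^sub>0 \<le> 1"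
    "\<forall>A. 0 \<le> A \<longrightarrow> A \<le> A\<^sub>0 \<longrightarrow>
      dissipative T \<KK>\<^sub>1 (fkernel T \<KK>\<^sub>2) A \<alpha> \<kappa> (c\<^sup>2 - c\<^sup>2 * \<bb> / \<alpha>) D TYPE('g::{real_inner,banach,second_countable_topology})"
proof (rule disjE[OF cases])
  assume "\<aa> > \<bb> \<and> \<bb> > 0 \<and>
          finite_real_measure T \<KK>\<^sub>1 \<and>
          (\<exists>\<rr>. kernel_factorization T \<rr> \<KK>\<^sub>1 \<KK>\<^sub>2 \<and> conv_nonneg (conv_fun \<rr>) T) \<and>
          conv_nonneg (conv_measure \<KK>\<^sub>1) T \<and>
          (conv_deriv_bounded_below \<KK>\<^sub>2 T \<or> W11_deriv_nonneg \<KK>\<^sub>2 T)"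
  then obtain \<rr> where ab: "\<aa> > \<bb>" "\<bb> > 0" and \<mu>: "finite_real_measure T \<KK>\<^sub>1" "conv_nonneg (conv_measure \<KK>\<^sub>1) T"
    and f: "kernel_factorization T \<rr> \<KK>\<^sub>1 \<KK>\<^sub>2" and r: "conv_nonneg (conv_fun \<rr>) T"
    and A5: "conv_deriv_bounded_below \<KK>\<^sub>2 T \<or> W11_deriv_nonneg \<KK>\<^sub>2 T"
    by blast
  have int: "integrable (time_measure T) \<rr>" "integrable (time_measure T) \<KK>\<^sub>2"
    and eq: "AE t in time_measure T. \<KK>\<^sub>2 t = conv_measure \<KK>\<^sub>1 \<rr> t"
    using f by (auto simp: kernel_factorization_def intro: Lp_space_1_integrable)
  note k = finite_real_measure_kernel[OF \<mu>(1)]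
  note p = conv_pos_conv_measure[OF k \<mu>(2)] conv_pos_conv_fun[OF int(1) r]
  have dp: "conv_deriv_pos (fkernel T \<KK>\<^sub>2) T"
    using A5 conv_deriv_pos_bounded_below[OF int(2)] conv_deriv_pos_W11 by blast
  \<comment> \<open>Being below \<aa> gives control of the velocity; being above \<bb> makes c^2 -
    c^2 \<bb> / \<alpha> positive. The midpoint is one choice that does both.\<close>
  define \<alpha> where "\<alpha> = (\<aa> + \<bb>) / 2"
  have \<alpha>: "\<bb> < \<alpha>" "\<alpha> < \<aa>" using ab by (auto simp: \<alpha>_def)
  have "c\<^sup>2 * \<bb> < c\<^sup>2 * \<alpha>" using \<alpha> c by simp
  then have e: "0 < c\<^sup>2 - c\<^sup>2 * \<bb> / \<alpha>" using \<alpha> ab by (simp add: field_simps)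
  show thesis
  proof (rule that[of \<alpha> "c\<^sup>2 - c\<^sup>2 * \<bb> / \<alpha>" 1])
    have "dissipative T \<KK>\<^sub>1 (fkernel T \<KK>\<^sub>2) A \<alpha> (c\<^sup>2 - c\<^sup>2 * \<bb> / \<alpha>) (c\<^sup>2 - c\<^sup>2 * \<bb> / \<alpha>) D TYPE('g)"
      if "0 \<le> A" for A
      using that \<alpha> ab e D by (intro dissipative_factor[OF k p(1) int(1) p(2) int(2) dp eq]) auto
    then show "\<forall>A. 0 \<le> A \<longrightarrow> A \<le> 1 \<longrightarrow> dissipative T \<KK>\<^sub>1 (fkernel T \<KK>\<^sub>2) A \<alpha> (c\<^sup>2 - c\<^sup>2 * \<bb> / \<alpha>) (c\<^sup>2 - c\<^sup>2 * \<bb> / \<alpha>) D TYPE('g)"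
      by blast
  qed (use k p int dp \<alpha> ab e in auto)
next
  assume "\<aa> > 0 \<and> \<bb> > 0 \<and> kernel_factorization T (\<lambda>_. 1) \<KK>\<^sub>1 \<KK>\<^sub>2 \<and>
          finite_real_measure T \<KK>\<^sub>1 \<and> conv_nonneg (conv_measure \<KK>\<^sub>1) T"
  then have ab: "\<aa> > 0" "\<bb> > 0" and \<mu>: "finite_real_measure T \<KK>\<^sub>1" "conv_nonneg (conv_measure \<KK>\<^sub>1) T"
    and f: "kernel_factorization T (\<lambda>_. 1) \<KK>\<^sub>1 \<KK>\<^sub>2"
    by blast+
  have int: "integrable (time_measure T) \<KK>\<^sub>2"
    and eq: "AE t in time_measure T. \<KK>\<^sub>2 t = conv_measure \<KK>\<^sub>1 (\<lambda>_. 1) t"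
    using f by (auto simp: kernel_factorization_def intro: Lp_space_1_integrable)
  note k = finite_real_measure_kernel[OF \<mu>(1)]
  note p = conv_pos_conv_measure[OF k \<mu>(2)]
  have dp: "conv_deriv_pos (fkernel T \<KK>\<^sub>2) T" by (rule conv_deriv_pos_factor[OF k p int eq])
  define e where "e = c\<^sup>2 - c\<^sup>2 * \<bb> / (\<aa> / 2)"
  \<comment> \<open>Chosen so that \<open>A * \<bar>e\<bar> \<le> D / 2\<close>, which leaves
    \<open>D / 2\<close> for the dissipation; together with \<open>A \<le> 1\<close> this permits
    \<kappa> = \<open>D / 2\<close>. The summand 1 keeps the denominator positive when
    \<open>e\<close> is 0.\<close>
  define A\<^sub>0 where "A\<^sub>0 = min 1 (D / (2 * (\<bar>e\<bar> + 1)))"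
  have A\<^sub>0: "0 < A\<^sub>0" "A\<^sub>0 \<le> 1" "A\<^sub>0 \<le> D / (2 * (\<bar>e\<bar> + 1))" using D by (auto simp: A\<^sub>0_def)
  have "dissipative T \<KK>\<^sub>1 (fkernel T \<KK>\<^sub>2) A (\<aa> / 2) (D / 2) (c\<^sup>2 - c\<^sup>2 * \<bb> / (\<aa> / 2)) D TYPE('g)"
    if A: "0 \<le> A" "A \<le> A\<^sub>0" for A
  proof -
    have "A * \<bar>e\<bar> \<le> D / (2 * (\<bar>e\<bar> + 1)) * (\<bar>e\<bar> + 1)"
      using A A\<^sub>0 D by (intro mult_mono) auto
    also have "\<dots> = D / 2" by (simp add: field_simps add_nonneg_eq_0_iff)
    finally have "\<bar>A * e\<bar> \<le> D / 2" using A by (simp add: abs_mult)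
    moreover have "D / 2 * A \<le> D / 2 * 1" using A A\<^sub>0 D by (intro mult_left_mono) auto
    ultimately have "D / 2 * A \<le> A * e + D" "0 \<le> A * e + D" using D by linarith+
    then show ?thesis
      unfolding e_def[symmetric] using A ab by (intro dissipative_integral[OF k p int eq]) auto
  qed
  then show thesis
    using k p int dp ab D A\<^sub>0 by (intro that[of "\<aa> / 2" "D / 2" A\<^sub>0]) auto
qed

theorem theorem2:
  fixes \<Omega> :: "'a::euclidean_space set"
    and T c \<delta> \<tau>\<^sub>\<theta> a b \<aa> \<bb> \<tau>bar :: real
    and \<KK>\<^sub>1 :: real_measure and \<KK>\<^sub>2 :: "real \<Rightarrow> real"
    and \<psi>\<^sub>0 :: "'a H1" and \<psi>\<^sub>2 :: "('a, real) L2" and f :: "real \<Rightarrow> ('a, real) L2"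
    and \<psi> :: "real \<Rightarrow> real \<Rightarrow> 'a H1" and \<psi>lim :: "real \<Rightarrow> 'a H1"
  assumes "bounded_lipschitz_domain \<Omega>"
    and "T > 0" "c > 0" "\<delta> > 0" "\<tau>\<^sub>\<theta> > 0" "a > 0" "\<tau>bar > 0"
    and "\<psi>\<^sub>0 \<in> H01 \<Omega>" "\<psi>\<^sub>2 \<in> L2_on \<Omega>" "f \<in> Lp_space 1 T (L2_on \<Omega>)"
    and "(\<aa> > \<bb> \<and> \<bb> > 0 \<and>
          finite_real_measure T \<KK>\<^sub>1 \<and> has_Lq_resolvent T \<KK>\<^sub>1 \<and>
          (\<exists>\<rr>. kernel_factorization T \<rr> \<KK>\<^sub>1 \<KK>\<^sub>2 \<and> conv_nonneg (conv_fun \<rr>) T) \<and>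
          conv_nonneg (conv_measure \<KK>\<^sub>1) T \<and>
          (conv_deriv_bounded_below \<KK>\<^sub>2 T \<or> W11_deriv_nonneg \<KK>\<^sub>2 T))
       \<or> (\<aa> > 0 \<and> \<bb> > 0 \<and>
          kernel_factorization T (\<lambda>_. 1) \<KK>\<^sub>1 \<KK>\<^sub>2 \<and>
          finite_real_measure T \<KK>\<^sub>1 \<and> has_Lq_resolvent T \<KK>\<^sub>1 \<and>
          conv_nonneg (conv_measure \<KK>\<^sub>1) T \<and>
          (\<exists>\<delta>low>0. \<forall>\<tau>\<in>{0<..\<tau>bar}. (\<aa> - \<bb>) / \<aa> * c\<^sup>2 * \<tau> powr a + \<delta> * \<tau>\<^sub>\<theta> powr b > \<delta>low))"
    and "\<forall>\<tau>\<in>{0<..\<tau>bar}. solves_P\<^sub>\<tau> \<Omega> T c \<delta> \<tau>\<^sub>\<theta> a b \<aa> \<bb> \<KK>\<^sub>1 \<KK>\<^sub>2 \<psi>\<^sub>0 \<psi>\<^sub>2 f \<tau> (\<psi> \<tau>)"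
    and "solves_P\<^sub>0 \<Omega> T c \<delta> \<tau>\<^sub>\<theta> b \<aa> \<bb> \<KK>\<^sub>2 \<psi>\<^sub>0 f \<psi>lim"
  shows "(\<lambda>\<tau>. Linf_norm T (\<lambda>t. fst (\<psi> \<tau> t) - fst (\<psi>lim t))) \<in> O[at_right 0](\<lambda>\<tau>. sqrt (\<tau> powr a))"
proof -
  define D where "D = \<tau>\<^sub>\<theta> powr b * \<delta>"
  have D: "0 < D" using assms(4,5) by (simp add: D_def)
  have cases: "(\<aa> > \<bb> \<and> \<bb> > 0 \<and>
          finite_real_measure T \<KK>\<^sub>1 \<and>
          (\<exists>\<rr>. kernel_factorization T \<rr> \<KK>\<^sub>1 \<KK>\<^sub>2 \<and> conv_nonneg (conv_fun \<rr>) T) \<and>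
          conv_nonneg (conv_measure \<KK>\<^sub>1) T \<and>
          (conv_deriv_bounded_below \<KK>\<^sub>2 T \<or> W11_deriv_nonneg \<KK>\<^sub>2 T))
       \<or> (\<aa> > 0 \<and> \<bb> > 0 \<and> kernel_factorization T (\<lambda>_. 1) \<KK>\<^sub>1 \<KK>\<^sub>2 \<and>
          finite_real_measure T \<KK>\<^sub>1 \<and> conv_nonneg (conv_measure \<KK>\<^sub>1) T)"
    using assms(11) by blast
  obtain \<alpha> \<kappa> A\<^sub>0 where \<mu>: "real_kernel \<KK>\<^sub>1" "conv_pos \<KK>\<^sub>1 T" and k2: "integrable (time_measure T) \<KK>\<^sub>2"
    and dp: "conv_deriv_pos (fkernel T \<KK>\<^sub>2) T" and const: "0 < \<bb>" "0 < \<alpha>" "\<alpha> < \<aa>" "0 < \<kappa>" "0 < A\<^sub>0" "A\<^sub>0 \<le> 1"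
    and dissip: "\<forall>A. 0 \<le> A \<longrightarrow> A \<le> A\<^sub>0 \<longrightarrow>
      dissipative T \<KK>\<^sub>1 (fkernel T \<KK>\<^sub>2) A \<alpha> \<kappa> (c\<^sup>2 - c\<^sup>2 * \<bb> / \<alpha>) D TYPE(('a, 'a) L2)"
    by (rule dissipative_parameters[OF assms(3) D cases, where 'g = "('a, 'a) L2"])
  define \<nu> where "\<nu> = fkernel T \<KK>\<^sub>2"
  have \<nu>: "real_kernel \<nu>" unfolding \<nu>_def by (rule real_kernel_fkernel[OF k2])
  have \<beta>: "0 < c\<^sup>2 * \<bb>" using assms(3) const(1) by simp
  have f: "integrable (time_measure T) f" by (rule Lp_space_1_integrable[OF assms(10)])
  note cf = causal_trunc[OF f]
  define Fb where "Fb = prim (\<lambda>s. norm (trunc T f s)) T"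
  have Fb: "prim (\<lambda>s. norm (trunc T f s)) t \<le> Fb" if "t < T" for t
    unfolding Fb_def using that by (intro prim_nonneg_mono causal_norm cf) auto
  have Fb0: "0 \<le> Fb" using Fb[of "-1"] assms(2) by (simp add: prim_neg)
  define \<phi>\<^sub>0 where "\<phi>\<^sub>0 = trunc T (\<lambda>s. \<psi>lim s - \<psi>\<^sub>0)"
  note P0 = solves_P\<^sub>0_identity[OF assms(13) \<mu>(1) k2 f, folded \<phi>\<^sub>0_def D_def \<nu>_def]
  obtain B where B: "0 \<le> B" "AE t in time_measure T. norm (\<psi>lim t) \<le> B" "integrable (time_measure T) \<psi>lim"
    "AE t in time_measure T. \<psi>lim t \<in> H01 \<Omega>"
    using Lp_space_infinity[OF P0(1)] by metis
  obtain \<psi>\<^sub>t where \<psi>\<^sub>t: "\<psi>\<^sub>t \<in> Lp_space \<infinity> T (L2_on \<Omega>)" "has_time_deriv T (\<lambda>t. fst (\<psi>lim t)) (fst \<psi>\<^sub>0) \<psi>\<^sub>t"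
    using P0(2) by blast
  obtain B\<^sub>t where B\<^sub>t: "0 \<le> B\<^sub>t" "AE t in time_measure T. norm (\<psi>\<^sub>t t) \<le> B\<^sub>t" "integrable (time_measure T) \<psi>\<^sub>t"
    using Lp_space_infinity[OF \<psi>\<^sub>t(1)] by metis
  have c\<phi>\<^sub>0: "causal \<phi>\<^sub>0" unfolding \<phi>\<^sub>0_def
    by (intro causal_trunc Bochner_Integration.integrable_diff B time_measure_const)
  have c\<phi>\<^sub>01: "causal (\<lambda>s. fst (\<phi>\<^sub>0 s))" by (rule causal_bounded_linear[OF bounded_linear_fst c\<phi>\<^sub>0])
  have c\<phi>\<^sub>02: "causal (\<lambda>s. snd (\<phi>\<^sub>0 s))" by (rule causal_bounded_linear[OF bounded_linear_snd c\<phi>\<^sub>0])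
  have \<phi>\<^sub>0_deriv: "AE t in time_measure T. fst (\<phi>\<^sub>0 t) = prim (trunc T \<psi>\<^sub>t) t"
    using has_time_deriv_prim[OF \<psi>\<^sub>t(2)] unfolding \<phi>\<^sub>0_def by eventually_elim simp
  \<comment> \<open>For the limit no energy estimate is made: its bounds are read off from the
    regularity contained in the notion of solution.\<close>
  define C\<^sub>0 where "C\<^sub>0 = max (B + norm \<psi>\<^sub>0) B\<^sub>t"
  have C\<^sub>0: "0 \<le> C\<^sub>0" unfolding C\<^sub>0_def using B(1) by (simp add: le_max_iff_disj)
  have lim_bound1: "norm (mol h 3 (\<lambda>s. fst (\<phi>\<^sub>0 s)) t) \<le> C\<^sub>0" if "0 < h" "t < T" for h t
  proof -
    have "mol h 3 (\<lambda>s. fst (\<phi>\<^sub>0 s)) t = mol h 3 (prim (trunc T \<psi>\<^sub>t)) t"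
      by (rule mol_cong_AE[OF c\<phi>\<^sub>01 causal_prim[OF causal_trunc[OF B\<^sub>t(3)]] \<phi>\<^sub>0_deriv that(1) _ that(2)]) simp
    also have "\<dots> = mol h 4 (trunc T \<psi>\<^sub>t) t"
      unfolding mol_def prim_pow_shift by (simp del: funpow.simps)
    also have "norm \<dots> \<le> B\<^sub>t"
      by (rule norm_mol_4_le[OF causal_trunc[OF B\<^sub>t(3)] that(1) AE_trunc_lborel[where P = "\<lambda>x. norm x \<le> B\<^sub>t", OF B\<^sub>t(2)]])
        (use B\<^sub>t in simp)
    finally show ?thesis by (simp add: C\<^sub>0_def)
  qed
  have lim_bound2: "norm (mol h 4 (\<lambda>s. snd (\<phi>\<^sub>0 s)) t) \<le> C\<^sub>0" if "0 < h" for h t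
  proof -
    have "AE s in time_measure T. norm (snd (\<psi>lim s - \<psi>\<^sub>0)) \<le> B + norm \<psi>\<^sub>0"
      using B(2)
    proof eventually_elim
      case (elim s)
      have "norm (snd (\<psi>lim s - \<psi>\<^sub>0)) \<le> norm (\<psi>lim s - \<psi>\<^sub>0)"
        using norm_snd_le[of "snd (\<psi>lim s - \<psi>\<^sub>0)" "fst (\<psi>lim s - \<psi>\<^sub>0)"] by (simp only: prod.collapse)
      also have "\<dots> \<le> norm (\<psi>lim s) + norm \<psi>\<^sub>0" by (rule norm_triangle_ineq4)
      finally show ?case using elim by simp
    qed
    then have "AE s in lborel. norm (snd (trunc T (\<lambda>s. \<psi>lim s - \<psi>\<^sub>0) s)) \<le> B + norm \<psi>\<^sub>0"
      by (rule AE_trunc_lborel) (use B(1) in simp)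
    then have "norm (mol h 4 (\<lambda>s. snd (\<phi>\<^sub>0 s)) t) \<le> B + norm \<psi>\<^sub>0"
      unfolding \<phi>\<^sub>0_def[symmetric] by (intro norm_mol_4_le c\<phi>\<^sub>02 that)
    then show ?thesis by (simp add: C\<^sub>0_def)
  qed
  define Q where "Q = sqrt 2 * (Fb + norm \<psi>\<^sub>2) + 2 * norm ((c\<^sup>2 * \<bb>) *\<^sub>R snd \<psi>\<^sub>0) * sqrt (2 * \<alpha> / (c\<^sup>2 * \<bb>))"
  define C where "C = max (Q * sqrt (2 / ((\<aa> - \<alpha>) * \<alpha>))) (Q * (sqrt (2 * \<alpha> / (c\<^sup>2 * \<bb>)) + sqrt (2 / \<kappa>)) / \<alpha>)"
  have "0 \<le> Q" unfolding Q_def using Fb0 const(2) \<beta> by simp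
  then have C: "0 \<le> C" unfolding C_def using const by (simp add: le_max_iff_disj)
  \<comment> \<open>The right-hand side of the difference estimate without the factor
    \<open>A\<close>; neither \<tau> nor the averaging width enters.\<close>
  define K where "K = T * (norm \<psi>\<^sub>2 * (T * (C + C\<^sub>0)) + (c\<^sup>2 + 2) * (total_mass \<KK>\<^sub>1 * (C + C\<^sub>0) * (C + C\<^sub>0)))"
  have K0: "0 \<le> K"
    unfolding K_def using assms(2) C C\<^sub>0 total_mass_nonneg[of \<KK>\<^sub>1] by (intro mult_nonneg_nonneg add_nonneg_nonneg) auto
  have m: "0 < \<aa>" using const by simp
  have estimate: "\<bar>Linf_norm T (\<lambda>t. fst (\<psi> \<tau> t) - fst (\<psi>lim t))\<bar> \<le> sqrt (2 * K / \<aa>) * sqrt (\<tau> powr a)"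
    if \<tau>: "0 < \<tau>" "\<tau> \<le> \<tau>bar" "\<tau> powr a \<le> A\<^sub>0" for \<tau>
  proof -
    have sol: "solves_P\<^sub>\<tau> \<Omega> T c \<delta> \<tau>\<^sub>\<theta> a b \<aa> \<bb> \<KK>\<^sub>1 \<KK>\<^sub>2 \<psi>\<^sub>0 \<psi>\<^sub>2 f \<tau> (\<psi> \<tau>)" using assms(12) \<tau> by auto
    define \<phi> where "\<phi> = trunc T (\<lambda>s. \<psi> \<tau> s - \<psi>\<^sub>0)"
    note P = solves_P\<^sub>\<tau>_identity[OF sol \<mu>(1) k2 f, folded \<phi>_def D_def \<nu>_def]
    have int: "integrable (time_measure T) (\<psi> \<tau>)" and H: "AE t in time_measure T. \<psi> \<tau> t \<in> H01 \<Omega>"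
      using Lp_space_infinity[OF P(1)] by metis+
    obtain \<psi>' where \<psi>': "has_time_deriv T (\<lambda>t. fst (\<psi> \<tau> t)) (fst \<psi>\<^sub>0) \<psi>'" using P(2) by blast
    then have int': "integrable (time_measure T) \<psi>'" by (simp add: has_conv_deriv_def)
    have c\<phi>: "causal \<phi>" unfolding \<phi>_def
      by (intro causal_trunc Bochner_Integration.integrable_diff int time_measure_const)
    have orth: "AE s in lborel. \<phi> s \<bullet> x = 0" if "\<And>\<xi>. \<xi> \<in> H01 \<Omega> \<Longrightarrow> \<xi> \<bullet> x = 0" for x
      unfolding \<phi>_def by (rule trunc_difference_orthogonal[OF H assms(8) that])
    have orth': "AE s in lborel. (\<phi> s - \<phi>\<^sub>0 s) \<bullet> x = 0" if x: "\<And>\<xi>. \<xi> \<in> H01 \<Omega> \<Longrightarrow> \<xi> \<bullet> x = 0" for x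
    proof -
      have "AE s in lborel. \<phi>\<^sub>0 s \<bullet> x = 0"
        unfolding \<phi>\<^sub>0_def by (rule trunc_difference_orthogonal[OF B(4) assms(8) x])
      moreover have "AE s in lborel. \<phi> s \<bullet> x = 0" by (rule orth) (rule x)
      ultimately show ?thesis by eventually_elim (simp add: inner_diff_left)
    qed
    have A: "0 \<le> \<tau> powr a" "\<tau> powr a \<le> 1" using \<tau>(3) const by auto
    note dis = dissip[rule_format, OF A(1) \<tau>(3), folded \<nu>_def]
    have b1: "norm (mol h 3 (\<lambda>s. fst (\<phi> s)) t) \<le> C" if "0 < h" "t < T" for h t
    proof -
      have "norm (mol h 3 (\<lambda>s. fst (\<phi> s)) t) \<le> Q * sqrt (2 / ((\<aa> - \<alpha>) * \<alpha>))"
        unfolding Q_def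
        by (rule uniform_bound(1)[OF P(3) \<mu> \<nu> c\<phi> cf that(1) _ A const(2,3) \<beta> Fb0 const(4) _ dis that(2)],
            fact orth, fact Fb)
      then show ?thesis by (simp add: C_def)
    qed
    have b2: "norm (mol h 4 (\<lambda>s. snd (\<phi> s)) t) \<le> C" if "0 < h" "t < T" for h t
    proof -
      have "norm (mol h 4 (\<lambda>s. snd (\<phi> s)) t) \<le> Q * (sqrt (2 * \<alpha> / (c\<^sup>2 * \<bb>)) + sqrt (2 / \<kappa>)) / \<alpha>"
        unfolding Q_def
        by (rule uniform_bound(2)[OF P(3) \<mu> \<nu> c\<phi> cf that(1) _ A const(2,3) \<beta> Fb0 const(4) _ dis that(2)],
            fact orth, fact Fb)
      then show ?thesis by (simp add: C_def)
    qed
    \<comment> \<open>As a difference of primitives of the two velocities it is continuous in time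
      and agrees almost everywhere with the difference of the solutions, which allows the limit of
      vanishing width at each \<open>t\<close>.\<close>
    define \<sigma> where "\<sigma> t = prim (trunc T \<psi>') t - prim (trunc T \<psi>\<^sub>t) t" for t
    have c\<sigma>: "ccont \<sigma>" unfolding \<sigma>_def[abs_def] by (intro ccont_diff ccont_prim causal_trunc int' B\<^sub>t)
    have "AE t in time_measure T. prim (trunc T \<psi>') t = fst (\<phi> t)"
      unfolding \<phi>_def by (rule has_time_deriv_prim[OF \<psi>'])
    with \<phi>\<^sub>0_deriv have \<sigma>: "AE t in time_measure T. fst (\<phi> t) - fst (\<phi>\<^sub>0 t) = \<sigma> t"
      by eventually_elim (simp add: \<sigma>_def)
    have err: "norm (\<sigma> t) \<le> sqrt (2 * K / \<aa>) * sqrt (\<tau> powr a)" if t: "0 \<le> t" "t < T" for t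
    proof -
      have "\<aa> / 2 * (norm (\<sigma> t))\<^sup>2 \<le> \<tau> powr a * K"
      proof (rule relaxation_error[OF c\<phi> c\<phi>\<^sub>0 c\<sigma> \<sigma> _ t(2)])
        fix h :: real assume h: "0 < h"
        show "\<aa> / 2 * (norm (mol h 4 (\<lambda>s. fst (\<phi> s) - fst (\<phi>\<^sub>0 s)) t))\<^sup>2 \<le> \<tau> powr a * K"
          unfolding K_def
          by (rule mollified_difference_bound[OF P(3) P0(3) \<mu>(1) \<nu> dp[folded \<nu>_def] c\<phi> c\<phi>\<^sub>0 h _ A(1) m
                less_imp_le[OF \<beta>] zero_le_power2 less_imp_le[OF D] C C\<^sub>0 b1[OF h] b2[OF h] lim_bound1[OF h] lim_bound2[OF h] t],
              fact orth')
      qed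
      then have "(norm (\<sigma> t))\<^sup>2 \<le> 2 * K / \<aa> * \<tau> powr a" using m by (simp add: field_simps)
      then have "norm (\<sigma> t) \<le> sqrt (2 * K / \<aa> * \<tau> powr a)" by (rule real_le_rsqrt)
      then show ?thesis by (simp only: real_sqrt_mult)
    qed
    show ?thesis
    proof (rule Linf_norm_le[OF assms(2)])
      show "AE t in time_measure T. norm (fst (\<psi> \<tau> t) - fst (\<psi>lim t)) \<le> sqrt (2 * K / \<aa>) * sqrt (\<tau> powr a)"
        using \<sigma> unfolding AE_time_measure
      proof eventually_elim
        case (elim t)
        show ?case
        proof
          assume t: "0 < t \<and> t < T"
          then have "fst (\<psi> \<tau> t) - fst (\<psi>lim t) = \<sigma> t" using elim by (simp add: \<phi>_def \<phi>\<^sub>0_def trunc_def)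
          then show "norm (fst (\<psi> \<tau> t) - fst (\<psi>lim t)) \<le> sqrt (2 * K / \<aa>) * sqrt (\<tau> powr a)"
            using err[of t] t by simp
        qed
      qed
    qed (use K0 m in simp)
  qed
  show ?thesis
  proof (rule bigoI[of _ "sqrt (2 * K / \<aa>)"])
    \<comment> \<open>Small \<tau> brings \<tau>^a below \<open>A\<^sub>0\<close>, where the
      dissipation with the fixed \<kappa> is available.\<close>
    have "((\<lambda>\<tau>. \<tau> powr a) \<longlongrightarrow> 0) (at_right 0)"
      by (rule tendsto_zero_powrI[OF tendsto_ident_at tendsto_const _ assms(6)])
        (simp add: eventually_at_right_less[THEN eventually_mono])
    then have "\<forall>\<^sub>F \<tau> in at_right 0. \<tau> powr a < A\<^sub>0" using const(5) by (rule order_tendstoD(2))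
    moreover have "\<forall>\<^sub>F \<tau> in at_right 0. 0 < \<tau> \<and> \<tau> < \<tau>bar"
      unfolding eventually_at_right_field using assms(7) by blast
    ultimately show "\<forall>\<^sub>F \<tau> in at_right 0. norm (Linf_norm T (\<lambda>t. fst (\<psi> \<tau> t) - fst (\<psi>lim t)))
        \<le> sqrt (2 * K / \<aa>) * norm (sqrt (\<tau> powr a))"
      by eventually_elim (use estimate in simp)
  qed
qed

end
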